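(* Let $f_0=sq_0+tq_3$, $f_1=sq_1+tq_4$, $f_2=sq_2+tq_5$ with $q_0,\dots,q_5\in\mathbb K[u,v]_n$ linearly independent over $\mathbb K$ (so $n\ge5$), and assume $W=\operatorname{Span}\{f_0,f_1,f_2\}$ is basepoint free. Let $N$ be the $6\times5$ Hilbert–Burch matrix of the ideal $Q=\langle q_0,\dots,q_5\rangle\subset\mathbb K[u,v]$. Then $I_W=\langle f_0,f_1,f_2\rangle$ has exactly five minimal first syzygies whose entries are quadratic in $\{s,t\}$ (that is, of bidegree $(3,m)$ for some $m$), and these are obtained from $N$; if the columns of $N$ have degrees $b_1,\dots,b_5$, then these five syzygies on $I_W$ have bidegrees $(3,2n-b_1),\dots,(3,2n-b_5)$.
   Context: $\mathbb K$ is a field, $R=\mathbb K[s,t;u,v]$ is $\mathbb Z^2$-graded with $\deg s=\deg t=(1,0)$, $\deg u=\deg v=(0,1)$. $W$ is basepoint free if $\sqrt{I_W}=\langle s,t\rangle\cap\langle u,v\rangle$. The first syzygy module is $\operatorname{Syz}=\ker\big(R(-1,-n)^3\xrightarrow{(f_0,f_1,f_2)}R\big)$; a syzygy whose entries have bidegree $\mathbf e$ has bidegree $\mathbf e+(1,n)$. Minimal first syzygies are the elements of a minimal bihomogeneous generating set of $\operatorname{Syz}$; the number of them of bidegree $\mathbf a$ is $\dim_{\mathbb K}(\operatorname{Syz}/\langle s,t,u,v\rangle\operatorname{Syz})_{\mathbf a}$. The Hilbert–Burch matrix $N$ of $Q$ is the matrix in the minimal graded free resolution $0\to\bigoplus_{j=1}^5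 S(-n-b_j)\xrightarrow{N}S(-n)^6\to Q\to0$ over $S=\mathbb K[u,v]$; the entries of its $j$-th column are homogeneous of degree $b_j$, and its maximal minors are, up to sign and scalar, the $q_i$. *)

theory Defs
  imports "HOL-Analysis.Determinants" "HOL-Library.Poly_Mapping"
begin

datatype indet = Xs | Xt | Xu | Xv

text \<open>
  The multivariate polynomial ring over 'k in the four indeterminates: a polynomial is a
  finitely supported map from monomials (exponent vectors) to coefficients, and
  multiplication is convolution.
\<close>

type_synonym 'k bipoly = "(indet \<Rightarrow>\<^sub>0 nat) \<Rightarrow>\<^sub>0 'k"

definition var :: "indet \<Rightarrow> 'k::comm_ring_1 bipoly" where
  "var x = Poly_Mapping.single (Poly_Mapping.single x 1) 1"

definition const :: "'k::comm_ring_1 \<Rightarrow> 'k bipoly" where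
  "const c = Poly_Mapping.single 0 c"

definition mon_bideg :: "(indet \<Rightarrow>\<^sub>0 nat) \<Rightarrow> int \<times> int" where
  "mon_bideg m =
     (int (Poly_Mapping.lookup m Xs) + int (Poly_Mapping.lookup m Xt),
      int (Poly_Mapping.lookup m Xu) + int (Poly_Mapping.lookup m Xv))"

text \<open>
  The component of R in bidegree e; it contains 0 for every e and is zero as soon as one of
  the two entries of e is negative.
\<close>

definition R_comp :: "int \<times> int \<Rightarrow> 'k::comm_ring_1 bipoly set" where
  "R_comp e = {p. \<forall>m \<in> Poly_Mapping.keys p. mon_bideg m = e}"

text \<open>
  K[u,v] is the subring of polynomials in which s and t do not occur; its component of
  degree d is \<open>R_comp (0, d)\<close>.
\<close>

definition Kuv :: "'k::comm_ring_1 bipoly set" where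
  "Kuv = {p. \<forall>m \<in> Poly_Mapping.keys p.
     Poly_Mapping.lookup m Xs = 0 \<and> Poly_Mapping.lookup m Xt = 0}"

definition ideal_gen :: "'r::comm_ring_1 set \<Rightarrow> 'r set" where
  "ideal_gen B = module.span (*) B"

definition radical :: "'r::comm_ring_1 set \<Rightarrow> 'r set" where
  "radical I = {p. \<exists>k. p ^ k \<in> I}"

definition basepoint_free :: "'k::field bipoly ^ 3 \<Rightarrow> bool" where
  "basepoint_free f \<longleftrightarrow>
     radical (ideal_gen {f $ i | i. True}) =
       ideal_gen {var Xs, var Xt} \<inter> ideal_gen {var Xu, var Xv}"

definition syz :: "'r::comm_ring_1 ^ 3 \<Rightarrow> ('r ^ 3) set" where
  "syz f = {A. (\<Sum>i\<in>UNIV. A $ i * f $ i) = 0}"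

text \<open>
  The grading of Syz is that of \<open>R(-1,-n)\<^sup>3\<close>: entries of bidegree e give a syzygy of
  bidegree e + (1,n).
\<close>

definition syz_comp :: "nat \<Rightarrow> 'k::field bipoly ^ 3 \<Rightarrow> int \<times> int \<Rightarrow> ('k bipoly ^ 3) set" where
  "syz_comp n f a = {A \<in> syz f. \<forall>i. A $ i \<in> R_comp (fst a - 1, snd a - int n)}"

definition max_syz :: "'k::field bipoly ^ 3 \<Rightarrow> ('k bipoly ^ 3) set" where
  "max_syz f = module.span (*s) {var x *s A | x A. A \<in> syz f}"

definition kscale :: "'k::field \<Rightarrow> 'k bipoly ^ 3 \<Rightarrow> 'k bipoly ^ 3" where
  "kscale c A = const c *s A"

text \<open>The classes of the elements of B are distinct and form a K-basis of V/U.\<close>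

definition basis_mod ::
  "('k::field bipoly ^ 3) set \<Rightarrow> ('k bipoly ^ 3) set \<Rightarrow> ('k bipoly ^ 3) set \<Rightarrow> bool" where
  "basis_mod V U B \<longleftrightarrow>
     finite B \<and> B \<subseteq> V \<and> V \<subseteq> module.span kscale (B \<union> U) \<and>
     (\<forall>c. (\<Sum>A\<in>B. kscale (c A) A) \<in> U \<longrightarrow> (\<forall>A\<in>B. c A = 0))"

definition quotient_dim ::
  "('k::field bipoly ^ 3) set \<Rightarrow> ('k bipoly ^ 3) set \<Rightarrow> nat" where
  "quotient_dim V U = (THE d. \<exists>B. basis_mod V U B \<and> card B = d)"

text \<open>
  The K-dimension of \<open>(Syz/\<langle>s,t,u,v\<rangle>Syz)\<^sub>a\<close>; the graded pieces are finite-dimensional.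
\<close>

definition num_min_syz :: "nat \<Rightarrow> 'k::field bipoly ^ 3 \<Rightarrow> int \<times> int \<Rightarrow> nat" where
  "num_min_syz n f a = quotient_dim (syz_comp n f a) (max_syz f \<inter> syz_comp n f a)"

definition min_bihom_gens :: "nat \<Rightarrow> 'k::field bipoly ^ 3 \<Rightarrow> ('k bipoly ^ 3) set \<Rightarrow> bool" where
  "min_bihom_gens n f G \<longleftrightarrow>
     (\<forall>A\<in>G. \<exists>a. A \<in> syz_comp n f a) \<and>
     module.span (*s) G = syz f \<and>
     (\<forall>H. H \<subset> G \<longrightarrow> module.span (*s) H \<noteq> syz f)"

text \<open>
  N is the matrix of the first map in a minimal graded free resolution, over \<open>S = K[u,v]\<close>,
  \<open>0 \<rightarrow> \<Oplus>\<^sub>j S(-n-b\<^sub>j) \<rightarrow> S(-n)\<^sup>6 \<rightarrow> \<langle>q\<^sub>0,\<dots>,q\<^sub>5\<rangle> \<rightarrow> 0\<close>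
  whose augmentation sends the i-th basis vector to \<open>q\<^sub>i\<close>. The conjuncts: N is homogeneous
  with j-th column of degree \<open>b\<^sub>j\<close>, the resolution is minimal, it is exact at \<open>S(-n)\<^sup>6\<close>,
  and N is injective.
\<close>

definition hilbert_burch ::
  "'k::field bipoly ^ 6 \<Rightarrow> (5 \<Rightarrow> nat) \<Rightarrow> 'k bipoly ^ 5 ^ 6 \<Rightarrow> bool" where
  "hilbert_burch q b N \<longleftrightarrow>
     (\<forall>i j. N $ i $ j \<in> R_comp (0, int (b j))) \<and>
     (\<forall>i j. N $ i $ j \<in> ideal_gen {var Xu, var Xv}) \<and>
     {x. (\<forall>i. x $ i \<in> Kuv) \<and> (\<Sum>i\<in>UNIV. x $ i * q $ i) = 0} =
       {N *v y | y. \<forall>j. y $ j \<in> Kuv} \<and>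
     (\<forall>y. (\<forall>j. y $ j \<in> Kuv) \<and> N *v y = 0 \<longrightarrow> y = 0)"

text \<open>
  The syzygy on f attached to the j-th column of N. Write \<open>N\<^sub>k\<close> for the rows of N and
  \<open>r\<^sub>k = t N\<^sub>k - s N\<^sub>k\<^sub>+\<^sub>3\<close> for k = 0,1,2. Since \<open>f = q [s I; t I]\<close> and the kernel of q is the
  image of N, a vector A is a syzygy on f iff \<open>(sA, tA) = N c\<close> for some c, and such a c is
  killed by the 3 x 5 matrix with rows \<open>r\<^sub>0, r\<^sub>1, r\<^sub>2\<close>. Deleting the j-th column of that
  matrix, the signed maximal minors of the remaining 3 x 4 matrix (Cramer's rule) give such
  a vector: \<open>c\<^sub>k = det (r\<^sub>0, r\<^sub>1, r\<^sub>2, e\<^sub>j, e\<^sub>k)\<close>. Then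
  \<open>(N c)\<^sub>i = det (r\<^sub>0, r\<^sub>1, r\<^sub>2, e\<^sub>j, N\<^sub>i)\<close>, and dividing \<open>(N c)\<^sub>i\<close> by s (equivalently
  \<open>(N c)\<^sub>i\<^sub>+\<^sub>3\<close> by t) yields the determinants below.
\<close>

definition quadratic_syz :: "'k::field bipoly ^ 5 ^ 6 \<Rightarrow> 5 \<Rightarrow> 'k bipoly ^ 3" where
  "quadratic_syz N j =
     (let r0 = var Xt *s N $ 0 - var Xs *s N $ 3;
          r1 = var Xt *s N $ 1 - var Xs *s N $ 4;
          r2 = var Xt *s N $ 2 - var Xs *s N $ 5;
          e = axis j 1
      in vector
        [det (vector [N $ 0, r1, r2, e, N $ 3] :: 'k bipoly ^ 5 ^ 5),
         det (vector [r0, N $ 1, r2, e, N $ 4] :: 'k bipoly ^ 5 ^ 5),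
         det (vector [r0, r1, N $ 2, e, N $ 5] :: 'k bipoly ^ 5 ^ 5)])"

end

theory Submission
  imports Defs
begin

text \<open>
  Write \<open>S = K[u,v]\<close>, let P and B be the upper and the lower three rows of N, and let \<open>M = t P - s B\<close>,
  a 3 by 5 matrix over R with rows \<open>r\<^sub>0, r\<^sub>1, r\<^sub>2\<close>. Since f is q applied to the pair of blocks
  \<open>(s I, t I)\<close> and N generates the kernel of q over R as well (\<open>kernel_q\<close>), a syzygy A on f corresponds
  to a vector c with \<open>N c = (s A, t A)\<close>, and such a c satisfies \<open>M c = 0\<close>. If A is quadratic in s and
  t, then c is cubic. Obvious solutions are \<open>\<omega>(g) = det (r\<^sub>0, r\<^sub>1, r\<^sub>2, g, -)\<close> with g in \<open>S\<^sup>5\<close>, called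
  \<open>cramer_vec M g\<close> below; for g a unit vector they give the five syzygies of the theorem
  (\<open>quadratic_syz_cramer\<close>). Two facts about them carry the proof.

  First, every cubic solution c equals \<open>\<omega>(g)\<close> for a unique g in \<open>S\<^sup>5\<close> (\<open>kernel_M_degree3\<close>,
  \<open>cramer_vec_inj_Kuv\<close>), so the syzygies that are quadratic in s and t form a free S-module on the five
  given ones. Second, if \<open>\<omega>(g)\<close> is divisible by s or by t, then the entries of g lie in the ideal
  generated by u and v (\<open>cramer_vec_multiple\<close>). The products of s or t with syzygies linear in s and t
  therefore contribute nothing modulo u and v, and all five syzygies are minimal
  (\<open>max_syz3_combination\<close>). Their bidegrees come from \<open>\<Sum> b\<^sub>j = n\<close>, the degree count in the
  Hilbert-Burch theorem (\<open>sum_b\<close>).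

  Geometrically the first fact holds because the Buchsbaum-Rim complex of M is exact on the product of
  two projective lines, where basepoint freeness makes M surjective; the obstruction to lifting a
  section of degree three to a combination of Cramer vectors lies in the first cohomology of
  \<open>O(-1)\<close> on the first factor, and this vanishes. The algebraic counterpart of local exactness is the
  predicate \<open>contracts\<close>: by Cramer's rule multiplication by a maximal minor of M is null-homotopic, and
  up to powers of the variables the forms \<open>f\<^sub>i\<close> are combinations of such minors, because they are
  Hilbert-Burch minors of the six rows of M and P, or of M and B (\<open>contracts_pencil\<close>). Together with
  basepoint freeness this gives a homotopy for \<open>x\<^sup>k y\<^sup>k\<close> whenever x is u or v and y is s or t. The powers
  of s and t are then removed by a degree argument that replaces the vanishing of cohomology
  (\<open>split_stdeg\<close>), and the powers of u and v by comparison of the two cases.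

  The passage to numbers of minimal syzygies is linear algebra modulo a subspace, and the required
  minimal generating set is obtained from the graded Nakayama lemma.
\<close>

section \<open>Determinants over commutative rings\<close>

text \<open>Both sides are the cofactor of A at position (k, l): in the Leibniz formula only the
  permutations sending k to l survive, with the same contribution.\<close>

lemma det_unit_row_eq_unit_column:
  fixes A :: "'r::comm_ring_1^'n^'n"
  shows "det (\<chi> i. if i = k then axis l 1 else A $ i) =
         det (\<chi> i j. if j = l then axis k 1 $ i else A $ i $ j)"
  unfolding det_def
proof (rule sum.cong[OF refl])
  fix p :: "'n \<Rightarrow> 'n"
  assume "p \<in> {p. p permutes UNIV}"
  then have p: "p permutes UNIV" by simp
  have "(\<Prod>i\<in>UNIV. (\<chi> i. if i = k then axis l 1 else A $ i) $ i $ p i) =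
        (\<Prod>i\<in>UNIV. (\<chi> i j. if j = l then axis k 1 $ i else A $ i $ j) $ i $ p i)"
  proof (cases "p k = l")
    case True
    have "p i = l \<longleftrightarrow> i = k" for i
      using True permutes_inj[OF p] by (auto dest: injD)
    then show ?thesis
      using True by (intro prod.cong) (auto simp: axis_def)
  next
    case False
    obtain i where i: "p i = l"
      using permutes_surj[OF p] by (metis surjD)
    have "(\<Prod>i\<in>UNIV. (\<chi> i j. if j = l then axis k 1 $ i else A $ i $ j) $ i $ p i) = 0"
      by (rule prod_zero, simp, rule bexI[of _ i]) (use False i in \<open>auto simp: axis_def\<close>)
    moreover have "(\<Prod>i\<in>UNIV. (\<chi> i. if i = k then axis l 1 else A $ i) $ i $ p i) = 0"
      by (rule prod_zero, simp, rule bexI[of _ k]) (use False in \<open>auto simp: axis_def\<close>)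
    ultimately show ?thesis by simp
  qed
  then show "of_int (sign p) * (\<Prod>i\<in>UNIV. (\<chi> i. if i = k then axis l 1 else A $ i) $ i $ p i) =
     of_int (sign p) * (\<Prod>i\<in>UNIV. (\<chi> i j. if j = l then axis k 1 $ i else A $ i $ j) $ i $ p i)"
    by simp
qed

lemma det_row_expansion:
  fixes A :: "'r::comm_ring_1^'n^'n"
  shows "det (\<chi> i. if i = k then x else A $ i) =
         (\<Sum>l\<in>UNIV. x $ l * det (\<chi> i. if i = k then axis l 1 else A $ i))"
proof -
  have "det (\<chi> i. if i = k then x else A $ i) =
        det (\<chi> i. if i = k then (\<Sum>l\<in>UNIV. x $ l *s axis l 1) else A $ i)"
    by (simp only: basis_expansion)
  then show ?thesis
    by (simp add: det_linear_row_sum det_row_mul)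
qed

text \<open>The columns of A paired with its cofactors; turning the unit row into a unit column makes
  the sum the expansion of a determinant in which column m has been replaced by column l.\<close>

lemma cofactor_column:
  fixes A :: "'r::comm_ring_1^'n^'n"
  shows "(\<Sum>k\<in>UNIV. A $ k $ l * det (\<chi> i. if i = k then axis m 1 else A $ i)) =
         (if l = m then det A else 0)"
proof -
  let ?T = "\<lambda>x. (\<chi> i. if i = m then x else transpose A $ i) :: 'r^'n^'n"
  have T: "transpose (?T x) = (\<chi> i j. if j = m then x $ i else A $ i $ j)" for x
    by (simp add: transpose_def vec_eq_iff)
  have "(\<Sum>k\<in>UNIV. A $ k $ l * det (\<chi> i. if i = k then axis m 1 else A $ i)) =
        (\<Sum>k\<in>UNIV. column l A $ k * det (?T (axis k 1)))"
    unfolding det_unit_row_eq_unit_column T[symmetric] det_transpose by (simp add: column_def)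
  also have "\<dots> = det (?T (column l A))"
    by (rule det_row_expansion[symmetric])
  also have "\<dots> = (if l = m then det A else 0)"
  proof (cases "l = m")
    case True
    have "?T (column l A) = transpose A"
      unfolding True by (simp add: transpose_def column_def vec_eq_iff)
    then have "det (?T (column l A)) = det A"
      using det_transpose[of A] by (rule ssubst)
    then show ?thesis unfolding if_P[OF True] .
  next
    case False
    then have "row l (?T (column l A)) = row m (?T (column l A))"
      by (simp add: row_def transpose_def column_def vec_eq_iff)
    from det_identical_rows[OF False this] show ?thesis unfolding if_not_P[OF False] .
  qed
  finally show ?thesis .
qed

text \<open>Cramer's rule in a form that needs no inverse: over any commutative ring, the determinant
  times an arbitrary vector is a combination of the rows.\<close>

lemma cramer_rows:
  fixes A :: "'r::comm_ring_1^'n^'n"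
  shows "det A *s x = (\<Sum>k\<in>UNIV. det (\<chi> i. if i = k then x else A $ i) *s A $ k)"
proof -
  have "(\<Sum>k\<in>UNIV. det (\<chi> i. if i = k then x else A $ i) *s A $ k) $ l = det A * x $ l" for l
  proof -
    have "(\<Sum>k\<in>UNIV. det (\<chi> i. if i = k then x else A $ i) *s A $ k) $ l =
      (\<Sum>k\<in>UNIV. \<Sum>m\<in>UNIV. x $ m * (A $ k $ l * det (\<chi> i. if i = k then axis m 1 else A $ i)))"
      unfolding det_row_expansion[of _ x]
      by (simp add: sum_distrib_left sum_distrib_right mult_ac)
    also have "\<dots> = (\<Sum>m\<in>UNIV. x $ m * (if l = m then det A else 0))"
      by (subst sum.swap) (simp only: sum_distrib_left[symmetric] cofactor_column)
    finally show ?thesis by (simp add: mult.commute if_distrib sum.delta' cong: if_cong)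
  qed
  then show ?thesis by (simp add: vec_eq_iff)
qed

text \<open>The qualitative half of the Cauchy-Binet formula. Every row of the product is a combination
  of rows of N, so expanding the rows one at a time by multilinearity leaves only determinants
  of rows selected from N. The predicate I plays the role of membership in an ideal.\<close>

lemma det_mult_mem_ideal:
  fixes N :: "'r::comm_ring_1^'n^'m" and Y :: "'r^'m^'n"
  assumes add: "\<And>x y. I x \<Longrightarrow> I y \<Longrightarrow> I (x + y)" and mult: "\<And>c x. I x \<Longrightarrow> I (c * x)"
    and rows: "\<And>\<phi>. I (det (\<chi> i. N $ \<phi> i))"
  shows "I (det (Y ** N))"
proof -
  have zero: "I 0" using mult[OF rows, of 0] by simp
  have sum: "I (\<Sum>k\<in>K. g k)" if "finite K" "\<And>k. I (g k)" for g :: "'m \<Rightarrow> 'r" and K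
    using that by (induction K rule: finite_induct) (auto intro: zero add)
  have "I (det (\<chi> i. if i \<in> T then \<Sum>k\<in>UNIV. Y $ i $ k *s N $ k else N $ \<phi> i))" for T \<phi>
  proof (induction T arbitrary: \<phi> rule: finite_induct[OF finite])
    case 1
    then show ?case using rows by simp
  next
    case (2 a T)
    let ?row = "\<lambda>\<psi> i. if i \<in> T then \<Sum>k\<in>UNIV. Y $ i $ k *s N $ k else N $ \<psi> i"
    have "(\<chi> i. if i \<in> insert a T then \<Sum>k\<in>UNIV. Y $ i $ k *s N $ k else N $ \<phi> i) =
          (\<chi> i. if i = a then \<Sum>k\<in>UNIV. Y $ a $ k *s N $ k else ?row \<phi> i)"
      by (auto simp: vec_eq_iff)
    moreover have "det (\<chi> i. if i = a then \<Sum>k\<in>UNIV. Y $ a $ k *s N $ k else ?row \<phi> i) =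
          (\<Sum>k\<in>UNIV. Y $ a $ k * det (\<chi> i. if i = a then N $ k else ?row \<phi> i))"
      by (simp add: det_linear_row_sum det_row_mul)
    moreover have "(\<chi> i. if i = a then N $ k else ?row \<phi> i) = (\<chi> i. ?row (\<phi>(a := k)) i)" for k
      using \<open>a \<notin> T\<close> by (auto simp: vec_eq_iff)
    ultimately show ?case using 2 by (auto intro!: sum mult)
  qed
  then have "I (det (\<chi> i. if i \<in> UNIV then \<Sum>k\<in>UNIV. Y $ i $ k *s N $ k else N $ undefined i))"
    .
  moreover have "Y ** N = (\<chi> i. if i \<in> UNIV then \<Sum>k\<in>UNIV. Y $ i $ k *s N $ k else N $ undefined i)"
    by (simp add: matrix_matrix_mult_def vec_eq_iff)
  ultimately show ?thesis by (simp only:)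
qed

text \<open>The signed maximal minors of a matrix with one row more than it has columns. The injection
  \<open>\<iota>\<close> enumerates all rows except row z; the minor omitting row \<open>\<iota> k\<close> is taken with row z
  standing in the place of the omitted row, which is why all signs except that at z are equal.\<close>

definition minors :: "('n \<Rightarrow> 'm) \<Rightarrow> 'm \<Rightarrow> 'r::comm_ring_1^'n^'m \<Rightarrow> 'r^'m" where
  "minors \<iota> z N = (\<chi> k. if k = z then det (\<chi> i. N $ \<iota> i)
                       else - det (\<chi> i. if \<iota> i = k then N $ z else N $ \<iota> i))"

text \<open>This is Cramer's rule for row z in terms of the other rows.\<close>

lemma minors_relation:
  fixes N :: "'r::comm_ring_1^'n^'m"
  assumes "inj \<iota>" "range \<iota> = - {z}"
  shows "minors \<iota> z N v* N = 0"
proof -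
  let ?A = "(\<chi> i. N $ \<iota> i) :: 'r^'n^'n"
  have "(minors \<iota> z N v* N) $ j = 0" for j
  proof -
    have UN: "UNIV = insert z (range \<iota>)" "z \<notin> range \<iota>" using assms by auto
    have "(minors \<iota> z N v* N) $ j = minors \<iota> z N $ z * N $ z $ j +
        (\<Sum>k\<in>range \<iota>. minors \<iota> z N $ k * N $ k $ j)"
      unfolding vector_matrix_mult_def by (simp, subst UN(1), subst sum.insert) (use UN in auto)
    also have "(\<Sum>k\<in>range \<iota>. minors \<iota> z N $ k * N $ k $ j) =
        (\<Sum>k\<in>UNIV. minors \<iota> z N $ \<iota> k * N $ \<iota> k $ j)"
      using assms(1) by (simp add: sum.reindex)
    also have "\<dots> = - (\<Sum>k\<in>UNIV. det (\<chi> i. if i = k then N $ z else ?A $ i) * ?A $ k $ j)"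
    proof -
      have "minors \<iota> z N $ \<iota> k = - det (\<chi> i. if i = k then N $ z else ?A $ i)" for k
      proof -
        have "\<iota> k \<noteq> z" "\<And>i. \<iota> i = \<iota> k \<longleftrightarrow> i = k" using UN(2) assms(1) by (auto simp: inj_eq)
        then show ?thesis by (simp add: minors_def cong: if_cong)
      qed
      then show ?thesis by (simp add: sum_negf)
    qed
    also have "(\<Sum>k\<in>UNIV. det (\<chi> i. if i = k then N $ z else ?A $ i) * ?A $ k $ j) =
        (det ?A *s N $ z) $ j"
      unfolding cramer_rows[of ?A "N $ z"] by simp
    finally show ?thesis by (simp add: minors_def)
  qed
  then show ?thesis by (simp add: vec_eq_iff)
qed

text \<open>A selection of rows either repeats a row, and then its determinant vanishes, or it omits
  exactly one row and is a permutation of the selection that defines the corresponding minor.\<close>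

lemma det_mult_in_minors:
  fixes N :: "'r::comm_ring_1^'n^'m" and Y :: "'r^'m^'n"
  assumes "inj \<iota>" "range \<iota> = - {z}"
  shows "\<exists>c. det (Y ** N) = (\<Sum>k\<in>UNIV. c k * minors \<iota> z N $ k)"
proof (rule det_mult_mem_ideal)
  fix \<phi> :: "'n \<Rightarrow> 'm"
  let ?A = "(\<chi> i. N $ \<phi> i) :: 'r^'n^'n"
  show "\<exists>c. det ?A = (\<Sum>k\<in>UNIV. c k * minors \<iota> z N $ k)"
  proof (cases "inj \<phi>")
    case False
    then obtain i j where ij: "i \<noteq> j" "\<phi> i = \<phi> j" by (auto simp: inj_def)
    then have "det ?A = 0" using det_identical_rows[of i j ?A] by (simp add: row_def)
    then show ?thesis by (intro exI[of _ "\<lambda>_. 0"]) simp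
  next
    case True
    have "card (range \<phi>) = card (range \<iota>)" using True assms(1) by (simp add: card_image)
    moreover have "- {z} \<noteq> UNIV" by blast
    ultimately have "range \<phi> \<noteq> UNIV"
      using assms(2) card_subset_eq[of UNIV "- {z}"] by auto
    then obtain k where k: "k \<notin> range \<phi>" by auto
    define \<psi> where "\<psi> i = (if \<iota> i = k then z else \<iota> i)" for i
    have inj: "inj \<psi>"
      using assms by (auto simp: inj_def \<psi>_def)
    have minor: "det (\<chi> i. N $ \<psi> i) = minors \<iota> z N $ k \<or> det (\<chi> i. N $ \<psi> i) = - minors \<iota> z N $ k"
    proof (cases "k = z")
      case True
      then have "\<psi> = \<iota>" using assms(2) by (auto simp: \<psi>_def)
      then show ?thesis using True by (simp add: minors_def)
    next
      case False
      have "(\<chi> i. N $ \<psi> i) = (\<chi> i. if \<iota> i = k then N $ z else N $ \<iota> i)"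
        by (simp add: vec_eq_iff \<psi>_def)
      then show ?thesis using False by (simp add: minors_def)
    qed
    have "k \<notin> range \<psi>" using assms(2) by (auto simp: \<psi>_def)
    have cardk: "card (- {k}) = card (- {z})" by (simp add: Compl_eq_Diff_UNIV)
    have "range \<psi> = - {k}"
      using \<open>k \<notin> range \<psi>\<close> inj assms cardk
      by (intro card_subset_eq) (auto simp: card_image simp flip: assms(2))
    then have ran: "range \<phi> \<subseteq> range \<psi>" using k by auto
    define p where "p = inv \<psi> \<circ> \<phi>"
    have \<phi>: "\<phi> i = \<psi> (p i)" for i
      using ran by (simp add: p_def f_inv_into_f subset_eq)
    have "inj p" using True by (auto simp: inj_def \<phi>)
    then have "p permutes UNIV"
      by (intro bij_imp_permutes) (auto simp: bij_betw_def finite_UNIV_inj_surj)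
    then have "det ?A = of_int (sign p) * det (\<chi> i. N $ \<psi> i)"
      using det_permute_rows[of p "\<chi> i. N $ \<psi> i"] by (simp add: \<phi>)
    with minor obtain e where "det ?A = e * minors \<iota> z N $ k"
      by (metis minus_mult_commute)
    then show ?thesis
      by (intro exI[of _ "\<lambda>l. if l = k then e else 0"])
         (simp add: if_distrib[of "\<lambda>x. x * _"] cong: if_cong)
  qed
next
  fix x y
  assume "\<exists>c. x = (\<Sum>k\<in>UNIV. c k * minors \<iota> z N $ k)" "\<exists>c. y = (\<Sum>k\<in>UNIV. c k * minors \<iota> z N $ k)"
  then obtain c d where "x = (\<Sum>k\<in>UNIV. c k * minors \<iota> z N $ k)"
    "y = (\<Sum>k\<in>UNIV. d k * minors \<iota> z N $ k)" by auto
  then show "\<exists>c. x + y = (\<Sum>k\<in>UNIV. c k * minors \<iota> z N $ k)"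
    by (intro exI[of _ "\<lambda>k. c k + d k"]) (simp add: sum.distrib distrib_right)
next
  fix a x
  assume "\<exists>c. x = (\<Sum>k\<in>UNIV. c k * minors \<iota> z N $ k)"
  then obtain c where "x = (\<Sum>k\<in>UNIV. c k * minors \<iota> z N $ k)" by auto
  then show "\<exists>c. a * x = (\<Sum>k\<in>UNIV. c k * minors \<iota> z N $ k)"
    by (intro exI[of _ "\<lambda>k. a * c k"]) (simp add: sum_distrib_left mult.assoc)
qed

text \<open>The algebraic core of the Hilbert-Burch theorem. If N has a left inverse up to the scalar
  \<open>\<alpha>\<close> and its left kernel is generated by q, again up to \<open>\<alpha>\<close>, then the vector of minors is a
  multiple of q because it lies in the left kernel. Conversely \<open>\<alpha>\<close> to the power of the number of
  columns is \<open>det (Y ** N)\<close>, hence a combination of minors, and this lets the relation be turned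
  around: q is a multiple of the minors up to a power of \<open>\<alpha>\<close>.\<close>

lemma left_kernel_generator_is_minors:
  fixes N :: "'r::idom^'n^'m" and Y :: "'r^'m^'n"
  assumes \<iota>: "inj \<iota>" "range \<iota> = - {z}" and YN: "Y ** N = mat \<alpha>" and "\<alpha> \<noteq> 0"
    and ker: "\<And>x. x v* N = 0 \<Longrightarrow> \<exists>\<kappa>. \<alpha> *s x = \<kappa> *s q"
  shows "\<exists>\<kappa>. \<alpha> ^ CARD('n) *s q = \<kappa> *s minors \<iota> z N"
proof -
  let ?\<Delta> = "minors \<iota> z N"
  obtain \<kappa> where \<kappa>: "\<alpha> *s ?\<Delta> = \<kappa> *s q" using ker minors_relation[OF \<iota>] by blast
  have "det (Y ** N) = \<alpha> ^ CARD('n)"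
    unfolding YN by (subst det_diagonal) (simp_all add: mat_def)
  then obtain c where c: "\<alpha> ^ CARD('n) = (\<Sum>k\<in>UNIV. c k * ?\<Delta> $ k)"
    using det_mult_in_minors[OF \<iota>, of Y N] by auto
  define d where "d = (\<Sum>k\<in>UNIV. c k * q $ k)"
  have "\<alpha> * \<alpha> ^ CARD('n) = (\<Sum>k\<in>UNIV. c k * (\<alpha> *s ?\<Delta>) $ k)"
    unfolding c by (simp add: sum_distrib_left mult_ac)
  then have *: "\<alpha> * \<alpha> ^ CARD('n) = \<kappa> * d"
    unfolding \<kappa> d_def by (simp add: sum_distrib_left mult_ac)
  have "\<alpha> * (\<alpha> ^ CARD('n) * q $ i) = \<alpha> * (d * ?\<Delta> $ i)" for i
  proof -
    have "\<alpha> * (\<alpha> ^ CARD('n) * q $ i) = (\<kappa> * d) * q $ i" using * by (simp add: mult.assoc)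
    also have "\<dots> = d * (\<kappa> *s q) $ i" by (simp add: mult_ac)
    also have "\<dots> = \<alpha> * (d * ?\<Delta> $ i)" unfolding \<kappa>[symmetric] by (simp add: mult_ac)
    finally show ?thesis .
  qed
  then have "\<alpha> ^ CARD('n) *s q = d *s ?\<Delta>" using \<open>\<alpha> \<noteq> 0\<close> by (simp add: vec_eq_iff)
  then show ?thesis by blast
qed

section \<open>The Buchsbaum-Rim complex of a 3 by 5 matrix\<close>

text \<open>The determinant as a bilinear alternating function of the rows i and j, the other rows being
  those of A.\<close>

definition det2 :: "('n \<Rightarrow> 'r^'n) \<Rightarrow> 'n \<Rightarrow> 'n \<Rightarrow> 'r^'n \<Rightarrow> 'r^'n \<Rightarrow> 'r::comm_ring_1" where
  "det2 A i j x y = det (\<chi> l. if l = i then x else if l = j then y else A l)"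

lemma det2_add_left: "det2 A i j (x + x') y = det2 A i j x y + det2 A i j x' y"
  unfolding det2_def by (rule det_row_add)

lemma det2_scale_left: "det2 A i j (c *s x) y = c * det2 A i j x y"
  unfolding det2_def by (rule det_row_mul)

lemma det2_same: "i \<noteq> j \<Longrightarrow> det2 A i j x x = 0"
  unfolding det2_def by (rule det_identical_rows[of i j]) (auto simp: row_def)

lemma det2_commute: "i \<noteq> j \<Longrightarrow> det2 A i j x y = det2 A j i y x"
  unfolding det2_def by (rule arg_cong[where f = det]) (auto simp: vec_eq_iff)

lemma det2_add_right: "i \<noteq> j \<Longrightarrow> det2 A i j x (y + y') = det2 A i j x y + det2 A i j x y'"
  by (simp add: det2_commute[of i j] det2_add_left)

lemma det2_swap: "i \<noteq> j \<Longrightarrow> det2 A i j x y = - det2 A i j y x"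
  using det2_same[of i j A "x + y"]
  by (simp add: det2_add_left det2_add_right det2_same eq_neg_iff_add_eq_0)

lemma det2_diff_left: "det2 A i j (x - x') y = det2 A i j x y - det2 A i j x' y"
  using det2_add_left[of A i j x "(-1) *s x'" y] det2_scale_left[of A i j "-1" x' y]
  by (simp add: vector_sneg_minus1[symmetric])

lemma det2_sum_left: "det2 A i j (\<Sum>k\<in>K. c k *s x k) y = (\<Sum>k\<in>K. c k * det2 A i j (x k) y)"
proof (induction K rule: infinite_finite_induct)
  case (insert k K)
  then show ?case by (simp add: det2_add_left det2_scale_left)
qed (use det2_scale_left[of A i j 0 0 y] in auto)

lemma det2_sum_right:
  "i \<noteq> j \<Longrightarrow> det2 A i j x (\<Sum>k\<in>K. c k *s y k) = (\<Sum>k\<in>K. c k * det2 A i j x (y k))"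
  by (simp add: det2_commute[of i j] det2_sum_left)

lemma exhaust_5: fixes i :: 5 shows "i = 1 \<or> i = 2 \<or> i = 3 \<or> i = 4 \<or> i = 0"
proof (induct i)
  case (of_int z)
  then have "0 \<le> z" "z < 5" by simp_all
  then have "z = 0 \<or> z = 1 \<or> z = 2 \<or> z = 3 \<or> z = 4" by arith
  then show ?case by auto
qed

lemma exhaust_6: fixes i :: 6 shows "i = 1 \<or> i = 2 \<or> i = 3 \<or> i = 4 \<or> i = 5 \<or> i = 0"
proof (induct i)
  case (of_int z)
  then have "0 \<le> z" "z < 6" by simp_all
  then have "z = 0 \<or> z = 1 \<or> z = 2 \<or> z = 3 \<or> z = 4 \<or> z = 5" by arith
  then show ?case by auto
qed

lemma forall_5: "(\<forall>i::5. Q i) \<longleftrightarrow> Q 1 \<and> Q 2 \<and> Q 3 \<and> Q 4 \<and> Q 0"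
  by (metis exhaust_5)

lemma forall_6: "(\<forall>i::6. Q i) \<longleftrightarrow> Q 1 \<and> Q 2 \<and> Q 3 \<and> Q 4 \<and> Q 5 \<and> Q 0"
  by (metis exhaust_6)

lemma UNIV_5: "(UNIV :: 5 set) = {1, 2, 3, 4, 0}"
  using exhaust_5 by auto

lemma UNIV_6: "(UNIV :: 6 set) = {1, 2, 3, 4, 5, 0}"
  using exhaust_6 by auto

lemma sum_5: "sum f (UNIV :: 5 set) = f 1 + f 2 + f 3 + f 4 + f 0"
  unfolding UNIV_5 by (simp add: ac_simps)

lemma sum_6: "sum f (UNIV :: 6 set) = f 1 + f 2 + f 3 + f 4 + f 5 + f 0"
  unfolding UNIV_6 by (simp add: ac_simps)

lemma vector_5:
  "(vector [a, b, c, d, e] :: ('a::zero)^5) $ 1 = a"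
  "(vector [a, b, c, d, e] :: ('a::zero)^5) $ 2 = b"
  "(vector [a, b, c, d, e] :: ('a::zero)^5) $ 3 = c"
  "(vector [a, b, c, d, e] :: ('a::zero)^5) $ 4 = d"
  "(vector [a, b, c, d, e] :: ('a::zero)^5) $ 0 = e"
  unfolding vector_def by simp_all

lemma vector_6:
  "(vector [a, b, c, d, e, f] :: ('a::zero)^6) $ 1 = a"
  "(vector [a, b, c, d, e, f] :: ('a::zero)^6) $ 2 = b"
  "(vector [a, b, c, d, e, f] :: ('a::zero)^6) $ 3 = c"
  "(vector [a, b, c, d, e, f] :: ('a::zero)^6) $ 4 = d"
  "(vector [a, b, c, d, e, f] :: ('a::zero)^6) $ 5 = e"
  "(vector [a, b, c, d, e, f] :: ('a::zero)^6) $ 0 = f"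
  unfolding vector_def by simp_all

lemma det_vector5:
  fixes a b c d e :: "'r::comm_ring_1^5"
  shows "det (vector [a, b, c, d, e]) = det2 (($) (vector [a, b, c, d, e])) 4 0 d e"
    and "det (vector [a, b, c, d, e]) = det2 (($) (vector [a, b, c, d, e])) 1 0 a e"
    and "det (vector [a, b, c, d, e]) = det2 (($) (vector [a, b, c, d, e])) 2 0 b e"
    and "det (vector [a, b, c, d, e]) = det2 (($) (vector [a, b, c, d, e])) 3 0 c e"
  unfolding det2_def
  by (rule arg_cong[where f = det], simp add: vec_eq_iff forall_5 vector_5)+

lemma det2_cong: "(\<And>l. l \<noteq> i \<Longrightarrow> l \<noteq> j \<Longrightarrow> A l = A' l) \<Longrightarrow> det2 A i j x y = det2 A' i j x y"
  unfolding det2_def by (rule arg_cong[where f = det]) (auto simp: vec_eq_iff)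

text \<open>For fixed M this is the alternating form \<open>r\<^sub>0 \<and> r\<^sub>1 \<and> r\<^sub>2 \<and> x \<and> y\<close> in x and y. Its matrix
  consists, up to sign, of the maximal minors of M.\<close>

definition pairing :: "'r::comm_ring_1^5^3 \<Rightarrow> 'r^5 \<Rightarrow> 'r^5 \<Rightarrow> 'r" where
  "pairing M x y = det (vector [M $ 1, M $ 2, M $ 3, x, y] :: 'r^5^5)"

lemma pairing_det2: "pairing M x y = det2 (\<lambda>l. if l = 1 then M $ 1 else if l = 2 then M $ 2 else M $ 3) 4 0 x y"
proof -
  have "vector [M $ 1, M $ 2, M $ 3, x, y] $ l = (if l = 1 then M $ 1 else if l = 2 then M $ 2 else M $ 3)"
    if "l \<noteq> 4" "l \<noteq> 0" for l :: 5
    using exhaust_5[of l] that by (auto simp: vector_5)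
  then show ?thesis unfolding pairing_def det_vector5(1) by (rule det2_cong)
qed

lemma pairing_swap: "pairing M x y = - pairing M y x"
  unfolding pairing_det2 by (rule det2_swap) simp

text \<open>The vector of signed minors that solves \<open>M *v c = 0\<close> by Cramer's rule. As a function of y it is
  the middle map of the Buchsbaum-Rim complex \<open>R\<^sup>3 \<rightarrow> R\<^sup>5 \<rightarrow> R\<^sup>5 \<rightarrow> R\<^sup>3\<close> of M, whose outer maps are
  \<open>z \<mapsto> z v* M\<close> and \<open>c \<mapsto> M *v c\<close>.\<close>

definition cramer_vec :: "'r::comm_ring_1^5^3 \<Rightarrow> 'r^5 \<Rightarrow> 'r^5" where
  "cramer_vec M y = (\<chi> k. pairing M y (axis k 1))"

lemma cramer_vec_add: "cramer_vec M (x + y) = cramer_vec M x + cramer_vec M y"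
  by (simp add: cramer_vec_def vec_eq_iff pairing_det2 det2_add_left)

lemma cramer_vec_scale: "cramer_vec M (c *s x) = c *s cramer_vec M x"
  by (simp add: cramer_vec_def vec_eq_iff pairing_det2 det2_scale_left)

lemma cramer_vec_diff: "cramer_vec M (x - y) = cramer_vec M x - cramer_vec M y"
  by (simp add: cramer_vec_def vec_eq_iff pairing_det2 det2_diff_left)

lemma cramer_vec_nth: "cramer_vec M y $ k = (\<Sum>j\<in>UNIV. y $ j * pairing M (axis j 1) (axis k 1))"
proof -
  have "pairing M y (axis k 1) = pairing M (\<Sum>j\<in>UNIV. y $ j *s axis j 1) (axis k 1)"
    by (simp only: basis_expansion)
  then show ?thesis
    unfolding cramer_vec_def by (simp add: pairing_det2 det2_sum_left)
qed

lemma sum_cramer_vec: "(\<Sum>k\<in>UNIV. x $ k * cramer_vec M y $ k) = pairing M y x"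
proof -
  have "pairing M y x = pairing M y (\<Sum>j\<in>UNIV. x $ j *s axis j 1)"
    by (simp only: basis_expansion)
  then show ?thesis
    unfolding cramer_vec_def by (simp add: pairing_det2 det2_sum_right)
qed

lemma pairing_row: "pairing M y (M $ i) = 0"
proof -
  have "\<exists>l. l \<noteq> 0 \<and> (vector [M $ 1, M $ 2, M $ 3, y, M $ i] :: 'a^5^5) $ l = M $ i"
    using exhaust_3[of i]
  proof (elim disjE)
    assume "i = 1" then show ?thesis by (intro exI[of _ 1]) (simp add: vector_5)
  next
    assume "i = 2" then show ?thesis by (intro exI[of _ 2]) (simp add: vector_5)
  next
    assume "i = 3" then show ?thesis by (intro exI[of _ 3]) (simp add: vector_5)
  qed
  then obtain l where "l \<noteq> 0" "(vector [M $ 1, M $ 2, M $ 3, y, M $ i] :: 'a^5^5) $ l = M $ i"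
    by blast
  then show ?thesis
    unfolding pairing_def
    by (intro det_identical_rows[of l 0]) (auto simp: row_def vector_5)
qed

lemma cramer_vec_row_combination: "cramer_vec M (z v* M) = 0"
proof -
  have "pairing M (M $ i) x = 0" for i x
    using pairing_swap[of M "M $ i" x] pairing_row by simp
  then have "cramer_vec M (M $ i) = 0" for i by (simp add: cramer_vec_def vec_eq_iff)
  moreover have "z v* M = z $ 1 *s M $ 1 + z $ 2 *s M $ 2 + z $ 3 *s M $ 3"
    by (simp add: vector_matrix_mult_def vec_eq_iff sum_3)
  ultimately show ?thesis by (simp add: cramer_vec_add cramer_vec_scale)
qed

lemma sum_mult_matrix_vector_mult:
  fixes A :: "'r::comm_ring_1^'n^'m"
  shows "(\<Sum>i\<in>UNIV. x $ i * (A *v c) $ i) = (\<Sum>j\<in>UNIV. (x v* A) $ j * c $ j)"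
  unfolding vector_matrix_mult_def matrix_vector_mult_def
  by (simp add: sum_distrib_left sum_distrib_right mult.assoc) (rule sum.swap)

lemma matrix_vector_mult_scale: "A *v (c *s x) = c *s (A *v x)"
  for c :: "'r::comm_ring_1"
  by (simp add: matrix_vector_mult_def vec_eq_iff sum_distrib_left mult.left_commute)

lemma mat_vector_mult: "mat c *v x = c *s x" for c :: "'r::comm_ring_1"
proof -
  have "(\<Sum>j\<in>UNIV. (if i = j then c else 0) * x $ j) = (\<Sum>j\<in>UNIV. if i = j then c * x $ j else 0)" for i
    by (rule sum.cong) auto
  then show ?thesis by (simp add: vec_eq_iff matrix_vector_mult_def mat_def)
qed

text \<open>Multiplication by \<open>\<beta>\<close> on the first copy of \<open>R\<^sup>5\<close> in the Buchsbaum-Rim complex is null-homotopic,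
  with G the component of the homotopy going back along \<open>cramer_vec M\<close>. Such \<open>\<beta>\<close> annihilate the
  homology at that place, and by transposing G also the homology at the second copy of \<open>R\<^sup>5\<close>.
  Asking for one matrix G, rather than only for the annihilation, also gives information about
  vectors on which \<open>cramer_vec M\<close> is merely divisible by some element.\<close>

definition contracts :: "'r::comm_ring_1^5^3 \<Rightarrow> 'r \<Rightarrow> bool" where
  "contracts M \<beta> \<longleftrightarrow> (\<exists>G. \<forall>y. \<exists>z. \<beta> *s y = z v* M + cramer_vec M y v* G)"

text \<open>Every maximal minor of M contracts: by Cramer's rule for the rows of M together with x and y,
  a vector v is a combination of these five vectors, and the coefficients of x and y are values
  of \<open>cramer_vec M v\<close>.\<close>

lemma contracts_pairing: "contracts M (pairing M x y)"
  unfolding contracts_def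
proof (intro exI[of _ "\<chi> k l. y $ k * x $ l - x $ k * y $ l"] allI)
  fix v
  let ?A = "vector [M $ 1, M $ 2, M $ 3, x, y] :: 'a^5^5"
  let ?z = "vector [det (\<chi> i. if i = 1 then v else ?A $ i), det (\<chi> i. if i = 2 then v else ?A $ i),
                    det (\<chi> i. if i = 3 then v else ?A $ i)] :: 'a^3"
  have "(\<chi> i. if i = 4 then v else ?A $ i) = vector [M $ 1, M $ 2, M $ 3, v, y]"
       "(\<chi> i. if i = 0 then v else ?A $ i) = vector [M $ 1, M $ 2, M $ 3, x, v]"
    by (simp_all add: vec_eq_iff forall_5 vector_5)
  then have d: "det (\<chi> i. if i = 4 then v else ?A $ i) = pairing M v y"
      "det (\<chi> i. if i = 0 then v else ?A $ i) = - pairing M v x"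
    unfolding pairing_swap[of M v x] by (simp_all add: pairing_def)
  have "pairing M x y *s v = ?z v* M + (pairing M v y *s x - pairing M v x *s y)"
    unfolding pairing_def[of M x y] cramer_rows[of ?A v] sum_5 d
    by (simp add: vec_eq_iff vector_matrix_mult_def sum_3 vector_5)
  also have "pairing M v y *s x - pairing M v x *s y =
      cramer_vec M v v* (\<chi> k l. y $ k * x $ l - x $ k * y $ l)"
    unfolding sum_cramer_vec[symmetric]
    by (simp add: vec_eq_iff vector_matrix_mult_def sum_distrib_left algebra_simps sum_subtractf)
  finally show "\<exists>z. pairing M x y *s v = z v* M +
      cramer_vec M v v* (\<chi> k l. y $ k * x $ l - x $ k * y $ l)"
    by blast
qed

lemma contracts_mult: "contracts M \<beta> \<Longrightarrow> contracts M (h * \<beta>)"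
  unfolding contracts_def
proof (elim exE)
  fix G
  assume G: "\<forall>y. \<exists>z. \<beta> *s y = z v* M + cramer_vec M y v* G"
  show "\<exists>G. \<forall>y. \<exists>z. (h * \<beta>) *s y = z v* M + cramer_vec M y v* G"
  proof (intro exI[of _ "\<chi> k. h *s G $ k"] allI)
    fix y
    obtain z where "\<beta> *s y = z v* M + cramer_vec M y v* G" using G by blast
    then have "(h * \<beta>) *s y = h *s (z v* M + cramer_vec M y v* G)"
      by (simp add: vec_eq_iff mult.assoc)
    also have "\<dots> = (h *s z) v* M + cramer_vec M y v* (\<chi> k. h *s G $ k)"
      by (simp add: vec_eq_iff vector_matrix_mult_def sum_distrib_left algebra_simps)
    finally show "\<exists>z. (h * \<beta>) *s y = z v* M + cramer_vec M y v* (\<chi> k. h *s G $ k)" by blast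
  qed
qed

lemma contracts_add: "contracts M \<beta> \<Longrightarrow> contracts M \<gamma> \<Longrightarrow> contracts M (\<beta> + \<gamma>)"
  unfolding contracts_def
proof (elim exE)
  fix G H
  assume G: "\<forall>y. \<exists>z. \<beta> *s y = z v* M + cramer_vec M y v* G"
    and H: "\<forall>y. \<exists>z. \<gamma> *s y = z v* M + cramer_vec M y v* H"
  show "\<exists>G. \<forall>y. \<exists>z. (\<beta> + \<gamma>) *s y = z v* M + cramer_vec M y v* G"
  proof (intro exI[of _ "G + H"] allI)
    fix y
    obtain z z' where "\<beta> *s y = z v* M + cramer_vec M y v* G"
      "\<gamma> *s y = z' v* M + cramer_vec M y v* H" using G H by blast
    then have "(\<beta> + \<gamma>) *s y = (z + z') v* M + cramer_vec M y v* (G + H)"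
      by (simp add: vector_sadd_rdistrib algebra_simps)
    then show "\<exists>z. (\<beta> + \<gamma>) *s y = z v* M + cramer_vec M y v* (G + H)" by blast
  qed
qed

lemma contracts_sum: "finite I \<Longrightarrow> (\<And>i. i \<in> I \<Longrightarrow> contracts M (h i)) \<Longrightarrow> contracts M (sum h I)"
proof (induction I rule: finite_induct)
  case empty
  have "contracts M (0 * pairing M 0 0)" by (rule contracts_mult[OF contracts_pairing])
  then show ?case by simp
next
  case (insert i I)
  then show ?case by (simp add: contracts_add)
qed

lemma contracts_row_space:
  "contracts M \<beta> \<Longrightarrow> cramer_vec M y = 0 \<Longrightarrow> \<exists>z. \<beta> *s y = z v* M"
  unfolding contracts_def by (elim exE) (drule spec[of _ y], simp)

text \<open>The homotopy is applied to the unit vectors and paired with c; the multiples of rows of M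
  disappear, and antisymmetry of the pairing moves the unit vector to the outside.\<close>

lemma contracts_kernel:
  assumes "contracts M \<beta>" and c: "M *v c = 0"
  shows "\<exists>g. \<beta> *s c = cramer_vec M g"
proof -
  obtain G where G: "\<And>y. \<exists>z. \<beta> *s y = z v* M + cramer_vec M y v* G"
    using assms(1) unfolding contracts_def by blast
  have "(\<beta> *s c) $ l = cramer_vec M ((-1) *s (G *v c)) $ l" for l
  proof -
    obtain z where z: "\<beta> *s axis l 1 = z v* M + cramer_vec M (axis l 1) v* G" using G by blast
    have "(\<beta> *s c) $ l = (\<Sum>k\<in>UNIV. (\<beta> *s axis l 1) $ k * c $ k)"
      by (simp add: axis_def if_distrib if_distribR cong: if_cong)
    also have "\<dots> = (\<Sum>k\<in>UNIV. (z v* M) $ k * c $ k) + (\<Sum>k\<in>UNIV. (cramer_vec M (axis l 1) v* G) $ k * c $ k)"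
      unfolding z by (simp add: sum.distrib distrib_right)
    also have "(\<Sum>k\<in>UNIV. (z v* M) $ k * c $ k) = (\<Sum>i\<in>UNIV. z $ i * (M *v c) $ i)"
      by (rule sum_mult_matrix_vector_mult[symmetric])
    also have "(\<Sum>k\<in>UNIV. (cramer_vec M (axis l 1) v* G) $ k * c $ k) =
        (\<Sum>i\<in>UNIV. (G *v c) $ i * cramer_vec M (axis l 1) $ i)"
      unfolding sum_mult_matrix_vector_mult[symmetric] by (simp add: mult.commute)
    also have "\<dots> = - pairing M (G *v c) (axis l 1)"
      unfolding sum_cramer_vec by (rule pairing_swap)
    finally show ?thesis
      unfolding cramer_vec_scale by (simp add: c cramer_vec_def)
  qed
  then have "\<beta> *s c = cramer_vec M ((-1) *s (G *v c))" by (simp only: vec_eq_iff simp_thms)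
  then show ?thesis by (rule exI)
qed

section \<open>Blocks of a matrix with six rows\<close>

text \<open>The six generators enter f as the three pairs \<open>q\<^sub>i, q\<^sub>i\<^sub>+\<^sub>3\<close>, so vectors and matrices with six rows
  are handled as pairs of blocks with three rows. Index i of a block stands for row i - 1 of the
  upper and for row i + 2 of the lower half.\<close>

definition upper :: "'a::zero^6 \<Rightarrow> 'a^3" where "upper x = vector [x $ 0, x $ 1, x $ 2]"
definition lower :: "'a::zero^6 \<Rightarrow> 'a^3" where "lower x = vector [x $ 3, x $ 4, x $ 5]"
definition join :: "'a::zero^3 \<Rightarrow> 'a^3 \<Rightarrow> 'a^6" where
  "join p r = vector [p $ 2, p $ 3, r $ 1, r $ 2, r $ 3, p $ 1]"

lemma upper_nth [simp]: "upper x $ 1 = x $ 0" "upper x $ 2 = x $ 1" "upper x $ 3 = x $ 2"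
  by (simp_all add: upper_def)

lemma lower_nth [simp]: "lower x $ 1 = x $ 3" "lower x $ 2 = x $ 4" "lower x $ 3 = x $ 5"
  by (simp_all add: lower_def)

lemma join_nth:
  "join p r $ 0 = p $ 1" "join p r $ 1 = p $ 2" "join p r $ 2 = p $ 3"
  "join p r $ 3 = r $ 1" "join p r $ 4 = r $ 2" "join p r $ 5 = r $ 3"
  by (simp_all add: join_def vector_6)

lemma upper_join [simp]: "upper (join p r) = p" and lower_join [simp]: "lower (join p r) = r"
  by (simp_all add: vec_eq_iff forall_3 join_nth)

lemma vec6_eq_iff: "x = y \<longleftrightarrow> upper x = upper y \<and> lower x = lower y"
  by (auto simp: vec_eq_iff forall_3 forall_6)

lemma vector_matrix_mult_upper_lower: "x v* N = upper x v* upper N + lower x v* lower N"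
  by (simp add: vec_eq_iff vector_matrix_mult_def sum_3 sum_6 algebra_simps)

lemma upper_matrix_vector_mult: "upper (N *v c) = upper N *v c"
  and lower_matrix_vector_mult: "lower (N *v c) = lower N *v c"
  by (simp_all add: vec_eq_iff forall_3 matrix_vector_mult_def)

lemma upper_scale: "upper (a *s x) = a *s upper x" and lower_scale: "lower (a *s x) = a *s lower x"
  for a :: "'a::semiring_0"
  by (simp_all add: vec_eq_iff forall_3)

text \<open>The rows of the pencil are the vectors \<open>r\<^sub>0, r\<^sub>1, r\<^sub>2\<close>.\<close>

definition pencil :: "'r \<Rightarrow> 'r \<Rightarrow> 'r::comm_ring_1^5^6 \<Rightarrow> 'r^5^3" where
  "pencil s t N = (\<chi> i. t *s upper N $ i - s *s lower N $ i)"

lemma vector_mult_pencil: "z v* pencil s t N = t *s (z v* upper N) - s *s (z v* lower N)"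
  by (simp add: vec_eq_iff pencil_def vector_matrix_mult_def sum_3 algebra_simps)

lemma pencil_mult_vector: "pencil s t N *v c = t *s (upper N *v c) - s *s (lower N *v c)"
  by (simp add: vec_eq_iff pencil_def matrix_vector_mult_def sum_5 algebra_simps)

lemma mult_cramer_vec_nth: "(N *v cramer_vec M y) $ k = pairing M y (N $ k)"
  by (simp add: matrix_vector_mult_def sum_cramer_vec)

lemma det2_pencil:
  assumes "i \<noteq> j"
  shows "det2 A i j (t *s x - s *s y) x = s * det2 A i j x y"
    and "det2 A i j (t *s x - s *s y) y = t * det2 A i j x y"
  using det2_swap[OF assms, of A y x]
  by (simp_all add: det2_diff_left det2_scale_left det2_same[OF assms])

text \<open>The i-th entry of the left side is \<open>det (r\<^sub>0, r\<^sub>1, r\<^sub>2, e\<^sub>j, N\<^sub>i)\<close>. Replacing the row r with the same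
  index as \<open>N\<^sub>i\<close> by its definition \<open>t N\<^sub>k - s N\<^sub>k\<^sub>+\<^sub>3\<close> kills one of the two terms and splits off the
  factor s or t.\<close>

lemma quadratic_syz_cramer:
  fixes N :: "'k::field bipoly^5^6"
  defines "M \<equiv> pencil (var Xs) (var Xt) N"
  shows "N *v cramer_vec M (axis j 1) =
    join (var Xs *s quadratic_syz N j) (var Xt *s quadratic_syz N j)"
proof -
  let ?e = "axis j 1 :: 'k bipoly^5"
  let ?s = "var Xs :: 'k bipoly" and ?t = "var Xt :: 'k bipoly"
  have M: "M $ i = ?t *s upper N $ i - ?s *s lower N $ i" for i
    by (simp add: M_def pencil_def)
  have 1: "pairing M ?e y = det2 (($) (vector [upper N $ 1, M $ 2, M $ 3, ?e, lower N $ 1])) 1 0 (M $ 1) y"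
    and 2: "pairing M ?e y = det2 (($) (vector [M $ 1, upper N $ 2, M $ 3, ?e, lower N $ 2])) 2 0 (M $ 2) y"
    and 3: "pairing M ?e y = det2 (($) (vector [M $ 1, M $ 2, upper N $ 3, ?e, lower N $ 3])) 3 0 (M $ 3) y"
    for y
    unfolding pairing_def det2_def
    by (rule arg_cong[where f = det], simp add: vec_eq_iff forall_5 vector_5)+
  have Q: "quadratic_syz N j = vector
    [det2 (($) (vector [upper N $ 1, M $ 2, M $ 3, ?e, lower N $ 1])) 1 0 (upper N $ 1) (lower N $ 1),
     det2 (($) (vector [M $ 1, upper N $ 2, M $ 3, ?e, lower N $ 2])) 2 0 (upper N $ 2) (lower N $ 2),
     det2 (($) (vector [M $ 1, M $ 2, upper N $ 3, ?e, lower N $ 3])) 3 0 (upper N $ 3) (lower N $ 3)]"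
    unfolding det_vector5(2-4)[symmetric] by (simp add: quadratic_syz_def M Let_def)
  have *: "pairing M ?e (upper N $ i) = ?s * quadratic_syz N j $ i"
    "pairing M ?e (lower N $ i) = ?t * quadratic_syz N j $ i" for i
    using exhaust_3[of i] 1[of "upper N $ 1"] 1[of "lower N $ 1"] 2[of "upper N $ 2"] 2[of "lower N $ 2"]
      3[of "upper N $ 3"] 3[of "lower N $ 3"]
    unfolding Q M[of 1] M[of 2] M[of 3] det2_pencil[OF one_neq_zero]
      det2_pencil[OF zero_neq_numeral[symmetric]]
    by (auto simp: det2_pencil)
  show ?thesis
    using *[of 1] *[of 2] *[of 3]
    by (simp add: vec_eq_iff forall_6 mult_cramer_vec_nth join_nth)
qed

text \<open>Enumerates the rows of a matrix with six rows apart from row 5 in such an order that it is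
  compatible with \<open>vector\<close>, where index 0 comes last in both dimensions.\<close>

definition embed5 :: "5 \<Rightarrow> 6" where
  "embed5 i = (if i = 1 then 1 else if i = 2 then 2 else if i = 3 then 3 else if i = 4 then 4 else 0)"

lemma embed5_simps: "embed5 1 = 1" "embed5 2 = 2" "embed5 3 = 3" "embed5 4 = 4" "embed5 0 = 0"
  by (simp_all add: embed5_def)

lemma inj_embed5: "inj embed5"
  unfolding inj_def forall_5 embed5_simps by simp

lemma range_embed5: "range embed5 = - {5}"
proof -
  have "- {5::6} = {1, 2, 3, 4, 0}" using UNIV_6 by auto
  then show ?thesis unfolding UNIV_5 by (simp add: embed5_simps)
qed

text \<open>If the rows of M and C together have the properties required by
  \<open>left_kernel_generator_is_minors\<close>, then the entries f of the left kernel that belong to the rows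
  of C are, up to a power of \<open>\<sigma>\<close>, multiples of the minors that omit a row of C. Those minors
  involve all three rows of M, so they are values of the pairing and contract.\<close>

lemma contracts_from_presentation:
  fixes M C :: "'r::idom^5^3"
  assumes "\<sigma> \<noteq> 0"
    and rows: "\<And>j. \<exists>x y. x v* M + y v* C = \<sigma> *s axis j 1"
    and ker: "\<And>x y. x v* M + y v* C = 0 \<Longrightarrow> \<exists>\<kappa>. \<sigma> *s x = \<kappa> *s g \<and> \<sigma> *s y = \<kappa> *s f"
  shows "contracts M (\<sigma> ^ 5 * f $ i)"
proof -
  let ?N = "vector [M $ 1, M $ 2, M $ 3, C $ 1, C $ 2, C $ 3] :: 'r^5^6"
  let ?q = "vector [g $ 1, g $ 2, g $ 3, f $ 1, f $ 2, f $ 3] :: 'r^6"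
  have mult: "x v* ?N = vector [x $ 1, x $ 2, x $ 3] v* M + vector [x $ 4, x $ 5, x $ 0] v* C" for x
    by (simp add: vec_eq_iff vector_matrix_mult_def sum_3 sum_6 vector_6)
  have "\<exists>y. y v* ?N = \<sigma> *s axis j 1" for j
  proof -
    obtain x y where xy: "x v* M + y v* C = \<sigma> *s axis j 1" using rows by blast
    have "vector [x $ 1, x $ 2, x $ 3, y $ 1, y $ 2, y $ 3] v* ?N = x v* M + y v* C"
      unfolding mult vector_6 by (simp add: vec_eq_iff vector_matrix_mult_def sum_3)
    then show ?thesis unfolding xy by (rule exI)
  qed
  then obtain Y where Y: "\<And>j. Y j v* ?N = \<sigma> *s axis j 1"
    using choice[of "\<lambda>j y. y v* ?N = \<sigma> *s axis j 1"] by blast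
  have "((\<chi> j. Y j) ** ?N) $ j = Y j v* ?N" for j
    by (simp add: matrix_matrix_mult_def vector_matrix_mult_def vec_eq_iff)
  then have YN: "(\<chi> j. Y j) ** ?N = mat \<sigma>"
    by (simp add: Y vec_eq_iff mat_def axis_def)
  have "\<exists>\<kappa>. \<sigma> *s x = \<kappa> *s ?q" if x: "x v* ?N = 0" for x
  proof -
    obtain \<kappa> where "\<sigma> *s vector [x $ 1, x $ 2, x $ 3] = \<kappa> *s g"
      "\<sigma> *s vector [x $ 4, x $ 5, x $ 0] = \<kappa> *s f"
      using ker[OF x[unfolded mult]] by blast
    then have "\<sigma> *s x = \<kappa> *s ?q" by (auto simp: vec_eq_iff forall_6 forall_3 vector_6)
    then show ?thesis by blast
  qed
  from left_kernel_generator_is_minors[OF inj_embed5 range_embed5 YN \<open>\<sigma> \<noteq> 0\<close> this]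
  obtain \<kappa> where \<kappa>: "\<sigma> ^ 5 *s ?q = \<kappa> *s minors embed5 5 ?N" by auto
  have "minors embed5 5 ?N $ 4 = (- 1) * pairing M (C $ 2) (C $ 3)"
    "minors embed5 5 ?N $ 5 = 1 * pairing M (C $ 1) (C $ 3)"
    "minors embed5 5 ?N $ 0 = (- 1) * pairing M (C $ 1) (C $ 2)"
    unfolding minors_def pairing_def
    by (simp_all, (rule arg_cong[where f = det], simp add: vec_eq_iff forall_5 embed5_simps vector_5 vector_6)+)
  then have "contracts M (minors embed5 5 ?N $ k)" if "k \<in> {4, 5, 0}" for k
    using that by (auto simp only: insert_iff empty_iff intro: contracts_mult[OF contracts_pairing])
  then have "contracts M (\<kappa> * minors embed5 5 ?N $ k)" if "k \<in> {4, 5, 0}" for k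
    using that contracts_mult by blast
  moreover have "\<kappa> * minors embed5 5 ?N $ k = \<sigma> ^ 5 * ?q $ k" for k
    using arg_cong[OF \<kappa>, of "\<lambda>v. v $ k"] by simp
  ultimately have "contracts M (\<sigma> ^ 5 * ?q $ k)" if "k \<in> {4, 5, 0}" for k
    using that by auto
  from this[of 4] this[of 5] this[of 0] show ?thesis
    using exhaust_3[of i] by (auto simp: vector_6)
qed

text \<open>Over the localisation at s the rows of N are combinations of the rows of the pencil and of the
  upper block, since \<open>s N\<^sub>k\<^sub>+\<^sub>3 = t N\<^sub>k - r\<^sub>k\<close>; in terms of these six rows the left kernel vector
  \<open>(upper q, lower q)\<close> becomes \<open>(- lower q, s upper q + t lower q)\<close>, whose second part belongs to
  the rows of the upper block. Over the localisation at t the lower block takes the role of the upper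
  one.\<close>

lemma contracts_pencil:
  fixes N :: "'r::idom^5^6"
  assumes "\<alpha> \<noteq> 0" and YN: "Y ** N = mat \<alpha>"
    and ker: "\<And>x. x v* N = 0 \<Longrightarrow> \<exists>\<kappa>. \<alpha> *s x = \<kappa> *s q"
  shows "s \<noteq> 0 \<Longrightarrow> contracts (pencil s t N) ((s * \<alpha>) ^ 5 * (s * upper q $ i + t * lower q $ i))"
    and "t \<noteq> 0 \<Longrightarrow> contracts (pencil s t N) ((t * \<alpha>) ^ 5 * (s * upper q $ i + t * lower q $ i))"
proof -
  have Y: "Y $ j v* N = \<alpha> *s axis j 1" for j
  proof -
    have "Y $ j v* N = (Y ** N) $ j"
      by (simp add: matrix_matrix_mult_def vector_matrix_mult_def vec_eq_iff)
    then show ?thesis unfolding YN by (simp add: mat_def vec_eq_iff axis_def)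
  qed
  define f where "f = s *s upper q + t *s lower q"
  have ker': "\<exists>\<kappa>. \<alpha> *s x = \<kappa> *s upper q \<and> \<alpha> *s y = \<kappa> *s lower q"
    if "x v* upper N + y v* lower N = 0" for x y
  proof -
    have "join x y v* N = 0" using that by (simp add: vector_matrix_mult_upper_lower)
    from ker[OF this] show ?thesis unfolding vec6_eq_iff by (simp add: upper_scale lower_scale)
  qed
  show "contracts (pencil s t N) ((s * \<alpha>) ^ 5 * (s * upper q $ i + t * lower q $ i))" if "s \<noteq> 0"
  proof -
    have "contracts (pencil s t N) ((s * \<alpha>) ^ 5 * f $ i)"
    proof (rule contracts_from_presentation[where C = "upper N" and g = "- lower q"])
      show "s * \<alpha> \<noteq> 0" using that \<open>\<alpha> \<noteq> 0\<close> by simp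
    next
      fix j
      let ?x = "- lower (Y $ j)" and ?y = "s *s upper (Y $ j) + t *s lower (Y $ j)"
      have "?x v* pencil s t N + ?y v* upper N = s *s (Y $ j v* N)"
        unfolding vector_matrix_mult_upper_lower[of "Y $ j"]
        by (simp add: vec_eq_iff pencil_def vector_matrix_mult_def sum_3 algebra_simps)
      then have "?x v* pencil s t N + ?y v* upper N = (s * \<alpha>) *s axis j 1"
        unfolding Y by (simp add: vector_smult_assoc)
      then show "\<exists>x y. x v* pencil s t N + y v* upper N = (s * \<alpha>) *s axis j 1" by blast
    next
      fix x y
      assume "x v* pencil s t N + y v* upper N = 0"
      then have "(t *s x + y) v* upper N + ((- s) *s x) v* lower N = 0"
        by (simp add: vec_eq_iff pencil_def vector_matrix_mult_def sum_3 algebra_simps)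
      from ker'[OF this] obtain \<kappa> where 1: "\<alpha> *s (t *s x + y) = \<kappa> *s upper q"
        and 2: "\<alpha> *s ((- s) *s x) = \<kappa> *s lower q" by blast
      have "(s * \<alpha>) *s x = \<kappa> *s (- lower q)"
        using 2 by (simp add: vec_eq_iff algebra_simps minus_equation_iff[of "_ * (_ * _)"])
      moreover have "(s * \<alpha>) *s y = s *s (\<alpha> *s (t *s x + y)) + t *s (\<alpha> *s ((- s) *s x))"
        by (simp add: vec_eq_iff algebra_simps)
      then have "(s * \<alpha>) *s y = \<kappa> *s f"
        unfolding 1 2 f_def by (simp add: vec_eq_iff algebra_simps)
      ultimately show "\<exists>\<kappa>. (s * \<alpha>) *s x = \<kappa> *s (- lower q) \<and> (s * \<alpha>) *s y = \<kappa> *s f" by blast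
    qed
    then show ?thesis by (simp add: f_def)
  qed
  show "contracts (pencil s t N) ((t * \<alpha>) ^ 5 * (s * upper q $ i + t * lower q $ i))" if "t \<noteq> 0"
  proof -
    have "contracts (pencil s t N) ((t * \<alpha>) ^ 5 * f $ i)"
    proof (rule contracts_from_presentation[where C = "lower N" and g = "upper q"])
      show "t * \<alpha> \<noteq> 0" using that \<open>\<alpha> \<noteq> 0\<close> by simp
    next
      fix j
      let ?x = "upper (Y $ j)" and ?y = "s *s upper (Y $ j) + t *s lower (Y $ j)"
      have "?x v* pencil s t N + ?y v* lower N = t *s (Y $ j v* N)"
        unfolding vector_matrix_mult_upper_lower[of "Y $ j"]
        by (simp add: vec_eq_iff pencil_def vector_matrix_mult_def sum_3 algebra_simps)
      then have "?x v* pencil s t N + ?y v* lower N = (t * \<alpha>) *s axis j 1"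
        unfolding Y by (simp add: vector_smult_assoc)
      then show "\<exists>x y. x v* pencil s t N + y v* lower N = (t * \<alpha>) *s axis j 1" by blast
    next
      fix x y
      assume "x v* pencil s t N + y v* lower N = 0"
      then have "(t *s x) v* upper N + (y - s *s x) v* lower N = 0"
        by (simp add: vec_eq_iff pencil_def vector_matrix_mult_def sum_3 algebra_simps)
      from ker'[OF this] obtain \<kappa> where 1: "\<alpha> *s (t *s x) = \<kappa> *s upper q"
        and 2: "\<alpha> *s (y - s *s x) = \<kappa> *s lower q" by blast
      have "(t * \<alpha>) *s x = \<kappa> *s upper q"
        using 1 by (simp add: vector_smult_assoc mult.commute)
      moreover have "(t * \<alpha>) *s y = s *s (\<alpha> *s (t *s x)) + t *s (\<alpha> *s (y - s *s x))"
        by (simp add: vec_eq_iff algebra_simps)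
      then have "(t * \<alpha>) *s y = \<kappa> *s f"
        unfolding 1 2 f_def by (simp add: vec_eq_iff algebra_simps)
      ultimately show "\<exists>\<kappa>. (t * \<alpha>) *s x = \<kappa> *s upper q \<and> (t * \<alpha>) *s y = \<kappa> *s f" by blast
    qed
    then show ?thesis by (simp add: f_def)
  qed
qed

section \<open>Graded components and powers of variables\<close>

text \<open>
  A linear order on the indeterminates orders the monomials linearly and compatibly with
  multiplication; with this instance the polynomial ring is known to be an integral domain.
\<close>

instantiation indet :: linorder
begin

fun position_indet :: "indet \<Rightarrow> nat" where
  "position_indet Xs = 0" | "position_indet Xt = 1" | "position_indet Xu = 2" | "position_indet Xv = 3"

definition "x \<le> y \<longleftrightarrow> position_indet x \<le> position_indet y"
definition "x < y \<longleftrightarrow> position_indet x < position_indet y"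

instance
proof
  fix x y :: indet
  show "x \<le> y \<Longrightarrow> y \<le> x \<Longrightarrow> x = y"
    by (cases x; cases y) (simp_all add: less_eq_indet_def)
qed (auto simp: less_eq_indet_def less_indet_def)

end

text \<open>
  The sum of the terms of weight d. The weight w may be any function of the monomial: besides
  gradings, two-valued functions are used below to split a polynomial by a property of its
  monomials.
\<close>

lift_definition part :: "('m \<Rightarrow> 'g) \<Rightarrow> 'g \<Rightarrow> ('m \<Rightarrow>\<^sub>0 'a::zero) \<Rightarrow> ('m \<Rightarrow>\<^sub>0 'a)" is
  "\<lambda>w d p m. if w m = d then p m else 0"
  by (rule finite_subset) auto

definition homog :: "('m \<Rightarrow> 'g) \<Rightarrow> 'g \<Rightarrow> ('m \<Rightarrow>\<^sub>0 'a::zero) \<Rightarrow> bool" where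
  "homog w d p \<longleftrightarrow> (\<forall>m\<in>Poly_Mapping.keys p. w m = d)"

lemma keys_part: "Poly_Mapping.keys (part w d p) = {m \<in> Poly_Mapping.keys p. w m = d}"
  by (auto simp: in_keys_iff part.rep_eq split: if_splits)

lemma homog_part [simp]: "homog w d (part w d p)"
  by (simp add: homog_def keys_part)

lemma part_add: "part w d (p + q) = part w d p + part w d q"
  by (rule poly_mapping_eqI) (simp add: part.rep_eq lookup_add)

lemma part_0 [simp]: "part w d 0 = 0"
  by (rule poly_mapping_eqI) (simp add: part.rep_eq)

lemma part_sum: "part w d (\<Sum>i\<in>I. p i) = (\<Sum>i\<in>I. part w d (p i))"
  by (induction I rule: infinite_finite_induct) (simp_all add: part_add)

lemma part_homog: "homog w e p \<Longrightarrow> part w d p = (if d = e then p else 0)"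
  by (rule poly_mapping_eqI) (auto simp: part.rep_eq homog_def in_keys_iff)

lemma part_compl: "p = part w True p + part w False p"
  by (rule poly_mapping_eqI) (simp add: part.rep_eq lookup_add)

lemma homog_0 [simp]: "homog w d 0" by (simp add: homog_def)

lemma homog_add: "homog w d p \<Longrightarrow> homog w d q \<Longrightarrow> homog w d (p + q)"
  using keys_add[of p q] by (auto simp: homog_def)

lemma homog_uminus: "homog w d p \<Longrightarrow> homog w d (- p)" for p :: "_ \<Rightarrow>\<^sub>0 'a::ab_group_add"
  by (simp add: homog_def)

lemma homog_diff: "homog w d p \<Longrightarrow> homog w d q \<Longrightarrow> homog w d (p - q)"
  for p :: "_ \<Rightarrow>\<^sub>0 'a::ab_group_add"
  using homog_add[of w d p "- q"] homog_uminus by force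

lemma homog_sum: "(\<And>i. i \<in> I \<Longrightarrow> homog w d (p i)) \<Longrightarrow> homog w d (\<Sum>i\<in>I. p i)"
  by (induction I rule: infinite_finite_induct) (auto intro: homog_add)

locale weight =
  fixes w :: "'m::comm_monoid_add \<Rightarrow> 'g::ab_group_add"
  assumes weight_add: "w (m + m') = w m + w m'"
begin

lemma weight_0 [simp]: "w 0 = 0"
  using weight_add[of 0 0] by simp

lemma homog_mult: "homog w d p \<Longrightarrow> homog w e q \<Longrightarrow> homog w (d + e) (p * q)"
  for p q :: "'m \<Rightarrow>\<^sub>0 'a::comm_semiring_0"
  using keys_mult[of p q] by (fastforce simp: homog_def weight_add)

lemma homog_1: "homog w 0 (1 :: 'm \<Rightarrow>\<^sub>0 'a::comm_ring_1)"
  by (simp add: homog_def)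

lemma homog_prod:
  "(\<And>i. i \<in> I \<Longrightarrow> homog w (d i) (p i)) \<Longrightarrow> homog w (\<Sum>i\<in>I. d i) (\<Prod>i\<in>I. p i)"
  for p :: "'i \<Rightarrow> 'm \<Rightarrow>\<^sub>0 'a::comm_ring_1"
  by (induction I rule: infinite_finite_induct) (auto intro: homog_mult homog_1)

text \<open>Projection to a graded component commutes with multiplication by a homogeneous element, up to
  the shift of the degree. This is what allows solutions of homogeneous linear equations to be
  replaced by homogeneous ones.\<close>

lemma part_mult:
  fixes p q :: "'m \<Rightarrow>\<^sub>0 'a::comm_ring_1"
  assumes "homog w e q"
  shows "part w d (p * q) = part w (d - e) p * q"
proof -
  let ?r = "p - part w (d - e) p"
  have r: "Poly_Mapping.keys ?r \<subseteq> {m. w m \<noteq> d - e}"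
    by (auto simp: in_keys_iff lookup_minus part.rep_eq split: if_splits)
  have "w m \<noteq> d" if m: "m \<in> Poly_Mapping.keys (?r * q)" for m
  proof -
    obtain a b where "m = a + b" "a \<in> Poly_Mapping.keys ?r" "b \<in> Poly_Mapping.keys q"
      using m keys_mult[of ?r q] by blast
    then show ?thesis using r assms by (auto simp: weight_add homog_def)
  qed
  then have "part w d (?r * q) = 0"
    by (intro poly_mapping_eqI) (auto simp: part.rep_eq in_keys_iff)
  moreover have "part w d (part w (d - e) p * q) = part w (d - e) p * q"
    using homog_mult[OF homog_part assms, of "d - e" p] by (simp add: part_homog)
  moreover have "part w d (p * q) = part w d (?r * q) + part w d (part w (d - e) p * q)"
    by (simp flip: part_add add: algebra_simps)
  ultimately show ?thesis by simp
qed

lemma part_mult_left: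
  "homog w e q \<Longrightarrow> part w d (q * p) = q * part w (d - e) p"
  for p q :: "'m \<Rightarrow>\<^sub>0 'a::comm_ring_1"
  using part_mult[of e q d p] by (simp add: mult.commute)

lemma part_sum_mult:
  fixes p q :: "'i \<Rightarrow> 'm \<Rightarrow>\<^sub>0 'a::comm_ring_1"
  assumes "\<And>i. i \<in> I \<Longrightarrow> homog w (e i) (q i)"
  shows "part w d (\<Sum>i\<in>I. p i * q i) = (\<Sum>i\<in>I. part w (d - e i) (p i) * q i)"
  unfolding part_sum using assms by (intro sum.cong) (simp_all add: part_mult)

text \<open>Degrees may be attached to rows and to columns; each Leibniz term collects every one of them
  once.\<close>

lemma homog_det:
  fixes A :: "('m \<Rightarrow>\<^sub>0 'a::comm_ring_1)^'n^'n"
  assumes "\<And>i j. homog w (\<rho> i + \<gamma> j) (A $ i $ j)"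
  shows "homog w ((\<Sum>i\<in>UNIV. \<rho> i) + (\<Sum>j\<in>UNIV. \<gamma> j)) (det A)"
  unfolding det_def
proof (rule homog_sum)
  fix p :: "'n \<Rightarrow> 'n"
  assume "p \<in> {p. p permutes UNIV}"
  then have p: "p permutes UNIV" by simp
  have "homog w (\<Sum>i\<in>UNIV. \<rho> i + \<gamma> (p i)) (\<Prod>i\<in>UNIV. A $ i $ p i)"
    by (rule homog_prod) (rule assms)
  moreover have "(\<Sum>i\<in>UNIV. \<rho> i + \<gamma> (p i)) = (\<Sum>i\<in>UNIV. \<rho> i) + (\<Sum>j\<in>UNIV. \<gamma> j)"
    using sum.permute[OF p, of \<gamma>] by (simp add: sum.distrib o_def)
  moreover have "homog w e (of_int (sign p) * x)" if "homog w e x" for e and x :: "'m \<Rightarrow>\<^sub>0 'a"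
    using that homog_uminus[OF that] by (simp add: sign_def)
  ultimately show "homog w ((\<Sum>i\<in>UNIV. \<rho> i) + (\<Sum>j\<in>UNIV. \<gamma> j))
      (of_int (sign p) * (\<Prod>i\<in>UNIV. A $ i $ p i))"
    by simp
qed

end

lemma var_power: "var x ^ k = (Poly_Mapping.single (Poly_Mapping.single x k) 1 :: 'k::comm_ring_1 bipoly)"
proof (induction k)
  case (Suc k)
  have "Poly_Mapping.single x (Suc k) = Poly_Mapping.single x 1 + Poly_Mapping.single x k"
    by (simp flip: single_add)
  with Suc show ?case by (simp add: var_def mult_single)
qed simp

lemma var_nonzero [simp]: "(var x :: 'k::field bipoly) \<noteq> 0"
  by (simp add: var_def flip: keys_eq_empty)

lemma homog_var_power: "homog w (w (Poly_Mapping.single x k)) (var x ^ k)"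
  by (simp add: var_power homog_def)

lemma keys_single_mult:
  fixes p :: "'m::comm_monoid_add \<Rightarrow>\<^sub>0 'a::comm_ring_1"
  shows "Poly_Mapping.keys (Poly_Mapping.single a 1 * p) \<subseteq> (+) a ` Poly_Mapping.keys p"
  using keys_mult[of "Poly_Mapping.single a 1" p] by auto

lemma sum_keys_single: "(\<Sum>m\<in>Poly_Mapping.keys p. Poly_Mapping.single m (Poly_Mapping.lookup p m)) = p"
  by (rule poly_mapping_eqI) (auto simp: lookup_sum lookup_single when_def in_keys_iff)

lemma var_power_dvd_iff:
  fixes p :: "'k::comm_ring_1 bipoly"
  shows "var x ^ k dvd p \<longleftrightarrow> (\<forall>m\<in>Poly_Mapping.keys p. k \<le> Poly_Mapping.lookup m x)"
proof
  assume "var x ^ k dvd p"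
  then obtain q where "p = Poly_Mapping.single (Poly_Mapping.single x k) 1 * q"
    by (auto simp: var_power)
  then show "\<forall>m\<in>Poly_Mapping.keys p. k \<le> Poly_Mapping.lookup m x"
    using keys_single_mult[of "Poly_Mapping.single x k" q] by (auto simp: lookup_add)
next
  assume *: "\<forall>m\<in>Poly_Mapping.keys p. k \<le> Poly_Mapping.lookup m x"
  have "var x ^ k dvd Poly_Mapping.single m (Poly_Mapping.lookup p m)" if "m \<in> Poly_Mapping.keys p" for m
  proof -
    have "m = Poly_Mapping.single x k + (m - Poly_Mapping.single x k)"
      using * that by (intro poly_mapping_eqI) (auto simp: lookup_add lookup_minus lookup_single when_def)
    then have "Poly_Mapping.single m (Poly_Mapping.lookup p m) =
        var x ^ k * Poly_Mapping.single (m - Poly_Mapping.single x k) (Poly_Mapping.lookup p m)"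
      unfolding var_power mult_single by simp
    then show ?thesis by (rule dvdI)
  qed
  then have "var x ^ k dvd (\<Sum>m\<in>Poly_Mapping.keys p. Poly_Mapping.single m (Poly_Mapping.lookup p m))"
    by (rule dvd_sum)
  then show "var x ^ k dvd p" unfolding sum_keys_single .
qed

text \<open>Distinct variables are coprime. Remove from p the terms divisible by \<open>var y ^ l\<close>; the product of
  \<open>var x ^ k\<close> with the rest is still divisible by \<open>var y ^ l\<close>, although none of its monomials is.\<close>

lemma dvd_var_power_mult_cancel:
  fixes p :: "'k::field bipoly"
  assumes "x \<noteq> y" and "var y ^ l dvd var x ^ k * p"
  shows "var y ^ l dvd p"
proof -
  let ?w = "\<lambda>m::indet \<Rightarrow>\<^sub>0 nat. l \<le> Poly_Mapping.lookup m y"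
  have "var y ^ l dvd part ?w True p"
    by (simp add: var_power_dvd_iff keys_part)
  have "var x ^ k * p = var x ^ k * part ?w True p + var x ^ k * part ?w False p"
    by (simp flip: distrib_left part_compl)
  with assms(2) \<open>var y ^ l dvd part ?w True p\<close> have "var y ^ l dvd var x ^ k * part ?w False p"
    using dvd_add_right_iff[of "var y ^ l" "var x ^ k * part ?w True p"] dvd_mult by simp
  moreover have "Poly_Mapping.lookup m y < l" if "m \<in> Poly_Mapping.keys (var x ^ k * part ?w False p)" for m
    using that keys_single_mult[of "Poly_Mapping.single x k" "part ?w False p"] \<open>x \<noteq> y\<close>
    unfolding var_power by (auto simp: keys_part lookup_add lookup_single)
  ultimately have "Poly_Mapping.keys (var x ^ k * part ?w False p) = {}"
    unfolding var_power_dvd_iff by (meson all_not_in_conv not_less)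
  then have "part ?w False p = 0" by simp
  with \<open>var y ^ l dvd part ?w True p\<close> part_compl[of p ?w] show ?thesis by simp
qed

lemma vec_dvd: "(\<And>i. c dvd p $ i) \<Longrightarrow> \<exists>q. p = c *s q" for p :: "'r::comm_ring_1^'n"
proof (rule exI[of _ "\<chi> i. SOME a. p $ i = c * a"])
  assume dvd: "\<And>i. c dvd p $ i"
  have "p $ i = c * (SOME a. p $ i = c * a)" for i
    using dvd[of i] unfolding dvd_def by (rule someI_ex)
  then show "p = c *s (\<chi> i. SOME a. p $ i = c * a)" by (simp add: vec_eq_iff)
qed

text \<open>The step by which denominators are removed: a vector of fractions whose denominator can be chosen
  as a power of x and also as a power of y has polynomial entries.\<close>

lemma vec_var_power_cancel:
  fixes p q :: "'k::field bipoly^'n"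
  assumes "x \<noteq> y" and eq: "var x ^ k *s p = var y ^ l *s q"
  shows "\<exists>r. p = var y ^ l *s r \<and> q = var x ^ k *s r"
proof -
  have nth: "var x ^ k * p $ i = var y ^ l * q $ i" for i
    using arg_cong[OF eq, of "\<lambda>v. v $ i"] by simp
  have "var y ^ l dvd p $ i" for i
    by (rule dvd_var_power_mult_cancel[OF assms(1), of l k], unfold nth) (rule dvd_triv_left)
  then obtain r where r: "p = var y ^ l *s r" using vec_dvd by blast
  have "var y ^ l * q $ i = var y ^ l * (var x ^ k * r $ i)" for i
    using nth[of i] unfolding r by (simp add: mult.left_commute)
  then have "q $ i = var x ^ k * r $ i" for i
    by (metis mult_left_cancel power_not_zero var_nonzero)
  then have "q = var x ^ k *s r" by (simp only: vec_eq_iff vector_smult_component simp_thms)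
  with r show ?thesis by blast
qed

lemma vec_power_cancel: "var x ^ k *s p = var x ^ k *s q \<Longrightarrow> p = q" for p q :: "'k::field bipoly^'n"
  by (simp add: vec_eq_iff)

definition stdeg :: "(indet \<Rightarrow>\<^sub>0 nat) \<Rightarrow> int" where
  "stdeg m = int (Poly_Mapping.lookup m Xs) + int (Poly_Mapping.lookup m Xt)"

definition exps :: "indet \<Rightarrow> indet \<Rightarrow> (indet \<Rightarrow>\<^sub>0 nat) \<Rightarrow> int \<times> int" where
  "exps x y m = (int (Poly_Mapping.lookup m x), int (Poly_Mapping.lookup m y))"

interpretation stdeg: weight stdeg by unfold_locales (simp add: stdeg_def lookup_add)
interpretation exps: weight "exps x y" for x y
  by unfold_locales (simp add: exps_def lookup_add)
interpretation bideg: weight mon_bideg by unfold_locales (simp add: mon_bideg_def lookup_add)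

lemma stdeg_var_power: "y \<in> {Xs, Xt} \<Longrightarrow> homog stdeg (int j) (var y ^ j)"
  using homog_var_power[of stdeg Xs j] homog_var_power[of stdeg Xt j]
  by (auto simp: stdeg_def lookup_single)

lemma stdeg_var: "y \<in> {Xs, Xt} \<Longrightarrow> homog stdeg 1 (var y)"
  using stdeg_var_power[of y 1] by simp

lemma R_comp_iff: "p \<in> R_comp e \<longleftrightarrow> homog mon_bideg e p"
  by (simp add: R_comp_def homog_def)

lemma Kuv_iff_stdeg: "p \<in> Kuv \<longleftrightarrow> homog stdeg 0 p"
  by (auto simp: Kuv_def homog_def stdeg_def)

lemma Kuv_exps: "p \<in> Kuv \<Longrightarrow> homog (exps Xs Xt) 0 p" "p \<in> Kuv \<Longrightarrow> homog (exps Xt Xs) 0 p"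
  by (auto simp: Kuv_def homog_def exps_def zero_prod_def)

lemma Kuv_part: "part (exps Xs Xt) 0 p \<in> Kuv" "part (exps Xt Xs) 0 p \<in> Kuv" "part stdeg 0 p \<in> Kuv"
  by (auto simp: Kuv_def keys_part exps_def stdeg_def zero_prod_def)

lemma Kuv_0: "0 \<in> Kuv" and Kuv_1: "1 \<in> Kuv"
  and Kuv_add: "p \<in> Kuv \<Longrightarrow> q \<in> Kuv \<Longrightarrow> p + q \<in> Kuv"
  and Kuv_diff: "p \<in> Kuv \<Longrightarrow> q \<in> Kuv \<Longrightarrow> p - q \<in> Kuv"
  and Kuv_mult: "p \<in> Kuv \<Longrightarrow> q \<in> Kuv \<Longrightarrow> p * q \<in> Kuv"
  and Kuv_sum: "(\<And>i. i \<in> I \<Longrightarrow> h i \<in> Kuv) \<Longrightarrow> sum h I \<in> Kuv"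
  for p q :: "'k::comm_ring_1 bipoly"
  using stdeg.homog_mult[of 0 p 0 q]
  by (simp_all add: Kuv_iff_stdeg homog_add homog_diff homog_sum stdeg.homog_1)

lemma Kuv_matrix_vector_mult:
  "(\<And>i j. A $ i $ j \<in> Kuv) \<Longrightarrow> (\<And>j. x $ j \<in> Kuv) \<Longrightarrow> (A *v x) $ i \<in> (Kuv :: 'k::comm_ring_1 bipoly set)"
  by (simp add: matrix_vector_mult_def Kuv_sum Kuv_mult)

lemma Kuv_var_power: "x \<in> {Xu, Xv} \<Longrightarrow> var x ^ k \<in> Kuv"
  by (auto simp: Kuv_def var_power lookup_single)

lemma homog_bideg_stdeg: "homog mon_bideg e p \<Longrightarrow> homog stdeg (fst e) p"
proof -
  have "stdeg m = fst (mon_bideg m)" for m by (simp add: stdeg_def mon_bideg_def)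
  then show "homog mon_bideg e p \<Longrightarrow> homog stdeg (fst e) p" by (simp add: homog_def)
qed

lemma homog_bideg_Kuv: "homog mon_bideg (0, d) p \<Longrightarrow> p \<in> Kuv"
  unfolding Kuv_iff_stdeg by (drule homog_bideg_stdeg) simp

lemma module_times: "module ((*) :: 'r::comm_ring_1 \<Rightarrow> 'r \<Rightarrow> 'r)"
  by unfold_locales (simp_all add: distrib_left distrib_right mult.assoc)

interpretation vec_module: module "(*s) :: 'r::comm_ring_1 \<Rightarrow> 'r^'n \<Rightarrow> 'r^'n"
  by unfold_locales
    (simp_all add: vector_add_ldistrib vector_sadd_rdistrib vector_smult_assoc)

definition vpart :: "('m \<Rightarrow> 'g) \<Rightarrow> 'g \<Rightarrow> ('m \<Rightarrow>\<^sub>0 'a::zero)^'n \<Rightarrow> ('m \<Rightarrow>\<^sub>0 'a)^'n" where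
  "vpart w d x = (\<chi> i. part w d (x $ i))"

definition vhomog :: "('m \<Rightarrow> 'g) \<Rightarrow> 'g \<Rightarrow> ('m \<Rightarrow>\<^sub>0 'a::zero)^'n \<Rightarrow> bool" where
  "vhomog w d x \<longleftrightarrow> (\<forall>i. homog w d (x $ i))"

lemma vpart_nth [simp]: "vpart w d x $ i = part w d (x $ i)"
  by (simp add: vpart_def)

lemma vhomog_vpart [simp]: "vhomog w d (vpart w d x)"
  by (simp add: vhomog_def)

lemma vpart_vhomog: "vhomog w d x \<Longrightarrow> vpart w d x = x"
  by (simp add: vhomog_def vec_eq_iff part_homog[where e = d])

lemma (in weight) vpart_scale:
  "homog w e c \<Longrightarrow> vpart w d (c *s x) = c *s vpart w (d - e) x"
  for x :: "('m \<Rightarrow>\<^sub>0 'a::comm_ring_1)^'n"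
  by (simp add: vec_eq_iff part_mult_left)

lemma (in weight) vpart_vector_matrix_mult:
  fixes A :: "('m \<Rightarrow>\<^sub>0 'a::comm_ring_1)^'n^'m2"
  assumes "\<And>i j. homog w e (A $ i $ j)"
  shows "vpart w d (x v* A) = vpart w (d - e) x v* A"
  using assms by (simp add: vec_eq_iff vector_matrix_mult_def part_sum_mult)

lemma (in weight) vpart_matrix_vector_mult:
  fixes A :: "('m \<Rightarrow>\<^sub>0 'a::comm_ring_1)^'n^'m2"
  assumes "\<And>i j. homog w e (A $ i $ j)"
  shows "vpart w d (A *v x) = A *v vpart w (d - e) x"
  by (simp add: vec_eq_iff matrix_vector_mult_def part_sum part_mult_left[OF assms])

section \<open>The ideals in the definition of basepoint freeness\<close>

lemma mem_ideal_uv_iff: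
  fixes p :: "'k::field bipoly"
  shows "p \<in> ideal_gen {var Xu, var Xv} \<longleftrightarrow> (\<forall>m\<in>Poly_Mapping.keys p. 0 < Poly_Mapping.lookup m Xu + Poly_Mapping.lookup m Xv)"
proof
  assume "p \<in> ideal_gen {var Xu, var Xv}"
  then obtain a where "p - a * var Xu \<in> module.span (*) {var Xv}"
    unfolding ideal_gen_def module.span_insert[OF module_times, of "var Xu"] by blast
  then obtain b where "p - a * var Xu = b * var Xv"
    unfolding module.span_singleton[OF module_times] by blast
  then have p: "p = var Xu ^ 1 * a + var Xv ^ 1 * b" by (simp add: algebra_simps)
  have "1 \<le> Poly_Mapping.lookup m Xu" if "m \<in> Poly_Mapping.keys (var Xu ^ 1 * a)" for m
    using that var_power_dvd_iff[of Xu 1 "var Xu ^ 1 * a"] by simp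
  moreover have "1 \<le> Poly_Mapping.lookup m Xv" if "m \<in> Poly_Mapping.keys (var Xv ^ 1 * b)" for m
    using that var_power_dvd_iff[of Xv 1 "var Xv ^ 1 * b"] by simp
  ultimately show "\<forall>m\<in>Poly_Mapping.keys p. 0 < Poly_Mapping.lookup m Xu + Poly_Mapping.lookup m Xv"
    unfolding p using keys_add[of "var Xu ^ 1 * a" "var Xv ^ 1 * b"] by fastforce
next
  assume *: "\<forall>m\<in>Poly_Mapping.keys p. 0 < Poly_Mapping.lookup m Xu + Poly_Mapping.lookup m Xv"
  let ?w = "\<lambda>m::indet \<Rightarrow>\<^sub>0 nat. 1 \<le> Poly_Mapping.lookup m Xu"
  have "var Xu ^ 1 dvd part ?w True p" "var Xv ^ 1 dvd part ?w False p"
    unfolding var_power_dvd_iff keys_part using * by auto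
  then obtain a b where ab: "part ?w True p = var Xu * a" "part ?w False p = var Xv * b"
    by (auto elim!: dvdE)
  have "p = a * var Xu + b * var Xv"
    using part_compl[of p ?w] unfolding ab by (simp add: mult.commute)
  then show "p \<in> ideal_gen {var Xu, var Xv}"
    unfolding ideal_gen_def
    by (simp add: module.span_add[OF module_times] module.span_scale[OF module_times] module.span_base[OF module_times])
qed

lemma ideal_uv_add: "p \<in> ideal_gen {var Xu, var Xv} \<Longrightarrow> q \<in> ideal_gen {var Xu, var Xv} \<Longrightarrow>
    p + q \<in> ideal_gen {var Xu, var Xv}"
  unfolding ideal_gen_def by (rule module.span_add[OF module_times])

lemma ideal_uv_mult: "p \<in> ideal_gen {var Xu, var Xv} \<Longrightarrow> q * p \<in> ideal_gen {var Xu, var Xv}"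
  unfolding ideal_gen_def by (rule module.span_scale[OF module_times])

lemma ideal_uv_sum: "(\<And>i. i \<in> I \<Longrightarrow> h i \<in> ideal_gen {var Xu, var Xv}) \<Longrightarrow>
    sum h I \<in> ideal_gen {var Xu, var Xv}"
  unfolding ideal_gen_def by (rule module.span_sum[OF module_times])

lemma mem_ideal_range:
  fixes f :: "'r::comm_ring_1^'n"
  assumes "p \<in> ideal_gen {f $ i | i. True}"
  shows "\<exists>h. p = (\<Sum>i\<in>UNIV. h i * f $ i)"
proof -
  have "p \<in> module.span (*) ((($) f) ` UNIV)"
    using assms unfolding ideal_gen_def by (simp add: full_SetCompr_eq)
  then show ?thesis
  proof (rule module.span_induct_alt[OF module_times])
    show "\<exists>h. 0 = (\<Sum>i\<in>UNIV. h i * f $ i)" by (intro exI[of _ "\<lambda>_. 0"]) simp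
  next
    fix c x y
    assume "x \<in> range (($) f)" "\<exists>h. y = (\<Sum>i\<in>UNIV. h i * f $ i)"
    then obtain i h where "x = f $ i" "y = (\<Sum>i\<in>UNIV. h i * f $ i)" by auto
    then have "c * x + y = (\<Sum>j\<in>UNIV. (h j + (if j = i then c else 0)) * f $ j)"
      by (simp add: distrib_right sum.distrib if_distribR if_distrib[of "\<lambda>a. a * f $ _"] cong: if_cong)
    then show "\<exists>h. c * x + y = (\<Sum>i\<in>UNIV. h i * f $ i)"
      by (intro exI[of _ "\<lambda>j. h j + (if j = i then c else 0)"])
  qed
qed

text \<open>The product of a variable of each kind lies in both ideals whose intersection is the radical.
  The exponent is a successor because comparing the terms with the highest power of y requires
  splitting off one factor y.\<close>

lemma basepoint_free_power:
  fixes f :: "'k::field bipoly^3"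
  assumes "basepoint_free f" "x \<in> {Xu, Xv}" "y \<in> {Xs, Xt}"
  shows "\<exists>k h. (var x * var y) ^ Suc k = (\<Sum>i\<in>UNIV. h i * f $ i)"
proof -
  have "var x * var y \<in> ideal_gen {var Xs, var Xt :: 'k bipoly}"
    unfolding ideal_gen_def
    by (rule module.span_scale[OF module_times], rule module.span_base[OF module_times]) (use assms(3) in auto)
  moreover have "var y * var x \<in> ideal_gen {var Xu, var Xv :: 'k bipoly}"
    unfolding ideal_gen_def
    by (rule module.span_scale[OF module_times], rule module.span_base[OF module_times]) (use assms(2) in auto)
  ultimately have "var x * var y \<in> ideal_gen {var Xs, var Xt} \<inter> ideal_gen {var Xu, var Xv :: 'k bipoly}"
    by (simp add: mult.commute)
  then have "var x * var y \<in> radical (ideal_gen {f $ i | i. True})"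
    using assms(1) unfolding basepoint_free_def by simp
  then obtain k where "(var x * var y) ^ k \<in> ideal_gen {f $ i | i. True}"
    unfolding radical_def by blast
  then have "(var x * var y) ^ Suc k \<in> ideal_gen {f $ i | i. True}"
    unfolding ideal_gen_def power_Suc by (rule module.span_scale[OF module_times])
  from mem_ideal_range[OF this] show ?thesis by blast
qed

section \<open>The Hilbert-Burch resolution over the bigraded ring\<close>

locale hilbert_burch_setting =
  fixes n :: nat and q :: "'k::field bipoly^6" and f :: "'k bipoly^3"
    and N :: "'k bipoly^5^6" and b :: "5 \<Rightarrow> nat"
  assumes q_deg: "\<forall>i. q $ i \<in> R_comp (0, int n)"
    and q_indep: "\<forall>c :: 6 \<Rightarrow> 'k. (\<Sum>i\<in>UNIV. const (c i) * q $ i) = 0 \<longrightarrow> (\<forall>i. c i = 0)"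
    and f_eq: "f = vector [var Xs * q $ 0 + var Xt * q $ 3,
                           var Xs * q $ 1 + var Xt * q $ 4,
                           var Xs * q $ 2 + var Xt * q $ 5]"
    and bpf: "basepoint_free f"
    and HB: "hilbert_burch q b N"
begin

lemma f_nth: "f $ i = var Xs * upper q $ i + var Xt * lower q $ i"
  unfolding f_eq using exhaust_3[of i] by auto

lemma q_Kuv: "q $ i \<in> Kuv"
  using q_deg homog_bideg_Kuv by (auto simp: R_comp_iff)

lemma N_bideg: "homog mon_bideg (0, int (b j)) (N $ i $ j)"
  using HB by (auto simp: hilbert_burch_def R_comp_iff)

lemma N_Kuv: "N $ i $ j \<in> Kuv"
  using N_bideg homog_bideg_Kuv by blast

lemma N_ideal_uv: "N $ i $ j \<in> ideal_gen {var Xu, var Xv}"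
  using HB by (auto simp: hilbert_burch_def)

lemma kernel_q_Kuv:
  assumes "\<And>i. x $ i \<in> Kuv" "(\<Sum>i\<in>UNIV. x $ i * q $ i) = 0"
  shows "\<exists>y. (\<forall>j. y $ j \<in> Kuv) \<and> x = N *v y"
proof -
  have "x \<in> {x. (\<forall>i. x $ i \<in> Kuv) \<and> (\<Sum>i\<in>UNIV. x $ i * q $ i) = 0}" using assms by simp
  then have "x \<in> {N *v y | y. \<forall>j. y $ j \<in> Kuv}" using HB unfolding hilbert_burch_def by argo
  then show ?thesis by blast
qed

lemma N_column_kernel: "(\<Sum>i\<in>UNIV. N $ i $ j * q $ i) = 0"
proof -
  have "axis j 1 $ l \<in> (Kuv :: 'k bipoly set)" for l
    by (simp add: axis_def Kuv_0 Kuv_1)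
  then have "N *v axis j 1 \<in> {N *v y | y. \<forall>j. y $ j \<in> Kuv}" by blast
  then have "N *v axis j 1 \<in> {x. (\<forall>i. x $ i \<in> Kuv) \<and> (\<Sum>i\<in>UNIV. x $ i * q $ i) = 0}"
    using HB unfolding hilbert_burch_def by argo
  moreover have "(N *v axis j 1) $ i = N $ i $ j" for i
    by (simp add: matrix_vector_mult_def axis_def if_distrib cong: if_cong)
  ultimately show ?thesis by simp
qed

lemma q_mult_N: "q v* N = 0"
  using N_column_kernel by (simp add: vec_eq_iff vector_matrix_mult_def mult.commute)

lemma image_N_in_kernel: "(\<Sum>i\<in>UNIV. (N *v y) $ i * q $ i) = 0"
  using sum_mult_matrix_vector_mult[of q N y] by (simp add: q_mult_N mult.commute)

lemma N_inj_Kuv: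
  assumes "\<And>j. y $ j \<in> Kuv" "N *v y = 0"
  shows "y = 0"
proof -
  have "\<forall>y. (\<forall>j. y $ j \<in> Kuv) \<and> N *v y = 0 \<longrightarrow> y = 0"
    using HB unfolding hilbert_burch_def by (elim conjE)
  then show ?thesis using assms by simp
qed

lemma q_nonzero: "q $ i \<noteq> 0"
proof
  assume i: "q $ i = 0"
  define c :: "6 \<Rightarrow> 'k" where "c j = (if j = i then 1 else 0)" for j
  have "const (c j) * q $ j = 0" for j
    by (cases "j = i") (simp_all add: c_def i const_def)
  then have "(\<Sum>j\<in>UNIV. const (c j) * q $ j) = 0" by (intro sum.neutral ballI)
  then have "c i = 0" by (rule q_indep[rule_format])
  then show False by (simp add: c_def)
qed

text \<open>The ideal of the \<open>q\<^sub>i\<close> contains a power of each of u and v: in a relation expressing \<open>(x s)\<^sup>k\<close>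
  by the \<open>f\<^sub>i\<close>, compare the terms with \<open>s\<^sup>k\<close> and without t.\<close>

lemma var_power_in_ideal_q:
  assumes x: "x \<in> {Xu, Xv}"
  shows "\<exists>k w. (\<forall>i. w $ i \<in> Kuv) \<and> (\<Sum>i\<in>UNIV. w $ i * q $ i) = var x ^ k"
proof -
  let ?e = "exps Xs Xt"
  obtain l h where hl: "(var x * var Xs) ^ Suc l = (\<Sum>i\<in>UNIV. h i * f $ i)"
    using basepoint_free_power[OF bpf x, of Xs] by auto
  define k where "k = Suc l"
  have h: "(var x * var Xs) ^ k = (\<Sum>i\<in>UNIV. h i * f $ i)"
    using hl unfolding k_def .
  have hx: "homog ?e 0 (var x ^ k :: 'k bipoly)"
    by (rule Kuv_exps(1)[OF Kuv_var_power[OF x]])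
  have hs: "homog ?e (int j, 0) (var Xs ^ j :: 'k bipoly)" for j
    using homog_var_power[of ?e Xs j] by (simp add: exps_def lookup_single)
  have hs1: "homog ?e (1, 0) (var Xs :: 'k bipoly)" using hs[of 1] by simp
  have ht1: "homog ?e (0, 1) (var Xt :: 'k bipoly)"
    using homog_var_power[of ?e Xt 1] by (simp add: exps_def lookup_single)
  have hq: "homog ?e 0 (q $ i)" for i by (rule Kuv_exps(1)[OF q_Kuv])
  have hq': "homog ?e 0 (upper q $ i)" "homog ?e 0 (lower q $ i)" for i
    using exhaust_3[of i] hq by auto
  \<comment> \<open>The terms t times lower q would need a coefficient with exponent -1 of t.\<close>
  have negative: "part ?e (d, - 1) p = 0" for d and p :: "'k bipoly"
    by (rule poly_mapping_eqI) (auto simp: part.rep_eq exps_def)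
  have "\<exists>w. part ?e (int l, 0) (h i) = var Xs ^ l * w" for i
  proof -
    have "var Xs ^ l dvd part ?e (int l, 0) (h i)"
      unfolding var_power_dvd_iff keys_part by (auto simp: exps_def)
    then show ?thesis by (auto elim: dvdE)
  qed
  then obtain w where w: "\<And>i. part ?e (int l, 0) (h i) = var Xs ^ l * w i" by metis
  have "part ?e (int k, 0) (h i * f $ i) = var Xs ^ k * (w i * upper q $ i)" for i
  proof -
    have 1: "part ?e (int k, 0) (h i * (var Xs * upper q $ i)) =
        part ?e (int l, 0) (h i) * (var Xs * upper q $ i)"
      using exps.part_mult[OF exps.homog_mult[OF hs1 hq'(1)], of "(int k, 0)" "h i" i] by (simp add: k_def)
    have 2: "part ?e (int k, 0) (h i * (var Xt * lower q $ i)) = 0"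
      using exps.part_mult[OF exps.homog_mult[OF ht1 hq'(2)], of "(int k, 0)" "h i" i]
      by (simp add: negative)
    show ?thesis
      unfolding f_nth distrib_left part_add 1 2 w by (simp add: k_def mult_ac)
  qed
  then have "part ?e (int k, 0) (\<Sum>i\<in>UNIV. h i * f $ i) = var Xs ^ k * (\<Sum>i\<in>UNIV. w i * upper q $ i)"
    by (simp add: part_sum sum_distrib_left)
  moreover have "homog ?e (int k, 0) ((var x * var Xs) ^ k :: 'k bipoly)"
    using exps.homog_mult[OF hx hs[of k]] by (simp add: power_mult_distrib)
  then have "part ?e (int k, 0) ((var x * var Xs) ^ k) = ((var x * var Xs) ^ k :: 'k bipoly)"
    by (simp add: part_homog[where e = "(int k, 0)"])
  ultimately have "var Xs ^ k * var x ^ k = var Xs ^ k * (\<Sum>i\<in>UNIV. w i * upper q $ i)"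
    unfolding h[symmetric] by (simp only: power_mult_distrib mult.commute)
  then have *: "var x ^ k = (\<Sum>i\<in>UNIV. w i * upper q $ i)" by simp
  have "part ?e 0 (\<Sum>i\<in>UNIV. w i * upper q $ i) = (\<Sum>i\<in>UNIV. part ?e (0 - 0) (w i) * upper q $ i)"
    by (rule exps.part_sum_mult) (rule hq'(1))
  moreover have "part ?e 0 (var x ^ k) = (var x ^ k :: 'k bipoly)"
    unfolding part_homog[OF hx] by simp
  ultimately have eq: "var x ^ k = (\<Sum>i\<in>UNIV. part ?e 0 (w i) * upper q $ i)"
    unfolding *[symmetric] by simp
  let ?w = "join (\<chi> i. part ?e 0 (w i)) 0"
  have "(\<Sum>i\<in>UNIV. ?w $ i * q $ i) = var x ^ k"
    unfolding eq by (simp add: sum_3 sum_6 join_nth)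
  moreover have "?w $ i \<in> Kuv" for i
    using exhaust_6[of i] by (elim disjE) (simp_all add: join_nth Kuv_0 Kuv_part)
  ultimately show ?thesis by blast
qed

text \<open>With w chosen such that w paired with q is a power \<open>\<alpha>\<close> of x, the vectors \<open>\<alpha> e\<^sub>i - q\<^sub>i w\<close> lie in the
  kernel of q. Writing them as \<open>N y\<^sub>i\<close> splits the resolution up to \<open>\<alpha>\<close>. The resulting identities are
  matrix identities, hence they hold with coefficients in all of R and carry the exactness of the
  resolution from \<open>K[u,v]\<close> to R.\<close>

lemma N_left_inverse_up_to_power:
  assumes x: "x \<in> {Xu, Xv}"
  obtains k w Y where "Y ** N = mat (var x ^ k)" "(\<Sum>i\<in>UNIV. w $ i * q $ i) = var x ^ k"
    "\<And>v. var x ^ k *s v = (\<Sum>i\<in>UNIV. v $ i * q $ i) *s w + N *v (Y *v v)"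
proof -
  obtain k w where wK: "\<And>i. w $ i \<in> Kuv" and w: "(\<Sum>i\<in>UNIV. w $ i * q $ i) = var x ^ k"
    using var_power_in_ideal_q[OF x] by blast
  let ?\<alpha> = "var x ^ k :: 'k bipoly"
  have \<alpha>K: "?\<alpha> \<in> Kuv" using Kuv_var_power[OF x] .
  have "\<exists>y. (\<forall>j. y $ j \<in> Kuv) \<and> ?\<alpha> *s axis i 1 - q $ i *s w = N *v y" for i
  proof (rule kernel_q_Kuv)
    show "(?\<alpha> *s axis i 1 - q $ i *s w) $ j \<in> Kuv" for j
      using \<alpha>K q_Kuv wK by (simp add: axis_def Kuv_0 Kuv_diff Kuv_mult)
    have "(\<Sum>j\<in>UNIV. (?\<alpha> *s axis i 1 - q $ i *s w) $ j * q $ j) =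
        ?\<alpha> * (\<Sum>j\<in>UNIV. axis i 1 $ j * q $ j) - q $ i * (\<Sum>j\<in>UNIV. w $ j * q $ j)"
      by (simp add: sum_distrib_left sum_subtractf algebra_simps)
    also have "(\<Sum>j\<in>UNIV. axis i 1 $ j * q $ j) = q $ i"
      by (simp add: axis_def if_distrib if_distribR cong: if_cong)
    finally show "(\<Sum>j\<in>UNIV. (?\<alpha> *s axis i 1 - q $ i *s w) $ j * q $ j) = 0"
      by (simp add: w)
  qed
  then obtain y where yK: "\<And>i j. y i $ j \<in> Kuv"
    and y: "\<And>i. ?\<alpha> *s axis i 1 - q $ i *s w = N *v y i" by metis
  define Y :: "'k bipoly^6^5" where "Y = (\<chi> j i. y i $ j)"
  have split: "?\<alpha> *s v = (\<Sum>i\<in>UNIV. v $ i * q $ i) *s w + N *v (Y *v v)" for v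
  proof -
    have "(N *v (Y *v v)) $ j = (?\<alpha> *s v) $ j - (\<Sum>i\<in>UNIV. v $ i * q $ i) * w $ j" for j
    proof -
      have "(N *v (Y *v v)) $ j = (\<Sum>l\<in>UNIV. N $ j $ l * (Y *v v) $ l)"
        by (simp add: matrix_vector_mult_def)
      also have "\<dots> = (\<Sum>i\<in>UNIV. (N $ j v* Y) $ i * v $ i)"
        by (rule sum_mult_matrix_vector_mult)
      also have "\<dots> = (\<Sum>i\<in>UNIV. v $ i * (N *v y i) $ j)"
        by (simp add: vector_matrix_mult_def matrix_vector_mult_def Y_def mult.commute)
      also have "\<dots> = (\<Sum>i\<in>UNIV. ?\<alpha> * (v $ i * axis i 1 $ j) - v $ i * q $ i * w $ j)"
        unfolding y[symmetric] by (simp add: algebra_simps)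
      also have "\<dots> = ?\<alpha> * (\<Sum>i\<in>UNIV. v $ i * axis i 1 $ j) - (\<Sum>i\<in>UNIV. v $ i * q $ i) * w $ j"
        by (simp add: sum_subtractf sum_distrib_left sum_distrib_right)
      also have "(\<Sum>i\<in>UNIV. v $ i * axis i 1 $ j) = v $ j"
        by (simp add: axis_def if_distrib cong: if_cong)
      finally show ?thesis by simp
    qed
    then show ?thesis by (simp add: vec_eq_iff)
  qed
  have "(Y ** N) *v axis j 1 = ?\<alpha> *s axis j 1" for j
  proof -
    let ?c = "N *v axis j 1"
    have "?\<alpha> *s ?c = N *v (Y *v ?c)" using split[of ?c] by (simp add: image_N_in_kernel)
    then have "N *v (Y *v ?c - ?\<alpha> *s axis j 1) = 0"
      by (simp add: matrix_vector_mult_diff_distrib matrix_vector_mult_scale)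
    moreover have "(Y *v ?c - ?\<alpha> *s axis j 1) $ l \<in> Kuv" for l
    proof -
      have e: "axis j 1 $ i \<in> (Kuv :: 'k bipoly set)" for i
        by (simp add: axis_def Kuv_0 Kuv_1)
      have "(Y *v ?c) $ l \<in> Kuv"
        by (intro Kuv_matrix_vector_mult N_Kuv e) (simp add: Y_def yK)
      then show ?thesis using Kuv_mult[OF \<alpha>K e] by (simp add: Kuv_diff)
    qed
    ultimately have "Y *v ?c - ?\<alpha> *s axis j 1 = 0" using N_inj_Kuv by blast
    then show ?thesis by (simp add: matrix_vector_mul_assoc)
  qed
  moreover have "((Y ** N) *v axis j 1) $ i = (Y ** N) $ i $ j" for i j
    by (simp add: matrix_vector_mult_def axis_def if_distrib cong: if_cong)
  ultimately have "(Y ** N) $ i $ j = ?\<alpha> * axis j 1 $ i" for i j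
    by (simp flip: vector_smult_component)
  then have "Y ** N = mat ?\<alpha>"
    by (simp add: vec_eq_iff mat_def axis_def)
  then show ?thesis using that w split by blast
qed

lemma N_left_kernel:
  assumes x: "x \<in> {Xu, Xv}"
  obtains k Y where "Y ** N = mat (var x ^ k)"
    "\<And>z. z v* N = 0 \<Longrightarrow> \<exists>\<kappa>. var x ^ k *s z = \<kappa> *s q"
proof -
  obtain k w Y where YN: "Y ** N = mat (var x ^ k)"
    and "(\<Sum>i\<in>UNIV. w $ i * q $ i) = var x ^ k"
    and split: "\<And>v. var x ^ k *s v = (\<Sum>i\<in>UNIV. v $ i * q $ i) *s w + N *v (Y *v v)"
    by (rule N_left_inverse_up_to_power[OF x]) (rule that)
  have "var x ^ k *s z = (\<Sum>i\<in>UNIV. z $ i * w $ i) *s q" if z: "z v* N = 0" for z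
  proof -
    have "var x ^ k * z $ l = (\<Sum>i\<in>UNIV. z $ i * w $ i) * q $ l" for l
    proof -
      have "var x ^ k * z $ l = (\<Sum>i\<in>UNIV. z $ i * (var x ^ k *s axis l 1) $ i)"
        by (simp add: axis_def if_distrib mult.commute cong: if_cong)
      also have "\<dots> = (\<Sum>i\<in>UNIV. z $ i * (q $ l * w $ i)) +
          (\<Sum>i\<in>UNIV. z $ i * (N *v (Y *v axis l 1)) $ i)"
      proof -
        have "(\<Sum>i\<in>UNIV. axis l 1 $ i * q $ i) = q $ l"
          by (simp add: axis_def if_distrib if_distribR cong: if_cong)
        then show ?thesis unfolding split by (simp add: sum.distrib distrib_left)
      qed
      finally show ?thesis
        unfolding sum_mult_matrix_vector_mult by (simp add: z sum_distrib_left mult_ac)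
    qed
    then show ?thesis by (simp add: vec_eq_iff)
  qed
  with that YN show ?thesis by blast
qed

lemma N_inj: "N *v c = 0 \<Longrightarrow> c = 0"
proof -
  assume c: "N *v c = 0"
  obtain k Y where "Y ** N = mat (var Xu ^ k)" using N_left_kernel[of Xu] by blast
  then have "mat (var Xu ^ k) *v c = 0" using c matrix_vector_mul_assoc[of Y N c] by simp
  then show "c = 0"
    by (simp add: mat_vector_mult vec_eq_iff)
qed

text \<open>Up to a power of u and up to a power of v the vector lies in the image of N; injectivity of N
  makes the two preimages compatible, so both denominators can be removed.\<close>

lemma kernel_q:
  assumes v: "(\<Sum>i\<in>UNIV. v $ i * q $ i) = 0"
  shows "\<exists>c. v = N *v c"
proof -
  obtain k w Y where "Y ** N = mat (var Xu ^ k)" "(\<Sum>i\<in>UNIV. w $ i * q $ i) = var Xu ^ k"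
    and split: "\<And>v. var Xu ^ k *s v = (\<Sum>i\<in>UNIV. v $ i * q $ i) *s w + N *v (Y *v v)"
    by (rule N_left_inverse_up_to_power[of Xu], simp) (rule that)
  have k: "var Xu ^ k *s v = N *v (Y *v v)" unfolding split[of v] v by simp
  obtain l w' Z where "Z ** N = mat (var Xv ^ l)" "(\<Sum>i\<in>UNIV. w' $ i * q $ i) = var Xv ^ l"
    and split': "\<And>v. var Xv ^ l *s v = (\<Sum>i\<in>UNIV. v $ i * q $ i) *s w' + N *v (Z *v v)"
    by (rule N_left_inverse_up_to_power[of Xv], simp) (rule that)
  have l: "var Xv ^ l *s v = N *v (Z *v v)" unfolding split'[of v] v by simp
  have "N *v (var Xv ^ l *s (Y *v v) - var Xu ^ k *s (Z *v v)) = 0"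
    by (simp add: matrix_vector_mult_diff_distrib matrix_vector_mult_scale vector_smult_assoc
        mult.commute flip: k l)
  then have "var Xv ^ l *s (Y *v v) = var Xu ^ k *s (Z *v v)" using N_inj by fastforce
  then obtain c where "Y *v v = var Xu ^ k *s c"
    using vec_var_power_cancel[of Xv Xu] by blast
  then have "var Xu ^ k *s v = var Xu ^ k *s (N *v c)"
    using k by (simp add: matrix_vector_mult_scale)
  then show ?thesis using vec_power_cancel by blast
qed

end

section \<open>The kernel of the pencil in degree three\<close>

lemma cramer_vec_sum_axis: "cramer_vec M g = (\<Sum>j\<in>UNIV. g $ j *s cramer_vec M (axis j 1))"
  by (simp add: vec_eq_iff cramer_vec_nth[of M g]) (simp add: cramer_vec_def)

context hilbert_burch_setting
begin

abbreviation M where "M \<equiv> pencil (var Xs) (var Xt) N"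

lemma M_stdeg: "homog stdeg 1 (M $ i $ j)"
proof -
  have "homog stdeg 0 (upper N $ i $ j)" "homog stdeg 0 (lower N $ i $ j)"
    using exhaust_3[of i] N_Kuv by (auto simp: Kuv_iff_stdeg)
  then have "homog stdeg (1 + 0) (var Xt * upper N $ i $ j - var Xs * lower N $ i $ j)"
    by (intro homog_diff stdeg.homog_mult) (simp_all add: stdeg_var)
  then show ?thesis by (simp add: pencil_def)
qed

lemma N_stdeg: "homog stdeg 0 (N $ i $ j)"
  using N_Kuv by (simp add: Kuv_iff_stdeg)

lemma pairing_stdeg: "homog stdeg 3 (pairing M (axis j 1) (axis k 1))"
proof -
  define \<rho> :: "5 \<Rightarrow> int" where "\<rho> i = (if i = 4 \<or> i = 0 then 0 else 1)" for i
  have "homog stdeg ((\<Sum>i\<in>UNIV. \<rho> i) + (\<Sum>j\<in>(UNIV :: 5 set). 0)) (pairing M (axis j 1) (axis k 1))"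
    unfolding pairing_def
  proof (rule stdeg.homog_det)
    have axis: "homog stdeg 0 (axis j 1 $ l :: 'k bipoly)" for j l :: 5
      by (simp add: axis_def stdeg.homog_1)
    show "homog stdeg (\<rho> i + 0) (vector [M $ 1, M $ 2, M $ 3, axis j 1, axis k 1] $ i $ l)" for i l
      using exhaust_5[of i] by (elim disjE) (simp_all add: vector_5 \<rho>_def M_stdeg axis)
  qed
  then show ?thesis by (simp add: \<rho>_def sum_5)
qed

lemma vpart_cramer_vec: "vpart stdeg d (cramer_vec M g) = cramer_vec M (vpart stdeg (d - 3) g)"
proof -
  have "part stdeg d (\<Sum>j\<in>UNIV. g $ j * pairing M (axis j 1) (axis k 1)) =
      (\<Sum>j\<in>UNIV. part stdeg (d - 3) (g $ j) * pairing M (axis j 1) (axis k 1))" for k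
    by (rule stdeg.part_sum_mult) (rule pairing_stdeg)
  then show ?thesis by (simp add: vec_eq_iff cramer_vec_nth)
qed

lemma vpart_vector_mult_M: "vpart stdeg d (z v* M) = vpart stdeg (d - 1) z v* M"
  by (rule stdeg.vpart_vector_matrix_mult) (rule M_stdeg)

lemma vpart_N_mult: "vpart stdeg d (N *v c) = N *v vpart stdeg d c"
  using stdeg.vpart_matrix_vector_mult[of 0 N d c] N_stdeg by simp

lemma f_nonzero: "\<exists>i. f $ i \<noteq> 0"
proof (rule ccontr)
  assume "\<nexists>i. f $ i \<noteq> 0"
  then have "\<And>i. f $ i = 0" by blast
  moreover obtain k h where "(var Xu * var Xs) ^ Suc k = (\<Sum>i\<in>UNIV. h i * f $ i)"
    using basepoint_free_power[OF bpf, of Xu Xs] by blast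
  ultimately have "(var Xu * var Xs :: 'k bipoly) ^ Suc k = 0" by simp
  then show False by simp
qed

text \<open>The left kernel of N has rank one and is spanned by q, up to a nonzero factor.\<close>

lemma left_kernel_cases:
  assumes "x v* upper N + y v* lower N = 0"
  shows "\<exists>\<alpha> \<kappa>. \<alpha> \<noteq> 0 \<and> \<alpha> *s x = \<kappa> *s upper q \<and> \<alpha> *s y = \<kappa> *s lower q"
proof -
  obtain k Y where "Y ** N = mat (var Xu ^ k)"
    and ker: "\<And>z. z v* N = 0 \<Longrightarrow> \<exists>\<kappa>. var Xu ^ k *s z = \<kappa> *s q"
    by (rule N_left_kernel[of Xu], simp) (rule that)
  have "join x y v* N = 0" using assms by (simp add: vector_matrix_mult_upper_lower)
  from ker[OF this] obtain \<kappa> where "var Xu ^ k *s join x y = \<kappa> *s q" by blast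
  then have "var Xu ^ k *s x = \<kappa> *s upper q \<and> var Xu ^ k *s y = \<kappa> *s lower q"
    unfolding vec6_eq_iff by (simp add: upper_scale lower_scale)
  moreover have "var Xu ^ k \<noteq> (0 :: 'k bipoly)" by simp
  ultimately show ?thesis by blast
qed

lemma upper_N_left_inj: "z v* upper N = 0 \<Longrightarrow> z = 0"
proof -
  assume "z v* upper N = 0"
  then have "z v* upper N + 0 v* lower N = 0" by simp
  from left_kernel_cases[OF this] obtain \<alpha> \<kappa> where \<alpha>: "\<alpha> \<noteq> 0" and
    *: "\<alpha> *s z = \<kappa> *s upper q" "\<alpha> *s 0 = \<kappa> *s lower q" by blast
  have "\<kappa> * q $ 3 = 0" using arg_cong[OF *(2), of "\<lambda>v. v $ 1"] by simp
  then have "\<kappa> = 0" using q_nonzero by simp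
  then show "z = 0" using *(1) \<alpha> by (simp add: vec_eq_iff)
qed

lemma lower_N_left_inj: "z v* lower N = 0 \<Longrightarrow> z = 0"
proof -
  assume "z v* lower N = 0"
  then have "0 v* upper N + z v* lower N = 0" by simp
  from left_kernel_cases[OF this] obtain \<alpha> \<kappa> where \<alpha>: "\<alpha> \<noteq> 0" and
    *: "\<alpha> *s 0 = \<kappa> *s upper q" "\<alpha> *s z = \<kappa> *s lower q" by blast
  have "\<kappa> * q $ 0 = 0" using arg_cong[OF *(1), of "\<lambda>v. v $ 1"] by simp
  then have "\<kappa> = 0" using q_nonzero by simp
  then show "z = 0" using *(2) \<alpha> by (simp add: vec_eq_iff)
qed

text \<open>A vector z with \<open>z v* M = 0\<close> gives the element \<open>(t z, - s z)\<close> of the left kernel of N, which is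
  proportional to q. The combination \<open>s (upper part) + t (lower part)\<close> vanishes for this element
  but equals f for q, so the factor of proportionality is zero.\<close>

lemma M_left_inj: "z v* M = 0 \<Longrightarrow> z = 0"
proof -
  assume "z v* M = 0"
  then have "(var Xt *s z) v* upper N + ((- var Xs) *s z) v* lower N = 0"
    unfolding vector_mult_pencil
    by (simp add: vec_eq_iff vector_matrix_mult_def sum_3 algebra_simps)
  from left_kernel_cases[OF this] obtain \<alpha> \<kappa> where \<alpha>: "\<alpha> \<noteq> 0"
    and 1: "\<alpha> *s (var Xt *s z) = \<kappa> *s upper q" and 2: "\<alpha> *s ((- var Xs) *s z) = \<kappa> *s lower q"
    by blast
  obtain i where i: "f $ i \<noteq> 0" using f_nonzero by blast
  have "\<kappa> * f $ i = var Xs * (\<kappa> *s upper q) $ i + var Xt * (\<kappa> *s lower q) $ i"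
    by (simp add: f_nth algebra_simps)
  also have "\<dots> = 0" unfolding 1[symmetric] 2[symmetric] by (simp add: algebra_simps)
  finally have "\<kappa> = 0" using i by simp
  then have "\<alpha> *s (var Xt *s z) = 0" using 1 by simp
  then show "z = 0" using \<alpha> by (simp add: vec_eq_iff)
qed

text \<open>A power of \<open>x y\<close> lies in the ideal of the \<open>f\<^sub>i\<close>, and each \<open>f\<^sub>i\<close> contracts after multiplication by
  powers of x and y. Geometrically: by basepoint freeness M has full rank wherever x and y do not
  vanish.\<close>

lemma contracts_monomial:
  assumes x: "x \<in> {Xu, Xv}" and y: "y \<in> {Xs, Xt}"
  shows "\<exists>k0. \<forall>k\<ge>k0. contracts M (var x ^ k * var y ^ k)"
proof -
  obtain a Y where YN: "Y ** N = mat (var x ^ a)"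
    and ker: "\<And>z. z v* N = 0 \<Longrightarrow> \<exists>\<kappa>. var x ^ a *s z = \<kappa> *s q"
    by (rule N_left_kernel[OF x]) (rule that)
  obtain l h where h: "(var x * var y) ^ Suc l = (\<Sum>i\<in>UNIV. h i * f $ i)"
    using basepoint_free_power[OF bpf x y] by blast
  have nz: "var x ^ a \<noteq> (0 :: 'k bipoly)" by simp
  have "contracts M ((var y * var x ^ a) ^ 5 * f $ i)" for i
    using contracts_pencil(1)[OF nz YN ker, where s = "var Xs" and t = "var Xt" and i = i]
      contracts_pencil(2)[OF nz YN ker, where s = "var Xs" and t = "var Xt" and i = i] y
    by (auto simp: f_nth)
  then have "contracts M (\<Sum>i\<in>UNIV. h i * ((var y * var x ^ a) ^ 5 * f $ i))"
    by (intro contracts_sum, simp) (rule contracts_mult)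
  also have "(\<Sum>i\<in>UNIV. h i * ((var y * var x ^ a) ^ 5 * f $ i)) =
      (var y * var x ^ a) ^ 5 * (var x * var y) ^ Suc l"
    unfolding h by (simp add: sum_distrib_left mult.left_commute)
  also have "\<dots> = var x ^ (5 * a + Suc l) * var y ^ (5 + Suc l)"
    by (simp only: power_mult_distrib power_add power_mult[symmetric] mult_ac)
  finally have c: "contracts M (var x ^ (5 * a + Suc l) * var y ^ (5 + Suc l))" .
  have "contracts M (var x ^ k * var y ^ k)" if "k \<ge> 5 * a + Suc l + 5" for k
  proof -
    define i j where "i = k - (5 * a + Suc l)" and "j = k - (5 + Suc l)"
    then have i: "k = i + (5 * a + Suc l)" and j: "k = j + (5 + Suc l)" using that by simp_all
    have "var x ^ k * var y ^ k = (var x ^ i * var y ^ j) * (var x ^ (5 * a + Suc l) * var y ^ (5 + Suc l) :: 'k bipoly)"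
      by (subst i, subst j) (simp only: power_add mult_ac)
    then show ?thesis using contracts_mult[OF c] by simp
  qed
  then show ?thesis by blast
qed

lemma contracts_common_power:
  "\<exists>k. \<forall>x\<in>{Xu, Xv}. \<forall>y\<in>{Xs, Xt}. contracts M (var x ^ Suc k * var y ^ Suc k)"
proof -
  obtain k1 where 1: "\<forall>k\<ge>k1. contracts M (var Xu ^ k * var Xs ^ k)"
    using contracts_monomial[of Xu Xs] by auto
  obtain k2 where 2: "\<forall>k\<ge>k2. contracts M (var Xu ^ k * var Xt ^ k)"
    using contracts_monomial[of Xu Xt] by auto
  obtain k3 where 3: "\<forall>k\<ge>k3. contracts M (var Xv ^ k * var Xs ^ k)"
    using contracts_monomial[of Xv Xs] by auto
  obtain k4 where 4: "\<forall>k\<ge>k4. contracts M (var Xv ^ k * var Xt ^ k)"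
    using contracts_monomial[of Xv Xt] by auto
  have "contracts M (var x ^ Suc (k1 + k2 + k3 + k4) * var y ^ Suc (k1 + k2 + k3 + k4))"
    if "x \<in> {Xu, Xv}" "y \<in> {Xs, Xt}" for x y
    using that 1 2 3 4 by (auto simp del: power_Suc)
  then show ?thesis by blast
qed

text \<open>One exponent that serves all four products of a variable from \<open>{u, v}\<close> with one from \<open>{s, t}\<close>. It
  is positive because a single factor has to be split off in one of the arguments below.\<close>

definition K :: nat where
  "K = Suc (SOME k. \<forall>x\<in>{Xu, Xv}. \<forall>y\<in>{Xs, Xt}. contracts M (var x ^ Suc k * var y ^ Suc k))"

lemma contracts_K: "x \<in> {Xu, Xv} \<Longrightarrow> y \<in> {Xs, Xt} \<Longrightarrow> contracts M (var x ^ K * var y ^ K)"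
  using someI_ex[OF contracts_common_power] unfolding K_def by blast

text \<open>Exactness of the Buchsbaum-Rim complex at the first \<open>R\<^sup>5\<close> after inverting x. Both \<open>s\<^sup>K\<close> and \<open>t\<^sup>K\<close>
  multiply the vector into the row space, and since M is injective from the left the two
  preimages agree, so that these factors can be cancelled.\<close>

lemma cramer_vec_kernel:
  assumes x: "x \<in> {Xu, Xv}" and c: "cramer_vec M c = 0"
  shows "\<exists>z. var x ^ K *s c = z v* M"
proof -
  obtain z1 where 1: "(var x ^ K * var Xs ^ K) *s c = z1 v* M"
    using contracts_row_space[OF contracts_K[OF x, of Xs] c] by blast
  obtain z2 where 2: "(var x ^ K * var Xt ^ K) *s c = z2 v* M"
    using contracts_row_space[OF contracts_K[OF x, of Xt] c] by blast
  have "(var Xt ^ K *s z1 - var Xs ^ K *s z2) v* M =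
      var Xt ^ K *s (z1 v* M) - var Xs ^ K *s (z2 v* M)"
    by (simp add: vec_eq_iff vector_matrix_mult_def sum_3 algebra_simps)
  also have "\<dots> = 0" unfolding 1[symmetric] 2[symmetric] by (simp add: vec_eq_iff algebra_simps)
  finally have "var Xt ^ K *s z1 = var Xs ^ K *s z2" using M_left_inj by fastforce
  then obtain z where z: "z1 = var Xs ^ K *s z" using vec_var_power_cancel[of Xt Xs] by blast
  have "var Xs ^ K *s (var x ^ K *s c) = var Xs ^ K *s (z v* M)"
    using 1 unfolding z by (simp add: vec_eq_iff vector_matrix_mult_def sum_3 algebra_simps)
  then have "var x ^ K *s c = z v* M" by (rule vec_power_cancel)
  then show ?thesis by blast
qed

text \<open>Up to a power of u, a kernel vector is a combination of the rows of M, and those have degree one in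
  s and t, whereas the entries of the vector have degree zero.\<close>

lemma cramer_vec_inj_Kuv:
  assumes c: "cramer_vec M c = 0" and cK: "\<And>j. c $ j \<in> Kuv"
  shows "c = 0"
proof -
  obtain z where z: "var Xu ^ K *s c = z v* M" using cramer_vec_kernel[of Xu, OF _ c] by blast
  have "vhomog stdeg 0 (var Xu ^ K *s c)"
    using Kuv_mult[OF Kuv_var_power cK] by (simp add: vhomog_def flip: Kuv_iff_stdeg)
  then have "var Xu ^ K *s c = vpart stdeg 0 (var Xu ^ K *s c)" by (simp add: vpart_vhomog)
  also have "\<dots> = vpart stdeg (- 1) z v* M" unfolding z vpart_vector_mult_M by simp
  also have "vpart stdeg (- 1) z = 0"
    by (simp add: vec_eq_iff) (auto intro!: poly_mapping_eqI simp: part.rep_eq stdeg_def)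
  finally show ?thesis by (simp add: vec_eq_iff)
qed

text \<open>A monomial of degree 2k - 1 in two variables is divisible by the k-th power of one of them. This
  is the vanishing of the first cohomology of \<open>O(-1)\<close> on the projective line, in Cech form.\<close>

lemma split_stdeg:
  fixes z :: "'k bipoly^'n"
  assumes "vhomog stdeg (2 * int k - 1) z"
  shows "\<exists>z1 z2. z = var Xt ^ k *s z1 - var Xs ^ k *s z2"
proof -
  let ?w = "\<lambda>m::indet \<Rightarrow>\<^sub>0 nat. k \<le> Poly_Mapping.lookup m Xt"
  have "var Xt ^ k dvd part ?w True (z $ i)" for i
    by (simp add: var_power_dvd_iff keys_part)
  then have "\<exists>z1. vpart ?w True z = var Xt ^ k *s z1" by (intro vec_dvd) simp
  moreover have "var Xs ^ k dvd part ?w False (z $ i)" for i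
    using assms unfolding var_power_dvd_iff keys_part vhomog_def homog_def stdeg_def by fastforce
  then have "\<exists>z2. vpart ?w False z = var Xs ^ k *s z2" by (intro vec_dvd) simp
  ultimately obtain z1 z2 where z: "vpart ?w True z = var Xt ^ k *s z1" "vpart ?w False z = var Xs ^ k *s z2"
    by blast
  have "z = vpart ?w True z + vpart ?w False z"
    by (simp add: vec_eq_iff flip: part_compl)
  then have "z = var Xt ^ k *s z1 - var Xs ^ k *s (- z2)"
    unfolding z by (simp add: vec_eq_iff)
  then show ?thesis by blast
qed

text \<open>The multiples of c by \<open>s\<^sup>K\<close> and by \<open>t\<^sup>K\<close> come from vectors g and h. The difference of \<open>t\<^sup>K g\<close> and
  \<open>s\<^sup>K h\<close> is a combination z of rows of M. As c is cubic in s and t, g and h have degree K and z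
  has degree 2K - 1, so z can be distributed between the two; after this correction the common
  powers cancel.\<close>

lemma kernel_M_degree3_power:
  assumes x: "x \<in> {Xu, Xv}" and Mc: "M *v c = 0" and c: "vhomog stdeg 3 c"
  shows "\<exists>g. (\<forall>j. g $ j \<in> Kuv) \<and> var x ^ (2 * K) *s c = cramer_vec M g"
proof -
  have hx: "homog stdeg 0 (var x ^ j :: 'k bipoly)" for j
    using Kuv_var_power[OF x] by (simp add: Kuv_iff_stdeg)
  have *: "\<exists>g. vhomog stdeg (int K) g \<and> (var x ^ K * var y ^ K) *s c = cramer_vec M g"
    if y: "y \<in> {Xs, Xt}" for y
  proof -
    obtain g where g: "(var x ^ K * var y ^ K) *s c = cramer_vec M g"
      using contracts_kernel[OF contracts_K[OF x y] Mc] by blast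
    have "(var x ^ K * var y ^ K) *s c = vpart stdeg (int K + 3) ((var x ^ K * var y ^ K) *s c)"
      using stdeg.vpart_scale[OF stdeg.homog_mult[OF hx stdeg_var_power[OF y]], of "int K + 3" K K c]
      by (simp add: vpart_vhomog[OF c])
    also have "\<dots> = cramer_vec M (vpart stdeg (int K) g)" unfolding g vpart_cramer_vec by simp
    finally show ?thesis by (intro exI[of _ "vpart stdeg (int K) g"] conjI vhomog_vpart)
  qed
  obtain g where gh: "vhomog stdeg (int K) g" and g: "(var x ^ K * var Xs ^ K) *s c = cramer_vec M g"
    using *[of Xs] by blast
  obtain h where hh: "vhomog stdeg (int K) h" and h: "(var x ^ K * var Xt ^ K) *s c = cramer_vec M h"
    using *[of Xt] by blast
  have "cramer_vec M (var Xt ^ K *s g - var Xs ^ K *s h) = 0"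
    unfolding cramer_vec_diff cramer_vec_scale g[symmetric] h[symmetric]
    by (simp add: vec_eq_iff algebra_simps)
  from cramer_vec_kernel[OF x this] obtain z0 where
    z0: "var x ^ K *s (var Xt ^ K *s g - var Xs ^ K *s h) = z0 v* M" by blast
  define z where "z = vpart stdeg (2 * int K - 1) z0"
  have "vhomog stdeg (2 * int K) (var x ^ K *s (var Xt ^ K *s g - var Xs ^ K *s h))"
  proof -
    have "homog stdeg (int K + int K) (var Xt ^ K * g $ i)" for i
      using gh by (intro stdeg.homog_mult stdeg_var_power) (simp_all add: vhomog_def)
    moreover have "homog stdeg (int K + int K) (var Xs ^ K * h $ i)" for i
      using hh by (intro stdeg.homog_mult stdeg_var_power) (simp_all add: vhomog_def)
    ultimately have "homog stdeg (0 + (int K + int K)) (var x ^ K * (var Xt ^ K * g $ i - var Xs ^ K * h $ i))" for i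
      by (intro stdeg.homog_mult[OF hx] homog_diff)
    then show ?thesis by (simp add: vhomog_def)
  qed
  then have zM: "var x ^ K *s (var Xt ^ K *s g - var Xs ^ K *s h) = z v* M"
    using vpart_vhomog vpart_vector_mult_M[of "2 * int K" z0] unfolding z0 z_def by metis
  have "vhomog stdeg (2 * int K - 1) z" unfolding z_def by simp
  from split_stdeg[OF this] obtain z1 z2 where z: "z = var Xt ^ K *s z1 - var Xs ^ K *s z2" by blast
  have "var Xt ^ K *s (var x ^ K *s g - z1 v* M) = var Xs ^ K *s (var x ^ K *s h - z2 v* M)"
  proof -
    have "var Xt ^ K *s (var x ^ K *s g - z1 v* M) - var Xs ^ K *s (var x ^ K *s h - z2 v* M) =
      var x ^ K *s (var Xt ^ K *s g - var Xs ^ K *s h) - (var Xt ^ K *s z1 - var Xs ^ K *s z2) v* M"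
      by (simp add: vec_eq_iff vector_matrix_mult_def sum_3 algebra_simps)
    also have "\<dots> = 0" unfolding zM z by simp
    finally show ?thesis by simp
  qed
  then obtain g' where g': "var x ^ K *s g - z1 v* M = var Xs ^ K *s g'"
    using vec_var_power_cancel[of Xt Xs] by blast
  have "var Xs ^ K *s (var x ^ (2 * K) *s c) = var x ^ K *s ((var x ^ K * var Xs ^ K) *s c)"
    unfolding mult_2 power_add by (simp add: vector_smult_assoc mult_ac)
  also have "\<dots> = cramer_vec M (var x ^ K *s g - z1 v* M)"
    unfolding g cramer_vec_diff cramer_vec_row_combination cramer_vec_scale by simp
  also have "\<dots> = var Xs ^ K *s cramer_vec M g'" unfolding g' cramer_vec_scale ..
  finally have "var x ^ (2 * K) *s c = cramer_vec M g'" by (rule vec_power_cancel)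
  moreover have "var x ^ (2 * K) *s c = vpart stdeg 3 (var x ^ (2 * K) *s c)"
    using stdeg.vpart_scale[OF hx, of 3 "2 * K" c] by (simp add: vpart_vhomog[OF c])
  ultimately have "var x ^ (2 * K) *s c = cramer_vec M (vpart stdeg 0 g')"
    by (simp add: vpart_cramer_vec)
  then show ?thesis by (intro exI[of _ "vpart stdeg 0 g'"]) (simp add: Kuv_part)
qed

lemma kernel_M_degree3:
  assumes Mc: "M *v c = 0" and c: "vhomog stdeg 3 c"
  shows "\<exists>g. (\<forall>j. g $ j \<in> Kuv) \<and> c = cramer_vec M g"
proof -
  obtain g where gK: "\<And>j. g $ j \<in> Kuv" and g: "var Xu ^ (2 * K) *s c = cramer_vec M g"
    using kernel_M_degree3_power[OF _ Mc c, of Xu] by blast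
  obtain h where hK: "\<And>j. h $ j \<in> Kuv" and h: "var Xv ^ (2 * K) *s c = cramer_vec M h"
    using kernel_M_degree3_power[OF _ Mc c, of Xv] by blast
  have "cramer_vec M (var Xv ^ (2 * K) *s g - var Xu ^ (2 * K) *s h) = 0"
    unfolding cramer_vec_diff cramer_vec_scale g[symmetric] h[symmetric]
    by (simp add: vec_eq_iff algebra_simps)
  then have "var Xv ^ (2 * K) *s g - var Xu ^ (2 * K) *s h = 0"
    by (rule cramer_vec_inj_Kuv) (simp add: Kuv_diff Kuv_mult Kuv_var_power gK hK)
  then have "var Xv ^ (2 * K) *s g = var Xu ^ (2 * K) *s h" by simp
  then obtain g' where "g = var Xu ^ (2 * K) *s g'" using vec_var_power_cancel[of Xv Xu] by blast
  then have "var Xu ^ (2 * K) *s c = var Xu ^ (2 * K) *s cramer_vec M g'"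
    unfolding g by (simp add: cramer_vec_scale)
  then have "c = cramer_vec M g'" by (rule vec_power_cancel)
  then have "c = cramer_vec M (vpart stdeg 0 g')"
    using vpart_cramer_vec[of 3 g'] vpart_vhomog[OF c] by simp
  then show ?thesis by (intro exI[of _ "vpart stdeg 0 g'"]) (simp add: Kuv_part)
qed

text \<open>The case distinction y = s or y = t is covered by the block C that survives in M modulo y. Setting
  y = 0 in the homotopy shows that a power of x times g is a combination of the rows of C, for x = u
  and for x = v; these denominators cancel because C is injective from the left. The entries of C
  lie in the ideal generated by u and v, and so do those of g.\<close>

lemma cramer_vec_multiple_aux:
  fixes C D :: "'k bipoly^5^3"
  assumes y: "(y, y') \<in> {(Xs, Xt), (Xt, Xs)}"
    and M: "\<And>z. z v* M = var y' *s (z v* C) + var y *s (z v* D)"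
    and C_Kuv: "\<And>i j. C $ i $ j \<in> Kuv" and C_ideal: "\<And>i j. C $ i $ j \<in> ideal_gen {var Xu, var Xv}"
    and C_inj: "\<And>z. z v* C = 0 \<Longrightarrow> z = 0"
    and gK: "\<And>j. g $ j \<in> Kuv" and g: "cramer_vec M g = var y *s c"
  shows "g $ j \<in> ideal_gen {var Xu, var Xv}"
proof -
  let ?e = "exps y y'"
  have Kuv0: "p \<in> Kuv \<Longrightarrow> homog ?e 0 p" for p :: "'k bipoly"
    using y Kuv_exps by auto
  have "y \<noteq> y'" using y by auto
  obtain l where K: "K = Suc l" by (simp add: K_def)
  have hy': "homog ?e (0, int j) (var y' ^ j :: 'k bipoly)" for j
    using homog_var_power[of ?e y' j] \<open>y \<noteq> y'\<close> by (simp add: exps_def lookup_single)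
  have hy'1: "homog ?e (0, 1) (var y' :: 'k bipoly)" using hy'[of 1] by simp
  have hy1: "homog ?e (1, 0) (var y :: 'k bipoly)"
    using homog_var_power[of ?e y 1] \<open>y \<noteq> y'\<close> by (simp add: exps_def lookup_single)
  \<comment> \<open>Comparing terms without y realises the substitution y = 0.\<close>
  have negative: "vpart ?e (- 1, d) v = 0" for d and v :: "'k bipoly^5"
    by (simp add: vec_eq_iff) (auto intro!: poly_mapping_eqI simp: part.rep_eq exps_def)
  have *: "\<exists>z. var x ^ K *s g = z v* C" if x: "x \<in> {Xu, Xv}" for x
  proof -
    have "y' \<in> {Xs, Xt}" using y by auto
    from contracts_K[OF x this] obtain G z where
      "(var x ^ K * var y' ^ K) *s g = z v* M + cramer_vec M g v* G"
      unfolding contracts_def by blast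
    then have eq: "(var x ^ K * var y' ^ K) *s g =
        var y' *s (z v* C) + var y *s (z v* D + c v* G)"
      unfolding M g by (simp add: vec_eq_iff vector_matrix_mult_def sum_distrib_left algebra_simps)
    have xg: "var x ^ K * g $ j \<in> Kuv" for j by (intro Kuv_mult Kuv_var_power x gK)
    have "vhomog ?e (0, int K) ((var x ^ K * var y' ^ K) *s g)"
      using exps.homog_mult[OF hy'[of K] Kuv0[OF xg]] by (simp add: vhomog_def mult_ac)
    then have "(var x ^ K * var y' ^ K) *s g = vpart ?e (0, int K) ((var x ^ K * var y' ^ K) *s g)"
      by (simp add: vpart_vhomog)
    also have "\<dots> = vpart ?e (0, int K) (var y' *s (z v* C)) + vpart ?e (0, int K) (var y *s (z v* D + c v* G))"
      unfolding eq by (simp add: vec_eq_iff part_add)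
    also have "vpart ?e (0, int K) (var y *s (z v* D + c v* G)) = 0"
      unfolding exps.vpart_scale[OF hy1] by (simp add: negative)
    also have "vpart ?e (0, int K) (var y' *s (z v* C)) = var y' *s (vpart ?e (0, int l) z v* C)"
      using exps.vpart_vector_matrix_mult[of y y' 0 C "(0, int l)" z] Kuv0[OF C_Kuv]
      unfolding exps.vpart_scale[OF hy'1] by (simp add: K)
    finally have 1: "(var x ^ K * var y' ^ K) *s g = var y' *s (vpart ?e (0, int l) z v* C)" by simp
    have "var y' ^ l dvd vpart ?e (0, int l) z $ i" for i
      by (auto simp: var_power_dvd_iff keys_part exps_def)
    then obtain z' where z': "vpart ?e (0, int l) z = var y' ^ l *s z'" using vec_dvd by blast
    have "var y' ^ K *s (var x ^ K *s g) = var y' ^ K *s (z' v* C)"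
      using 1 unfolding z' by (simp add: K vec_eq_iff vector_matrix_mult_def sum_3 algebra_simps)
    then have "var x ^ K *s g = z' v* C" by (rule vec_power_cancel)
    then show ?thesis by blast
  qed
  obtain z1 where z1: "var Xu ^ K *s g = z1 v* C" using *[of Xu] by blast
  obtain z2 where z2: "var Xv ^ K *s g = z2 v* C" using *[of Xv] by blast
  have "(var Xv ^ K *s z1 - var Xu ^ K *s z2) v* C =
      var Xv ^ K *s (z1 v* C) - var Xu ^ K *s (z2 v* C)"
    by (simp add: vec_eq_iff vector_matrix_mult_def sum_3 algebra_simps)
  also have "\<dots> = 0" unfolding z1[symmetric] z2[symmetric] by (simp add: vec_eq_iff algebra_simps)
  finally have "var Xv ^ K *s z1 = var Xu ^ K *s z2" using C_inj by fastforce
  then obtain z where z: "z1 = var Xu ^ K *s z" using vec_var_power_cancel[of Xv Xu] by blast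
  have "var Xu ^ K *s g = var Xu ^ K *s (z v* C)"
    using z1 unfolding z by (simp add: vec_eq_iff vector_matrix_mult_def sum_3 algebra_simps)
  then have "g = z v* C" by (rule vec_power_cancel)
  then show ?thesis
    by (simp add: vector_matrix_mult_def ideal_uv_sum ideal_uv_mult C_ideal)
qed

lemma cramer_vec_multiple:
  assumes gK: "\<And>j. g $ j \<in> Kuv" and y: "y \<in> {Xs, Xt}" and g: "cramer_vec M g = var y *s c"
  shows "g $ j \<in> ideal_gen {var Xu, var Xv}"
proof -
  have upper: "upper N $ i $ l \<in> Kuv" "upper N $ i $ l \<in> ideal_gen {var Xu, var Xv}" for i l
    using exhaust_3[of i] N_Kuv N_ideal_uv by auto
  have lower: "lower N $ i $ l \<in> Kuv" "lower N $ i $ l \<in> ideal_gen {var Xu, var Xv}" for i l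
    using exhaust_3[of i] N_Kuv N_ideal_uv by auto
  from y consider "y = Xs" | "y = Xt" by blast
  then show ?thesis
  proof cases
    case 1
    show ?thesis
    proof (rule cramer_vec_multiple_aux[of y Xt "upper N" "- lower N", OF _ _ upper upper_N_left_inj gK g])
      show "z v* M = var Xt *s (z v* upper N) + var y *s (z v* - lower N)" for z
        unfolding 1 vector_mult_pencil
        by (simp add: vec_eq_iff vector_matrix_mult_def sum_negf)
    qed (simp_all add: 1)
  next
    case 2
    have neg: "z v* - lower N = (- z) v* lower N" for z
      by (simp add: vec_eq_iff vector_matrix_mult_def)
    show ?thesis
    proof (rule cramer_vec_multiple_aux[of y Xs "- lower N" "upper N", OF _ _ _ _ _ gK g])
      show "z v* M = var Xs *s (z v* - lower N) + var y *s (z v* upper N)" for z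
        unfolding 2 vector_mult_pencil
        by (simp add: vec_eq_iff vector_matrix_mult_def sum_negf)
      show "(- lower N) $ i $ l \<in> Kuv" for i l
        using Kuv_diff[OF Kuv_0 lower(1)] by simp
      show "(- lower N) $ i $ l \<in> ideal_gen {var Xu, var Xv}" for i l
        using ideal_uv_mult[OF lower(2), of "- 1"] by simp
      show "z = 0" if "z v* - lower N = 0" for z
        using lower_N_left_inj[of "- z"] that unfolding neg by simp
    qed (simp_all add: 2)
  qed
qed

end

section \<open>Syzygies that are quadratic in s and t\<close>

lemma matrix_vector_mult_sum_scale:
  fixes A :: "'r::comm_ring_1^'n^'m"
  shows "A *v (\<Sum>j\<in>J. g j *s x j) = (\<Sum>j\<in>J. g j *s (A *v x j))"
  by (induction J rule: infinite_finite_induct)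
     (simp_all add: matrix_vector_right_distrib matrix_vector_mult_scale)

lemma sum_Pair: "(\<Sum>i\<in>I. (f i, g i)) = (\<Sum>i\<in>I. f i, \<Sum>i\<in>I. g i)"
  by (induction I rule: infinite_finite_induct) (simp_all add: zero_prod_def)

context hilbert_burch_setting
begin

text \<open>Combinations of the five quadratic syzygies. For coefficients in \<open>K[u,v]\<close> the map is a bijection
  onto the syzygies that are quadratic in s and t.\<close>

definition comb :: "'k bipoly^5 \<Rightarrow> 'k bipoly^3" where
  "comb g = (\<Sum>j\<in>UNIV. g $ j *s quadratic_syz N j)"

lemma comb_add: "comb (g + h) = comb g + comb h"
  by (simp add: comb_def vector_sadd_rdistrib sum.distrib)

lemma comb_scale: "comb (c *s g) = c *s comb g"
  by (simp add: comb_def vec_eq_iff sum_distrib_left mult.assoc)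

lemma comb_diff: "comb (g - h) = comb g - comb h"
  by (simp add: comb_def vec_eq_iff sum_subtractf left_diff_distrib)

lemma comb_axis: "comb (axis j 1) = quadratic_syz N j"
proof -
  have "comb (axis j 1) = (\<Sum>l\<in>UNIV. if l = j then quadratic_syz N l else 0)"
    unfolding comb_def by (rule sum.cong) (auto simp: axis_def)
  then show ?thesis by simp
qed

lemma comb_nth: "comb g $ i = (\<Sum>j\<in>UNIV. g $ j * quadratic_syz N j $ i)"
  by (simp add: comb_def)

lemma N_mult_cramer_vec: "N *v cramer_vec M g = join (var Xs *s comb g) (var Xt *s comb g)"
proof -
  have "N *v cramer_vec M g = (\<Sum>j\<in>UNIV. g $ j *s (N *v cramer_vec M (axis j 1)))"
    unfolding cramer_vec_sum_axis[of M g] matrix_vector_mult_sum_scale ..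
  then show ?thesis
    unfolding quadratic_syz_cramer
    by (simp add: vec_eq_iff forall_6 join_nth comb_nth sum_distrib_left mult.left_commute)
qed

lemma sum_join_q: "(\<Sum>i\<in>UNIV. join (var Xs *s A) (var Xt *s A) $ i * q $ i) = (\<Sum>i\<in>UNIV. A $ i * f $ i)"
  by (simp add: sum_6 sum_3 join_nth f_nth algebra_simps)

text \<open>Since f is q applied to the pairs \<open>(s A, t A)\<close>, this is the exactness of the resolution over R.\<close>

lemma syz_iff: "A \<in> syz f \<longleftrightarrow> (\<exists>c. N *v c = join (var Xs *s A) (var Xt *s A))"
proof
  assume "A \<in> syz f"
  then have "(\<Sum>i\<in>UNIV. join (var Xs *s A) (var Xt *s A) $ i * q $ i) = 0"
    unfolding sum_join_q by (simp add: syz_def)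
  from kernel_q[OF this] show "\<exists>c. N *v c = join (var Xs *s A) (var Xt *s A)" by auto
next
  assume "\<exists>c. N *v c = join (var Xs *s A) (var Xt *s A)"
  then obtain c where c: "N *v c = join (var Xs *s A) (var Xt *s A)" by blast
  show "A \<in> syz f"
    using image_N_in_kernel[of c] unfolding c sum_join_q by (simp add: syz_def)
qed

lemma comb_syz: "comb g \<in> syz f"
  using N_mult_cramer_vec syz_iff by blast

lemma quadratic_syz_syz: "quadratic_syz N j \<in> syz f"
  using comb_syz[of "axis j 1"] by (simp add: comb_axis)

text \<open>The preimage c of \<open>(s A, t A)\<close> under N is cubic in s and t and is killed by the pencil, because
  t times s A equals s times t A.\<close>

lemma syz_stdeg2:
  assumes A: "A \<in> syz f" and hA: "vhomog stdeg 2 A"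
  shows "\<exists>g. (\<forall>j. g $ j \<in> Kuv) \<and> A = comb g"
proof -
  let ?x = "join (var Xs *s A) (var Xt *s A)"
  obtain c0 where c0: "N *v c0 = ?x" using A syz_iff by blast
  define c where "c = vpart stdeg 3 c0"
  have "homog stdeg (1 + 2) (var y * A $ i)" if "y \<in> {Xs, Xt}" for y i
    using hA that by (intro stdeg.homog_mult stdeg_var) (simp_all add: vhomog_def)
  then have "vhomog stdeg 3 ?x" by (simp add: vhomog_def forall_6 join_nth)
  then have c: "N *v c = ?x"
    using vpart_N_mult[of 3 c0] by (simp add: c_def c0 vpart_vhomog)
  have "M *v c = 0"
    unfolding pencil_mult_vector upper_matrix_vector_mult[symmetric] lower_matrix_vector_mult[symmetric] c
    by (simp add: vec_eq_iff)
  from kernel_M_degree3[OF this] obtain g where gK: "\<forall>j. g $ j \<in> Kuv" and g: "c = cramer_vec M g"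
    unfolding c_def by auto
  have "var Xs *s A = var Xs *s comb g"
    using c N_mult_cramer_vec[of g] unfolding g vec6_eq_iff by simp
  then have "A = comb g" by (simp add: vec_eq_iff)
  with gK show ?thesis by blast
qed

lemma comb_inj:
  assumes "\<And>j. g $ j \<in> Kuv" "comb g = 0"
  shows "g = 0"
proof (rule cramer_vec_inj_Kuv)
  have "N *v cramer_vec M g = 0"
    unfolding N_mult_cramer_vec assms(2) by (simp add: vec_eq_iff forall_6 join_nth)
  then show "cramer_vec M g = 0" by (rule N_inj)
qed (rule assms(1))

lemma comb_eqD: "(\<And>j. g $ j \<in> Kuv) \<Longrightarrow> (\<And>j. h $ j \<in> Kuv) \<Longrightarrow> comb g = comb h \<Longrightarrow> g = h"
  using comb_inj[of "g - h"] by (simp add: comb_diff Kuv_diff)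

text \<open>If the combination is divisible by y as a syzygy, then so is the corresponding vector
  \<open>cramer_vec M g\<close>.\<close>

lemma comb_multiple:
  assumes gK: "\<And>j. g $ j \<in> Kuv" and A: "A \<in> syz f" and y: "y \<in> {Xs, Xt}"
    and g: "comb g = var y *s A"
  shows "g $ j \<in> ideal_gen {var Xu, var Xv}"
proof -
  obtain c where c: "N *v c = join (var Xs *s A) (var Xt *s A)" using A syz_iff by blast
  have "N *v cramer_vec M g = N *v (var y *s c)"
    unfolding N_mult_cramer_vec matrix_vector_mult_scale c g
    by (simp add: vec_eq_iff forall_6 join_nth mult.left_commute)
  then have "N *v (cramer_vec M g - var y *s c) = 0"
    by (simp add: matrix_vector_mult_diff_distrib)
  then have "cramer_vec M g = var y *s c" using N_inj by fastforce
  with gK y show ?thesis by (rule cramer_vec_multiple)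
qed

lemma minors_N_bideg: "homog mon_bideg (0, \<Sum>j\<in>UNIV. int (b j)) (minors embed5 5 N $ i)"
proof -
  have "homog mon_bideg ((\<Sum>i\<in>(UNIV :: 5 set). 0) + (\<Sum>j\<in>UNIV. (0, int (b j)))) (det (\<chi> i. N $ \<phi> i))" for \<phi> :: "5 \<Rightarrow> 6"
    by (rule bideg.homog_det) (simp add: N_bideg)
  then have *: "homog mon_bideg (0, \<Sum>j\<in>UNIV. int (b j)) (det (\<chi> i. N $ \<phi> i))" for \<phi> :: "5 \<Rightarrow> 6"
    by (simp add: sum_Pair)
  have "(\<chi> l. if embed5 l = i then N $ 5 else N $ embed5 l) = (\<chi> l. N $ (if embed5 l = i then 5 else embed5 l))"
    by (simp add: vec_eq_iff)
  then show ?thesis using * by (simp add: minors_def homog_uminus)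
qed

lemma bideg_nonneg: "m \<in> Poly_Mapping.keys p \<Longrightarrow> homog mon_bideg (d, e) p \<Longrightarrow> 0 \<le> d \<and> 0 \<le> e"
  unfolding homog_def mon_bideg_def by fastforce

lemma bideg_nonneg_nonzero: "p \<noteq> 0 \<Longrightarrow> homog mon_bideg (d, e) p \<Longrightarrow> 0 \<le> d \<and> 0 \<le> e"
  using bideg_nonneg by (metis all_not_in_conv keys_eq_empty)

text \<open>The degree count of the Hilbert-Burch theorem. Applied with powers of u and of v,
  \<open>left_kernel_generator_is_minors\<close> gives \<open>q = g \<Delta>\<close> with \<open>\<Delta>\<close> the minors of N, homogeneous of degree
  \<open>\<Sum> b\<^sub>j\<close>. As g divides every element of the ideal of the \<open>q\<^sub>i\<close>, it divides a power of u and a power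
  of v; hence it is a unit and has degree zero.\<close>

lemma sum_b: "(\<Sum>j\<in>UNIV. int (b j)) = int n"
proof -
  let ?\<Delta> = "minors embed5 5 N"
  let ?b = "\<Sum>j\<in>UNIV. int (b j)"
  obtain a Y where Y: "Y ** N = mat (var Xu ^ a)"
    and Yker: "\<And>z. z v* N = 0 \<Longrightarrow> \<exists>\<kappa>. var Xu ^ a *s z = \<kappa> *s q"
    by (rule N_left_kernel[of Xu], simp) (rule that)
  obtain c Z where Z: "Z ** N = mat (var Xv ^ c)"
    and Zker: "\<And>z. z v* N = 0 \<Longrightarrow> \<exists>\<kappa>. var Xv ^ c *s z = \<kappa> *s q"
    by (rule N_left_kernel[of Xv], simp) (rule that)
  have nz: "var Xu ^ a \<noteq> (0 :: 'k bipoly)" "var Xv ^ c \<noteq> (0 :: 'k bipoly)" by simp_all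
  obtain \<kappa> where "(var Xu ^ a) ^ CARD(5) *s q = \<kappa> *s ?\<Delta>"
    using left_kernel_generator_is_minors[OF inj_embed5 range_embed5 Y nz(1) Yker] by blast
  then have \<kappa>: "var Xu ^ (a * 5) * q $ i = \<kappa> * ?\<Delta> $ i" for i
    unfolding vec_eq_iff by (simp add: power_mult)
  obtain \<mu> where "(var Xv ^ c) ^ CARD(5) *s q = \<mu> *s ?\<Delta>"
    using left_kernel_generator_is_minors[OF inj_embed5 range_embed5 Z nz(2) Zker] by blast
  then have \<mu>: "var Xv ^ (c * 5) * q $ i = \<mu> * ?\<Delta> $ i" for i
    unfolding vec_eq_iff by (simp add: power_mult)
  have \<Delta>0: "?\<Delta> $ 0 \<noteq> 0"
  proof
    assume "?\<Delta> $ 0 = 0"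
    then have "var Xu ^ (a * 5) * q $ 0 = 0" using \<kappa>[of 0] by simp
    then show False using q_nonzero[of 0] by simp
  qed
  have "(var Xv ^ (c * 5) * \<kappa>) * ?\<Delta> $ 0 = (var Xu ^ (a * 5) * \<mu>) * ?\<Delta> $ 0"
    using \<kappa>[of 0, symmetric] \<mu>[of 0, symmetric] by (simp add: mult.assoc mult.left_commute)
  then have "var Xv ^ (c * 5) * \<kappa> = var Xu ^ (a * 5) * \<mu>" using \<Delta>0 by simp
  then have "var Xu ^ (a * 5) dvd var Xv ^ (c * 5) * \<kappa>" by simp
  then have "var Xu ^ (a * 5) dvd \<kappa>" by (rule dvd_var_power_mult_cancel[rotated]) simp
  then obtain g where g: "\<kappa> = var Xu ^ (a * 5) * g" by (rule dvdE)
  have q: "q $ i = g * ?\<Delta> $ i" for i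
    using \<kappa>[of i] unfolding g by (simp add: mult.assoc)
  have "g \<noteq> 0" using q[of 0] q_nonzero[of 0] by auto
  have "homog mon_bideg (0, int n) (q $ 0)" using q_deg by (simp add: R_comp_iff)
  then have "q $ 0 = part mon_bideg (0, int n) (q $ 0)" by (simp add: part_homog)
  then have "q $ 0 = part mon_bideg (0, int n) (g * ?\<Delta> $ 0)" unfolding q[of 0] .
  also have "\<dots> = part mon_bideg (0, int n - ?b) g * ?\<Delta> $ 0"
    using bideg.part_mult[OF minors_N_bideg, of "(0, int n)" g 0] by simp
  finally have "g * ?\<Delta> $ 0 = part mon_bideg (0, int n - ?b) g * ?\<Delta> $ 0" using q[of 0] by simp
  then have "g = part mon_bideg (0, int n - ?b) g" using \<Delta>0 by simp
  then have hg: "homog mon_bideg (0, int n - ?b) g" by (metis homog_part)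
  then have "?b \<le> int n" using bideg_nonneg_nonzero[OF \<open>g \<noteq> 0\<close>] by fastforce
  have dvd: "g dvd var x ^ k" if "(\<Sum>i\<in>UNIV. w $ i * q $ i) = var x ^ k" for w x k
    unfolding that[symmetric] q by (intro dvd_sum) simp
  obtain k1 h1 where h1: "var Xu ^ k1 = g * h1"
  proof -
    obtain k w where "(\<Sum>i\<in>UNIV. w $ i * q $ i) = var Xu ^ k"
      using var_power_in_ideal_q[of Xu] by auto
    from dvd[OF this] show ?thesis using that by (auto elim: dvdE)
  qed
  obtain k2 h2 where h2: "var Xv ^ k2 = g * h2"
  proof -
    obtain k w where "(\<Sum>i\<in>UNIV. w $ i * q $ i) = var Xv ^ k"
      using var_power_in_ideal_q[of Xv] by auto
    from dvd[OF this] show ?thesis using that by (auto elim: dvdE)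
  qed
  have "g * (var Xv ^ k2 * h1) = g * (var Xu ^ k1 * h2)"
    unfolding h1 h2 by (simp add: mult_ac)
  then have "var Xv ^ k2 * h1 = var Xu ^ k1 * h2" using \<open>g \<noteq> 0\<close> by simp
  then have "var Xu ^ k1 dvd var Xv ^ k2 * h1" by simp
  then have "var Xu ^ k1 dvd h1" by (rule dvd_var_power_mult_cancel[rotated]) simp
  then obtain h where h: "h1 = var Xu ^ k1 * h" by (rule dvdE)
  have "var Xu ^ k1 * (g * h) = var Xu ^ k1 * 1" using h1 unfolding h by (simp add: mult_ac)
  then have gh: "1 = h * g" by (simp add: mult.commute)
  have "1 = part mon_bideg 0 (1 :: 'k bipoly)"
    using part_homog[OF bideg.homog_1, of 0] by simp
  also have "\<dots> = part mon_bideg (0, ?b - int n) h * g"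
    unfolding gh using bideg.part_mult[OF hg, of 0 h] by (simp add: zero_prod_def)
  finally have "part mon_bideg (0, ?b - int n) h \<noteq> 0" by auto
  then have "int n \<le> ?b" using bideg_nonneg_nonzero[OF _ homog_part] by fastforce
  with \<open>?b \<le> int n\<close> show ?thesis by simp
qed

lemma M_bideg: "homog mon_bideg ((1, 0) + (0, int (b j))) (M $ i $ j)"
proof -
  have x: "homog mon_bideg (1, 0) (var Xs :: 'k bipoly)" "homog mon_bideg (1, 0) (var Xt :: 'k bipoly)"
    by (simp_all add: var_def homog_def mon_bideg_def lookup_single)
  have "homog mon_bideg (0, int (b j)) (upper N $ i $ j)" "homog mon_bideg (0, int (b j)) (lower N $ i $ j)"
    using exhaust_3[of i] N_bideg by auto
  then have "homog mon_bideg ((1, 0) + (0, int (b j))) (var Xt * upper N $ i $ j - var Xs * lower N $ i $ j)"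
    by (intro homog_diff bideg.homog_mult x)
  then show ?thesis by (simp add: pencil_def)
qed

text \<open>The rows of the determinants have degrees (0,0) for a row of N, (1,0) for a row of M and
  \<open>(0, - b\<^sub>j)\<close> for the unit vector; the columns contribute \<open>(0, b\<^sub>l)\<close>, which sum up to (0, n).\<close>

lemma quadratic_syz_bideg: "homog mon_bideg (2, int n - int (b j)) (quadratic_syz N j $ i)"
proof -
  let ?e = "axis j 1 :: 'k bipoly^5"
  let ?\<gamma> = "\<lambda>l. (0 :: int, int (b l))"
  have axis: "homog mon_bideg ((0, - int (b j)) + ?\<gamma> l) (?e $ l)" for l
    using bideg.homog_1[where 'a = 'k] by (simp add: axis_def zero_prod_def)
  have row: "homog mon_bideg (2, int n - int (b j)) (det (vector [r1, r2, r3, ?e, r5] :: 'k bipoly^5^5))"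
    if r: "\<And>l. homog mon_bideg (\<rho>1 + ?\<gamma> l) (r1 $ l)" "\<And>l. homog mon_bideg (\<rho>2 + ?\<gamma> l) (r2 $ l)"
      "\<And>l. homog mon_bideg (\<rho>3 + ?\<gamma> l) (r3 $ l)" "\<And>l. homog mon_bideg (0 + ?\<gamma> l) (r5 $ l)"
      and \<rho>: "\<rho>1 + \<rho>2 + \<rho>3 = (2, 0)" for r1 r2 r3 r5 \<rho>1 \<rho>2 \<rho>3
  proof -
    let ?\<rho> = "vector [\<rho>1, \<rho>2, \<rho>3, (0, - int (b j)), 0] :: (int \<times> int)^5"
    have "homog mon_bideg ((\<Sum>i\<in>UNIV. ?\<rho> $ i) + (\<Sum>l\<in>UNIV. ?\<gamma> l))
        (det (vector [r1, r2, r3, ?e, r5] :: 'k bipoly^5^5))"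
    proof (rule bideg.homog_det)
      show "homog mon_bideg (?\<rho> $ i + ?\<gamma> l) (vector [r1, r2, r3, ?e, r5] $ i $ l)" for i l
        using exhaust_5[of i] by (elim disjE) (simp_all only: vector_5 r axis)
    qed
    moreover have "(\<Sum>i\<in>UNIV. ?\<rho> $ i) + (\<Sum>l\<in>UNIV. ?\<gamma> l) = (2, int n - int (b j))"
      by (simp add: sum_5[of "\<lambda>i. ?\<rho> $ i"] vector_5 \<rho> sum_Pair sum_b)
    ultimately show ?thesis by simp
  qed
  have N: "homog mon_bideg (0 + ?\<gamma> l) (N $ i $ l)" for i l using N_bideg by simp
  note Mb = M_bideg
  have M: "var Xt *s N $ 0 - var Xs *s N $ 3 = M $ 1" "var Xt *s N $ 1 - var Xs *s N $ 4 = M $ 2"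
    "var Xt *s N $ 2 - var Xs *s N $ 5 = M $ 3"
    by (simp_all add: pencil_def)
  have "homog mon_bideg (2, int n - int (b j)) (det (vector [N $ 0, M $ 2, M $ 3, ?e, N $ 3] :: 'k bipoly^5^5))"
    by (rule row[OF N Mb Mb N]) simp
  moreover have "homog mon_bideg (2, int n - int (b j)) (det (vector [M $ 1, N $ 1, M $ 3, ?e, N $ 4] :: 'k bipoly^5^5))"
    by (rule row[OF Mb N Mb N]) simp
  moreover have "homog mon_bideg (2, int n - int (b j)) (det (vector [M $ 1, M $ 2, N $ 2, ?e, N $ 5] :: 'k bipoly^5^5))"
    by (rule row[OF Mb Mb N N]) simp
  ultimately show ?thesis
    using exhaust_3[of i] unfolding quadratic_syz_def Let_def M by auto
qed

lemma quadratic_syz_comp: "quadratic_syz N j \<in> syz_comp n f (3, 2 * int n - int (b j))"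
  using quadratic_syz_syz[of j] quadratic_syz_bideg[of j] by (simp add: syz_comp_def R_comp_iff)

lemma inj_quadratic_syz: "inj (quadratic_syz N)"
proof (rule injI)
  fix i j
  assume "quadratic_syz N i = quadratic_syz N j"
  then have "comb (axis i 1) = comb (axis j 1)" by (simp add: comb_axis)
  then have "axis i 1 = (axis j 1 :: 'k bipoly^5)"
    by (intro comb_eqD) (simp_all add: axis_def Kuv_0 Kuv_1)
  then show "i = j" by (simp add: axis_eq_axis)
qed

end

section \<open>Bases modulo a subspace and multiples of the variables\<close>

lemma const_0 [simp]: "const 0 = 0" and const_1 [simp]: "const 1 = 1"
  and const_add: "const (a + b) = const a + const b"
  and const_mult: "const (a * b) = const a * const b"
  by (simp_all add: const_def single_add mult_single)

interpretation kspace: vector_space kscale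
  by unfold_locales
    (simp_all add: kscale_def const_add const_mult vector_add_ldistrib vector_sadd_rdistrib
      vector_smult_assoc)

text \<open>Since U may be infinite-dimensional, cardinalities are compared inside the span W of B and B': with \<open>U0\<close> a basis of the intersection of U and W, the set \<open>B \<union> U0\<close> is independent
  and contained in the span of \<open>B' \<union> U0\<close>.\<close>

lemma basis_mod_card_le:
  assumes U: "kspace.subspace U" and B: "basis_mod V U B" and B': "basis_mod V U B'"
  shows "card B \<le> card B'"
proof -
  have fin: "finite B" "finite B'" and BV: "B \<subseteq> V" "V \<subseteq> kspace.span (B' \<union> U)"
    and indep: "\<And>c. (\<Sum>A\<in>B. kscale (c A) A) \<in> U \<Longrightarrow> \<forall>A\<in>B. c A = 0"
    using B B' unfolding basis_mod_def by blast+
  obtain U0 where U0: "U0 \<subseteq> U \<inter> kspace.span (B \<union> B')" "kspace.independent U0"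
      "U \<inter> kspace.span (B \<union> B') \<subseteq> kspace.span U0"
    by (rule kspace.maximal_independent_subset)
  have finU0: "finite U0"
    using kspace.independent_span_bound[OF _ U0(2), of "B \<union> B'"] U0(1) fin by auto
  have spanU0: "kspace.span U0 \<subseteq> U"
    using U0(1) U by (intro kspace.span_minimal) auto
  have "kspace.independent (B \<union> U0)"
  proof (rule kspace.independent_if_scalars_zero)
    show "finite (B \<union> U0)" using fin finU0 by simp
  next
    fix c A
    assume sum: "(\<Sum>x\<in>B \<union> U0. kscale (c x) x) = 0" and A: "A \<in> B \<union> U0"
    have "(\<Sum>x\<in>B \<union> U0. kscale (c x) x) =
        (\<Sum>x\<in>B. kscale (c x) x) + (\<Sum>x\<in>U0 - B. kscale (c x) x)"
      using fin(1) finU0 sum.union_disjoint[of B "U0 - B" "\<lambda>x. kscale (c x) x"] by (simp add: Un_Diff_cancel)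
    with sum have B_eq: "(\<Sum>x\<in>B. kscale (c x) x) = - (\<Sum>x\<in>U0 - B. kscale (c x) x)"
      by (simp add: eq_neg_iff_add_eq_0)
    have U0_mem: "(\<Sum>x\<in>U0 - B. kscale (c x) x) \<in> U"
      using spanU0 by (intro kspace.subspace_sum[OF U] kspace.subspace_scale[OF U])
        (auto intro: kspace.span_base)
    then have "(\<Sum>x\<in>B. kscale (c x) x) \<in> U"
      unfolding B_eq using kspace.subspace_neg[OF U] by blast
    then have cB: "\<forall>x\<in>B. c x = 0" by (rule indep)
    then have "(\<Sum>x\<in>U0 - B. kscale (c x) x) = 0" using B_eq by simp
    then have "(\<Sum>x\<in>U0. kscale (if x \<in> B then 0 else c x) x) = 0"
      using finU0 by (simp add: sum.If_cases if_distribR if_distrib[of kscale] cong: if_cong)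
        (simp add: Diff_eq)
    note kspace.independentD[OF U0(2) finU0 order_refl this, of A]
    then show "c A = 0" using A cB by (cases "A \<in> B") simp_all
  qed
  moreover have disjoint: "B \<inter> U0 = {}"
  proof (rule ccontr)
    assume "B \<inter> U0 \<noteq> {}"
    then obtain A where A: "A \<in> B" "A \<in> U" using U0(1) by auto
    define c :: "'a bipoly^3 \<Rightarrow> 'a" where "c x = (if x = A then 1 else 0)" for x
    have "(\<Sum>x\<in>B. kscale (c x) x) = (\<Sum>x\<in>B. if x = A then x else 0)"
      by (rule sum.cong) (auto simp: c_def)
    then have "(\<Sum>x\<in>B. kscale (c x) x) \<in> U" using A fin(1) by simp
    from indep[OF this] A(1) show False by (auto simp: c_def)
  qed
  moreover have "B \<union> U0 \<subseteq> kspace.span (B' \<union> U0)"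
  proof
    fix A
    assume "A \<in> B \<union> U0"
    then show "A \<in> kspace.span (B' \<union> U0)"
    proof
      assume "A \<in> B"
      then have "A \<in> kspace.span (B' \<union> U)" using BV by blast
      then obtain x y where A: "A = x + y" "x \<in> kspace.span B'" "y \<in> kspace.span U"
        unfolding kspace.span_Un by blast
      have y: "y \<in> U" using A(3) U by (simp add: kspace.span_eq_iff[THEN iffD2])
      have "y = A - x" using A(1) by simp
      also have "A - x \<in> kspace.span (B \<union> B')"
        using \<open>A \<in> B\<close> A(2) kspace.span_mono[of B' "B \<union> B'"]
        by (intro kspace.span_diff) (auto intro: kspace.span_base)
      finally have "y \<in> kspace.span U0" using y U0(3) by blast
      then show ?thesis unfolding A(1) kspace.span_Un using A(2) by blast
    next
      assume "A \<in> U0"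
      then show ?thesis by (simp add: kspace.span_base)
    qed
  qed
  ultimately have "card (B \<union> U0) \<le> card (B' \<union> U0)"
    using kspace.independent_span_bound[of "B' \<union> U0" "B \<union> U0"] fin finU0 by simp
  also have "\<dots> \<le> card B' + card U0" by (rule card_Un_le)
  finally show ?thesis using card_Un_disjoint[OF fin(1) finU0 disjoint] by simp
qed

lemma quotient_dim_eq_card:
  assumes "kspace.subspace U" "basis_mod V U B"
  shows "quotient_dim V U = card B"
  unfolding quotient_dim_def
  using assms basis_mod_card_le by (intro the_equality) (blast intro: antisym)+

lemma basis_mod_irredundant:
  assumes U: "kspace.subspace U" and B: "basis_mod V U B" and A: "A \<in> B"
  shows "A \<notin> kspace.span ((B - {A}) \<union> U)"
proof
  assume "A \<in> kspace.span ((B - {A}) \<union> U)"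
  then obtain x y where xy: "A = x + y" "x \<in> kspace.span (B - {A})" "y \<in> kspace.span U"
    unfolding kspace.span_Un by blast
  have fin: "finite B" and indep: "\<And>c. (\<Sum>A\<in>B. kscale (c A) A) \<in> U \<Longrightarrow> \<forall>A\<in>B. c A = 0"
    using B unfolding basis_mod_def by blast+
  have y: "y \<in> U" using xy(3) U by (simp add: kspace.span_eq_iff[THEN iffD2])
  obtain c where x: "x = (\<Sum>b\<in>B - {A}. kscale (c b) b)"
    using xy(2) fin by (auto simp: kspace.span_finite)
  define d where "d b = (if b = A then - 1 else c b)" for b
  have "(\<Sum>b\<in>B. kscale (d b) b) = kscale (d A) A + (\<Sum>b\<in>B - {A}. kscale (d b) b)"
    using fin A by (rule sum.remove)
  also have "(\<Sum>b\<in>B - {A}. kscale (d b) b) = x"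
    unfolding x by (rule sum.cong) (auto simp: d_def)
  also have "kscale (d A) A + x = - y" using xy(1) by (simp add: d_def)
  finally have "(\<Sum>b\<in>B. kscale (d b) b) \<in> U" using kspace.subspace_neg[OF U y] by simp
  from indep[OF this] A show False by (auto simp: d_def)
qed

lemma subspace_syz: "vec_module.subspace (syz f)"
  unfolding vec_module.subspace_def syz_def
  by (simp add: distrib_right sum.distrib mult.assoc sum_distrib_left[symmetric])

lemmas syz_0 = vec_module.subspace_0[OF subspace_syz]
  and syz_add = vec_module.subspace_add[OF subspace_syz]
  and syz_scale = vec_module.subspace_scale[OF subspace_syz]

lemma subspace_max_syz: "vec_module.subspace (max_syz f)"
  unfolding max_syz_def by (rule vec_module.subspace_span)

lemma var_mult_max_syz: "A \<in> syz f \<Longrightarrow> var x *s A \<in> max_syz f"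
  unfolding max_syz_def by (rule vec_module.span_base) blast

text \<open>Every monomial other than 1 is divisible by some variable.\<close>

lemma no_constant_term_max_syz:
  assumes "0 \<notin> Poly_Mapping.keys p" and A: "A \<in> syz f"
  shows "p *s A \<in> max_syz f"
proof -
  have "Poly_Mapping.single m c *s A \<in> max_syz f" if m: "m \<noteq> 0" for m c
  proof -
    obtain x where "Poly_Mapping.lookup m x \<noteq> 0" using m by (metis lookup_zero poly_mapping_eqI)
    then have "var x ^ 1 dvd (Poly_Mapping.single m c :: 'a bipoly)"
      unfolding var_power_dvd_iff by simp
    then obtain r where "Poly_Mapping.single m c = var x * r" by (auto elim: dvdE)
    then have "Poly_Mapping.single m c *s A = r *s (var x *s A)"
      by (simp add: vector_smult_assoc mult.commute)
    then show ?thesis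
      using vec_module.subspace_scale[OF subspace_max_syz var_mult_max_syz[OF A]] by simp
  qed
  then have "(\<Sum>m\<in>Poly_Mapping.keys p. Poly_Mapping.single m (Poly_Mapping.lookup p m) *s A) \<in> max_syz f"
    using assms(1) by (intro vec_module.subspace_sum[OF subspace_max_syz]) metis
  also have "(\<Sum>m\<in>Poly_Mapping.keys p. Poly_Mapping.single m (Poly_Mapping.lookup p m) *s A) =
      (\<Sum>m\<in>Poly_Mapping.keys p. Poly_Mapping.single m (Poly_Mapping.lookup p m)) *s A"
    by (simp add: vec_eq_iff sum_distrib_right)
  also have "(\<Sum>m\<in>Poly_Mapping.keys p. Poly_Mapping.single m (Poly_Mapping.lookup p m)) = p"
    by (rule sum_keys_single)
  finally show ?thesis .
qed

text \<open>The coefficients can be absorbed into the syzygies, so one summand for each variable suffices.\<close>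

lemma max_syz_elem:
  assumes "A \<in> max_syz f"
  shows "\<exists>S. (\<forall>x. S x \<in> syz f) \<and> A = (\<Sum>x\<in>{Xs, Xt, Xu, Xv}. var x *s S x)"
proof -
  let ?T = "{A. \<exists>S. (\<forall>x. S x \<in> syz f) \<and> A = (\<Sum>x\<in>{Xs, Xt, Xu, Xv}. var x *s S x)}"
  have "max_syz f \<subseteq> ?T"
    unfolding max_syz_def
  proof (rule vec_module.span_minimal)
    show "{var x *s A |x A. A \<in> syz f} \<subseteq> ?T"
    proof clarify
      fix x A
      assume A: "A \<in> syz f"
      have x: "x \<in> {Xs, Xt, Xu, Xv}" by (cases x) auto
      have "(\<Sum>y\<in>{Xs, Xt, Xu, Xv}. var y *s (if y = x then A else 0)) =
          (\<Sum>y\<in>{Xs, Xt, Xu, Xv}. if y = x then var y *s A else 0)"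
        by (rule sum.cong) auto
      also have "\<dots> = var x *s A" using x by (simp only: sum.delta finite.intros if_True)
      finally have "var x *s A = (\<Sum>y\<in>{Xs, Xt, Xu, Xv}. var y *s (if y = x then A else 0))" ..
      moreover have "(if y = x then A else 0) \<in> syz f" for y
        using A by (simp add: syz_0)
      ultimately show "\<exists>S. (\<forall>y. S y \<in> syz f) \<and> var x *s A = (\<Sum>y\<in>{Xs, Xt, Xu, Xv}. var y *s S y)"
        by (intro exI[of _ "\<lambda>y. if y = x then A else 0"] conjI allI)
    qed
    show "vec_module.subspace ?T"
    proof (rule vec_module.subspaceI)
      show "0 \<in> ?T"
        by (auto intro!: exI[of _ "\<lambda>_. 0"] syz_0)
    next
      fix A B
      assume "A \<in> ?T" "B \<in> ?T"
      then obtain S S' where S: "\<forall>x. S x \<in> syz f" "A = (\<Sum>x\<in>{Xs, Xt, Xu, Xv}. var x *s S x)"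
        and S': "\<forall>x. S' x \<in> syz f" "B = (\<Sum>x\<in>{Xs, Xt, Xu, Xv}. var x *s S' x)" by blast
      have "A + B = (\<Sum>x\<in>{Xs, Xt, Xu, Xv}. var x *s (S x + S' x))"
        unfolding S S' by (simp only: vector_add_ldistrib sum.distrib)
      moreover have "\<forall>x. S x + S' x \<in> syz f"
        using S(1) S'(1) by (simp add: syz_add)
      ultimately show "A + B \<in> ?T" by (intro CollectI exI[of _ "\<lambda>x. S x + S' x"] conjI)
    next
      fix c A
      assume "A \<in> ?T"
      then obtain S where S: "\<forall>x. S x \<in> syz f" "A = (\<Sum>x\<in>{Xs, Xt, Xu, Xv}. var x *s S x)" by blast
      have "c *s A = (\<Sum>x\<in>{Xs, Xt, Xu, Xv}. var x *s (c *s S x))"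
        unfolding S vec_module.scale_sum_right by (simp only: vector_smult_assoc mult.commute)
      moreover have "\<forall>x. c *s S x \<in> syz f"
        using S(1) by (simp add: syz_scale)
      ultimately show "c *s A \<in> ?T" by (intro CollectI exI[of _ "\<lambda>x. c *s S x"] conjI)
    qed
  qed
  with assms show ?thesis by blast
qed

lemma kspace_subspace_of_module:
  "vec_module.subspace U \<Longrightarrow> kspace.subspace U"
  unfolding vec_module.subspace_def kspace.subspace_def kscale_def by blast

lemma subspace_syz_comp: "kspace.subspace (syz_comp n f a)"
  unfolding kspace.subspace_def
proof (intro conjI ballI allI)
  show "0 \<in> syz_comp n f a"
    by (simp add: syz_comp_def R_comp_iff syz_0)
  show "A + B \<in> syz_comp n f a" if "A \<in> syz_comp n f a" "B \<in> syz_comp n f a" for A B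
    using that by (simp add: syz_comp_def R_comp_iff homog_add syz_add)
  show "kscale c A \<in> syz_comp n f a" if "A \<in> syz_comp n f a" for c A
  proof -
    have "homog mon_bideg (0 + e) (const c * A $ i)" if "homog mon_bideg e (A $ i)" for e i
      using that by (intro bideg.homog_mult) (simp_all add: const_def homog_def)
    then show ?thesis
      using that by (simp add: syz_comp_def R_comp_iff kscale_def syz_scale)
  qed
qed

definition var_bideg :: "indet \<Rightarrow> int \<times> int" where
  "var_bideg x = (if x \<in> {Xs, Xt} then (1, 0) else (0, 1))"

lemma homog_var_bideg: "homog mon_bideg (var_bideg x) (var x)"
  by (cases x) (simp_all add: var_def homog_def mon_bideg_def lookup_single var_bideg_def)

lemma homog_bideg_0: "homog mon_bideg 0 p \<Longrightarrow> \<exists>c. p = const c"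
proof -
  assume p: "homog mon_bideg 0 p"
  have "m = 0" if m: "m \<in> Poly_Mapping.keys p" for m
  proof (rule poly_mapping_eqI)
    fix x
    have "mon_bideg m = 0" using p m by (simp add: homog_def)
    then show "Poly_Mapping.lookup m x = Poly_Mapping.lookup 0 x"
      by (cases x) (simp_all add: mon_bideg_def zero_prod_def)
  qed
  then have "p = const (Poly_Mapping.lookup p 0)"
    unfolding const_def
    by (intro poly_mapping_eqI) (auto simp: lookup_single when_def in_keys_iff)
  then show ?thesis by blast
qed

section \<open>Minimal generators\<close>

context hilbert_burch_setting
begin

lemma f_bideg: "homog mon_bideg (1, int n) (f $ i)"
proof -
  have "homog mon_bideg (0, int n) (upper q $ i)" "homog mon_bideg (0, int n) (lower q $ i)"
    using exhaust_3[of i] q_deg by (auto simp: R_comp_iff)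
  moreover have "homog mon_bideg (1, 0) (var Xs :: 'k bipoly)" "homog mon_bideg (1, 0) (var Xt :: 'k bipoly)"
    using homog_var_bideg[of Xs] homog_var_bideg[of Xt] by (simp_all add: var_bideg_def)
  ultimately have "homog mon_bideg ((1, 0) + (0, int n)) (f $ i)"
    unfolding f_nth by (intro homog_add bideg.homog_mult)
  then show ?thesis by simp
qed

lemma vpart_syz: "A \<in> syz f \<Longrightarrow> vpart mon_bideg d A \<in> syz f"
proof -
  assume "A \<in> syz f"
  then have "0 = part mon_bideg (d + (1, int n)) (\<Sum>i\<in>UNIV. A $ i * f $ i)"
    by (simp add: syz_def)
  also have "\<dots> = (\<Sum>i\<in>UNIV. part mon_bideg (d + (1, int n) - (1, int n)) (A $ i) * f $ i)"
    by (rule bideg.part_sum_mult) (rule f_bideg)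
  finally show ?thesis by (simp add: syz_def)
qed

lemma syz_comp_iff: "A \<in> syz_comp n f a \<longleftrightarrow> A \<in> syz f \<and> vhomog mon_bideg (a - (1, int n)) A"
  by (cases a) (simp add: syz_comp_def R_comp_iff vhomog_def)

text \<open>Taking components of the right bidegree makes the syzygies in a representation of a homogeneous
  element homogeneous.\<close>

lemma max_syz_homog:
  assumes "A \<in> max_syz f" "A \<in> syz_comp n f a"
  shows "\<exists>S. (\<forall>x. S x \<in> syz_comp n f (a - var_bideg x)) \<and> A = (\<Sum>x\<in>{Xs, Xt, Xu, Xv}. var x *s S x)"
proof -
  obtain S where S: "\<forall>x. S x \<in> syz f" "A = (\<Sum>x\<in>{Xs, Xt, Xu, Xv}. var x *s S x)"
    using max_syz_elem[OF assms(1)] by blast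
  define S' where "S' x = vpart mon_bideg (a - (1, int n) - var_bideg x) (S x)" for x
  have "A = vpart mon_bideg (a - (1, int n)) A"
    using assms(2) by (simp add: syz_comp_iff vpart_vhomog)
  also have "\<dots> = (\<Sum>x\<in>{Xs, Xt, Xu, Xv}. vpart mon_bideg (a - (1, int n)) (var x *s S x))"
    unfolding S(2) by (simp add: vec_eq_iff part_sum part_add)
  also have "\<dots> = (\<Sum>x\<in>{Xs, Xt, Xu, Xv}. var x *s S' x)"
    unfolding S'_def by (intro sum.cong refl bideg.vpart_scale homog_var_bideg)
  finally have "A = (\<Sum>x\<in>{Xs, Xt, Xu, Xv}. var x *s S' x)" .
  moreover have "S' x \<in> syz_comp n f (a - var_bideg x)" for x
    unfolding syz_comp_iff S'_def using S(1) by (simp add: vpart_syz algebra_simps)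
  ultimately show ?thesis by blast
qed

lemma syz_comp3_combination:
  assumes A: "A \<in> syz_comp n f (3, m)"
  shows "\<exists>g. (\<forall>j. homog mon_bideg (0, m - 2 * int n + int (b j)) (g $ j)) \<and> A = comb g"
proof -
  have hA: "vhomog mon_bideg (2, m - int n) A" using A by (simp add: syz_comp_iff)
  then have "vhomog stdeg 2 A"
    unfolding vhomog_def by (metis homog_bideg_stdeg fst_conv)
  then obtain g where g: "A = comb g" using syz_stdeg2 A by (auto simp: syz_comp_iff)
  define h where "h = (\<chi> j. part mon_bideg (0, m - 2 * int n + int (b j)) (g $ j))"
  have "A $ i = comb h $ i" for i
  proof -
    have "A $ i = part mon_bideg (2, m - int n) (A $ i)"
      using hA by (simp add: vhomog_def part_homog[where e = "(2, m - int n)"])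
    also have "\<dots> = (\<Sum>j\<in>UNIV. part mon_bideg ((2, m - int n) - (2, int n - int (b j))) (g $ j) * quadratic_syz N j $ i)"
      unfolding g comb_nth by (rule bideg.part_sum_mult) (rule quadratic_syz_bideg)
    also have "\<dots> = comb h $ i" by (simp add: comb_nth h_def algebra_simps)
    finally show ?thesis .
  qed
  then have "A = comb h" by (simp add: vec_eq_iff)
  moreover have "homog mon_bideg (0, m - 2 * int n + int (b j)) (h $ j)" for j
    by (simp add: h_def)
  ultimately show ?thesis by blast
qed

text \<open>The reason why the five syzygies are minimal. A summand u or v times a syzygy visibly has its
  coefficients in the ideal generated by u and v. In a summand s or t times a syzygy, the latter is
  linear in s and t and need not be a combination of the five, but \<open>comb_multiple\<close> applies to the
  product.\<close>

lemma max_syz3_combination: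
  assumes "A \<in> max_syz f" and A: "A \<in> syz_comp n f (3, m)"
  shows "\<exists>g. (\<forall>j. g $ j \<in> Kuv \<and> g $ j \<in> ideal_gen {var Xu, var Xv}) \<and> A = comb g"
proof -
  let ?P = "\<lambda>A. \<exists>g. (\<forall>j. g $ j \<in> Kuv \<and> g $ j \<in> ideal_gen {var Xu, var Xv}) \<and> A = comb g"
  obtain S where S: "\<And>x. S x \<in> syz_comp n f ((3, m) - var_bideg x)"
    and A_eq: "A = (\<Sum>x\<in>{Xs, Xt, Xu, Xv}. var x *s S x)"
    using max_syz_homog[OF assms] by blast
  have Ssyz: "S x \<in> syz f" for x using S by (simp add: syz_comp_iff)
  have st: "?P (var x *s S x)" if x: "x \<in> {Xs, Xt}" for x
  proof -
    have "vhomog mon_bideg (1, m - int n) (S x)" using S[of x] x by (simp add: syz_comp_iff var_bideg_def)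
    then have "vhomog stdeg 1 (S x)"
      unfolding vhomog_def by (metis homog_bideg_stdeg fst_conv)
    then have "homog stdeg (1 + 1) (var x * S x $ i)" for i
      by (intro stdeg.homog_mult stdeg_var x) (simp add: vhomog_def)
    then have "vhomog stdeg 2 (var x *s S x)" by (simp add: vhomog_def)
    then obtain g where gK: "\<forall>j. g $ j \<in> Kuv" and g: "var x *s S x = comb g"
      using syz_stdeg2[OF syz_scale[OF Ssyz]] by blast
    have "g $ j \<in> ideal_gen {var Xu, var Xv}" for j
      using comb_multiple[OF _ Ssyz x g[symmetric]] gK by blast
    with gK g show ?thesis by blast
  qed
  have uv: "?P (var x *s S x)" if x: "x \<in> {Xu, Xv}" for x
  proof -
    have "vhomog mon_bideg (2, m - 1 - int n) (S x)"
      using S[of x] x by (auto simp add: syz_comp_iff var_bideg_def)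
    then have "vhomog stdeg 2 (S x)"
      unfolding vhomog_def by (metis homog_bideg_stdeg fst_conv)
    then obtain g where gK: "\<forall>j. g $ j \<in> Kuv" and g: "S x = comb g"
      using syz_stdeg2[OF Ssyz] by blast
    have "var x \<in> ideal_gen {var Xu, var Xv :: 'k bipoly}"
      using x unfolding ideal_gen_def by (auto intro: module.span_base[OF module_times])
    then have "g $ j * var x \<in> ideal_gen {var Xu, var Xv}" for j by (rule ideal_uv_mult)
    moreover have "var x * g $ j \<in> Kuv" for j
      using gK Kuv_var_power[OF x, of 1] by (intro Kuv_mult) auto
    ultimately show ?thesis
      unfolding g by (intro exI[of _ "var x *s g"]) (simp add: comb_scale mult.commute)
  qed
  have add: "?P (B + C)" if BC: "?P B" "?P C" for B C
  proof -
    obtain g h where "\<forall>j. g $ j \<in> Kuv \<and> g $ j \<in> ideal_gen {var Xu, var Xv}" "B = comb g"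
      "\<forall>j. h $ j \<in> Kuv \<and> h $ j \<in> ideal_gen {var Xu, var Xv}" "C = comb h"
      using BC by blast
    then show ?thesis
      by (intro exI[of _ "g + h"]) (simp add: comb_add Kuv_add ideal_uv_add)
  qed
  have "A = var Xs *s S Xs + (var Xt *s S Xt + (var Xu *s S Xu + var Xv *s S Xv))"
    unfolding A_eq by simp
  then show ?thesis using st[of Xs] st[of Xt] uv[of Xu] uv[of Xv] add by auto
qed

abbreviation J where "J m \<equiv> {j. 2 * int n - int (b j) = m}"

lemma subspace_max_syz_comp: "kspace.subspace (max_syz f \<inter> syz_comp n f a)"
  by (intro kspace.subspace_inter kspace_subspace_of_module subspace_max_syz subspace_syz_comp)

text \<open>In bidegree (3, m) the coefficients of a combination are homogeneous of degree \<open>m - (2n - b\<^sub>j)\<close>. They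
  are constants if this number is zero and have no constant term otherwise. A constant in the ideal
  generated by u and v vanishes, whence the independence.\<close>

lemma basis_mod_quadratic:
  "basis_mod (syz_comp n f (3, m)) (max_syz f \<inter> syz_comp n f (3, m)) (quadratic_syz N ` J m)"
proof -
  let ?V = "syz_comp n f (3, m)" and ?Q = "quadratic_syz N"
  let ?U = "max_syz f \<inter> ?V"
  have "?V \<subseteq> kspace.span (?Q ` J m \<union> ?U)"
  proof
    fix A
    assume "A \<in> ?V"
    then obtain g where g: "\<And>j. homog mon_bideg (0, m - 2 * int n + int (b j)) (g $ j)" "A = comb g"
      using syz_comp3_combination by blast
    have "g $ j *s ?Q j \<in> kspace.span (?Q ` J m \<union> ?U)" for j
    proof (cases "j \<in> J m")
      case True
      then have z: "(0 :: int, m - 2 * int n + int (b j)) = 0" by (auto simp: zero_prod_def)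
      have "homog mon_bideg 0 (g $ j)" using g(1)[of j] unfolding z .
      then obtain c where "g $ j = const c" using homog_bideg_0 by blast
      then have "g $ j *s ?Q j = kscale c (?Q j)" by (simp add: kscale_def)
      moreover have "?Q j \<in> kspace.span (?Q ` J m \<union> ?U)"
        using True by (intro kspace.span_base) blast
      ultimately show ?thesis by (simp only: kspace.span_scale)
    next
      case False
      have "mon_bideg m' \<noteq> 0" if "m' \<in> Poly_Mapping.keys (g $ j)" for m'
        using g(1)[of j] that False unfolding homog_def zero_prod_def by fastforce
      then have "0 \<notin> Poly_Mapping.keys (g $ j)" by (metis bideg.weight_0)
      then have "g $ j *s ?Q j \<in> max_syz f"
        by (rule no_constant_term_max_syz) (rule quadratic_syz_syz)
      moreover have "homog mon_bideg ((0, m - 2 * int n + int (b j)) + (2, int n - int (b j))) (g $ j * ?Q j $ i)" for i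
        by (intro bideg.homog_mult g(1) quadratic_syz_bideg)
      then have "g $ j *s ?Q j \<in> ?V"
        unfolding syz_comp_iff using syz_scale[OF quadratic_syz_syz] by (simp add: vhomog_def)
      ultimately show ?thesis by (auto intro: kspace.span_base)
    qed
    then show "A \<in> kspace.span (?Q ` J m \<union> ?U)"
      unfolding g(2) comb_def by (rule kspace.span_sum)
  qed
  moreover have "\<forall>A\<in>?Q ` J m. c A = 0" if "(\<Sum>A\<in>?Q ` J m. kscale (c A) A) \<in> ?U" for c
  proof -
    define h :: "'k bipoly^5" where "h = (\<chi> j. if j \<in> J m then const (c (?Q j)) else 0)"
    have "(\<Sum>A\<in>?Q ` J m. kscale (c A) A) = (\<Sum>j\<in>J m. h $ j *s ?Q j)"
      using inj_on_subset[OF inj_quadratic_syz]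
      by (subst sum.reindex) (auto simp: h_def kscale_def intro!: sum.cong)
    also have "\<dots> = comb h"
      unfolding comb_def by (rule sum.mono_neutral_left) (auto simp: h_def)
    finally have "comb h \<in> max_syz f" "comb h \<in> ?V" using that by auto
    from max_syz3_combination[OF this] obtain g where
      g: "\<And>j. g $ j \<in> Kuv" "\<And>j. g $ j \<in> ideal_gen {var Xu, var Xv}" "comb h = comb g" by blast
    have "h $ j \<in> Kuv" for j by (auto simp: h_def const_def Kuv_def)
    then have "h = g" using comb_eqD g(1,3) by blast
    have "c (?Q j) = 0" if "j \<in> J m" for j
    proof (rule ccontr)
      assume "c (?Q j) \<noteq> 0"
      then have "0 \<in> Poly_Mapping.keys (g $ j)"
        using that \<open>h = g\<close>[symmetric] by (simp add: h_def const_def)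
      then show False using g(2)[of j] unfolding mem_ideal_uv_iff by auto
    qed
    then show ?thesis by blast
  qed
  moreover have "?Q ` J m \<subseteq> ?V" using quadratic_syz_comp by auto
  ultimately show ?thesis unfolding basis_mod_def by simp
qed

lemma num_min_syz_eq: "num_min_syz n f (3, m) = card (J m)"
proof -
  have "num_min_syz n f (3, m) = card (quadratic_syz N ` J m)"
    unfolding num_min_syz_def
    by (rule quotient_dim_eq_card[OF subspace_max_syz_comp basis_mod_quadratic])
  also have "\<dots> = card (J m)"
    by (rule card_image) (rule inj_on_subset[OF inj_quadratic_syz subset_UNIV])
  finally show ?thesis .
qed

lemma num_min_syz_support: "{m. num_min_syz n f (3, m) \<noteq> 0} = (\<lambda>j. 2 * int n - int (b j)) ` UNIV"
  unfolding num_min_syz_eq by auto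

lemma sum_num_min_syz: "(\<Sum>m | num_min_syz n f (3, m) \<noteq> 0. num_min_syz n f (3, m)) = 5"
proof -
  let ?h = "\<lambda>j. 2 * int n - int (b j)"
  have "(\<Sum>m | num_min_syz n f (3, m) \<noteq> 0. num_min_syz n f (3, m)) = (\<Sum>m\<in>?h ` UNIV. card (J m))"
    unfolding num_min_syz_support by (simp only: num_min_syz_eq)
  also have "\<dots> = (\<Sum>m\<in>?h ` UNIV. \<Sum>j\<in>{j \<in> UNIV. ?h j = m}. 1)"
    by simp
  also have "\<dots> = (\<Sum>j\<in>(UNIV :: 5 set). 1)"
    by (rule sum.image_gen[symmetric]) simp
  finally show ?thesis by simp
qed

text \<open>B represents a basis of the part of bidegree a of the quotient of Syz by the multiples of the
  variables. Independence is expressed by irredundancy, which makes sense for infinite B as well.\<close>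

definition min_gens_of_bideg :: "int \<times> int \<Rightarrow> ('k bipoly^3) set \<Rightarrow> bool" where
  "min_gens_of_bideg a B \<longleftrightarrow> B \<subseteq> syz_comp n f a \<and>
     syz_comp n f a \<subseteq> kspace.span (B \<union> (max_syz f \<inter> syz_comp n f a)) \<and>
     (\<forall>A\<in>B. A \<notin> kspace.span ((B - {A}) \<union> (max_syz f \<inter> syz_comp n f a)))"

lemma ex_min_gens_of_bideg: "\<exists>B. min_gens_of_bideg a B"
proof -
  let ?V = "syz_comp n f a"
  let ?U = "max_syz f \<inter> ?V"
  obtain U0 where U0: "U0 \<subseteq> ?U" "kspace.independent U0" "?U \<subseteq> kspace.span U0"
    by (rule kspace.maximal_independent_subset)
  obtain B' where B': "U0 \<subseteq> B'" "B' \<subseteq> ?V" "kspace.independent B'" "?V \<subseteq> kspace.span B'"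
    using kspace.maximal_independent_subset_extend[of U0 ?V] U0 by blast
  have "?V \<subseteq> kspace.span ((B' - U0) \<union> ?U)"
    using B'(4) kspace.span_mono[of B' "(B' - U0) \<union> ?U"] U0(1) by blast
  moreover have "A \<notin> kspace.span ((B' - U0 - {A}) \<union> ?U)" if A: "A \<in> B' - U0" for A
  proof
    assume *: "A \<in> kspace.span ((B' - U0 - {A}) \<union> ?U)"
    have "U0 \<subseteq> B' - {A}" using A B'(1) by blast
    then have "?U \<subseteq> kspace.span (B' - {A})" using U0(3) kspace.span_mono by blast
    moreover have "B' - U0 - {A} \<subseteq> kspace.span (B' - {A})" by (auto intro: kspace.span_base)
    ultimately have "kspace.span ((B' - U0 - {A}) \<union> ?U) \<subseteq> kspace.span (B' - {A})"
      by (intro kspace.span_minimal) auto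
    with * A B'(3) show False unfolding kspace.dependent_def by blast
  qed
  ultimately have "min_gens_of_bideg a (B' - U0)"
    unfolding min_gens_of_bideg_def using B'(2) by blast
  then show ?thesis by blast
qed

lemma min_gens_of_bideg_quadratic: "min_gens_of_bideg (3, m) (quadratic_syz N ` J m)"
  using basis_mod_quadratic[of m] basis_mod_irredundant[OF subspace_max_syz_comp basis_mod_quadratic]
  unfolding min_gens_of_bideg_def basis_mod_def by blast

lemma syz_comp_unique:
  assumes "A \<in> syz_comp n f a" "A \<in> syz_comp n f a'" "A \<noteq> 0"
  shows "a = a'"
proof -
  obtain i where "A $ i \<noteq> 0" using assms(3) by (auto simp: vec_eq_iff)
  then obtain m where m: "m \<in> Poly_Mapping.keys (A $ i)" by (metis all_not_in_conv keys_eq_empty)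
  then have "a - (1, int n) = mon_bideg m" "a' - (1, int n) = mon_bideg m"
    using assms(1,2) by (auto simp: syz_comp_iff vhomog_def homog_def)
  then show ?thesis by (metis diff_add_cancel)
qed

text \<open>The graded Nakayama lemma, by induction on the total degree: modulo the elements of B a syzygy is a
  combination of multiples of syzygies of smaller degree, and there are none of negative degree.\<close>

lemma span_contains_syz_comp:
  assumes G: "\<And>a. min_gens_of_bideg a (Bs a)"
  shows "fst a + snd a < int k \<Longrightarrow> syz_comp n f a \<subseteq> vec_module.span (\<Union>a. Bs a)"
proof (induction k arbitrary: a)
  case 0
  have "A = 0" if A: "A \<in> syz_comp n f a" for A
  proof (rule ccontr)
    assume "A \<noteq> 0"
    then obtain i where "A $ i \<noteq> 0" by (auto simp: vec_eq_iff)
    moreover have "homog mon_bideg (fst a - 1, snd a - int n) (A $ i)"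
      using A by (simp add: syz_comp_def R_comp_iff)
    ultimately show False using bideg_nonneg_nonzero 0 by fastforce
  qed
  then show ?case using vec_module.span_zero by blast
next
  case (Suc k)
  let ?S = "vec_module.span (\<Union>a. Bs a)"
  have sub: "kspace.subspace ?S" by (intro kspace_subspace_of_module vec_module.subspace_span)
  have "max_syz f \<inter> syz_comp n f a \<subseteq> ?S"
  proof
    fix A
    assume A: "A \<in> max_syz f \<inter> syz_comp n f a"
    obtain S where S: "\<forall>x. S x \<in> syz_comp n f (a - var_bideg x)"
      "A = (\<Sum>x\<in>{Xs, Xt, Xu, Xv}. var x *s S x)"
      using max_syz_homog A by blast
    have "fst (a - var_bideg x) + snd (a - var_bideg x) < int k" for x
      using Suc.prems by (cases x) (auto simp: var_bideg_def)
    then have "S x \<in> ?S" for x using Suc.IH S(1) by blast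
    then show "A \<in> ?S"
      unfolding S(2) by (intro vec_module.span_sum vec_module.span_scale)
  qed
  moreover have "Bs a \<subseteq> ?S" by (auto intro: vec_module.span_base)
  ultimately have "kspace.span (Bs a \<union> (max_syz f \<inter> syz_comp n f a)) \<subseteq> ?S"
    by (intro kspace.span_minimal sub) auto
  then show ?case using G[of a] unfolding min_gens_of_bideg_def by blast
qed

lemma syz_sum_of_components:
  "\<exists>D. finite D \<and> A = (\<Sum>d\<in>D. vpart mon_bideg d A)" for A :: "'k bipoly^3"
proof -
  define D where "D = (\<Union>i. mon_bideg ` Poly_Mapping.keys (A $ i))"
  have fin: "finite D" by (simp add: D_def)
  have "A $ i = (\<Sum>d\<in>D. part mon_bideg d (A $ i))" for i
  proof (rule poly_mapping_eqI)
    fix m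
    have "mon_bideg m \<in> D \<or> Poly_Mapping.lookup (A $ i) m = 0"
    proof (cases "m \<in> Poly_Mapping.keys (A $ i)")
      case True
      then show ?thesis unfolding D_def by blast
    next
      case False
      then show ?thesis by (simp add: in_keys_iff)
    qed
    then have "(\<Sum>d\<in>D. if mon_bideg m = d then Poly_Mapping.lookup (A $ i) m else 0) =
        Poly_Mapping.lookup (A $ i) m"
      using fin by auto
    then show "Poly_Mapping.lookup (A $ i) m = Poly_Mapping.lookup (\<Sum>d\<in>D. part mon_bideg d (A $ i)) m"
      by (simp add: lookup_sum part.rep_eq)
  qed
  then have "A = (\<Sum>d\<in>D. vpart mon_bideg d A)" by (simp add: vec_eq_iff)
  with fin show ?thesis by blast
qed

lemma span_min_gens:
  assumes G: "\<And>a. min_gens_of_bideg a (Bs a)"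
  shows "vec_module.span (\<Union>a. Bs a) = syz f"
proof
  have "Bs a \<subseteq> syz f" for a using G[of a] by (auto simp: min_gens_of_bideg_def syz_comp_def)
  then show "vec_module.span (\<Union>a. Bs a) \<subseteq> syz f"
    by (intro vec_module.span_minimal subspace_syz) blast
  show "syz f \<subseteq> vec_module.span (\<Union>a. Bs a)"
  proof
    fix A
    assume A: "A \<in> syz f"
    obtain D where D: "A = (\<Sum>d\<in>D. vpart mon_bideg d A)" using syz_sum_of_components by blast
    have "vpart mon_bideg d A \<in> vec_module.span (\<Union>a. Bs a)" for d
    proof -
      let ?a = "d + (1, int n)"
      have "vpart mon_bideg d A \<in> syz_comp n f ?a" using A by (simp add: syz_comp_iff vpart_syz)
      moreover have "fst ?a + snd ?a < int (Suc (nat (fst ?a + snd ?a)))" by linarith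
      ultimately show ?thesis using span_contains_syz_comp[OF G] by blast
    qed
    then have "(\<Sum>d\<in>D. vpart mon_bideg d A) \<in> vec_module.span (\<Union>a. Bs a)"
      by (rule vec_module.span_sum)
    then show "A \<in> vec_module.span (\<Union>a. Bs a)" using D by simp
  qed
qed

text \<open>In the component of bidegree a of a combination of generators, a generator of bidegree a has a
  constant coefficient, and any other one has a coefficient without constant term and contributes
  only to the multiples of the variables.\<close>

lemma part_of_span:
  assumes G: "\<And>a. min_gens_of_bideg a (Bs a)" and H: "H \<subseteq> (\<Union>a. Bs a) - {A}"
    and X: "X \<in> vec_module.span H"
  shows "vpart mon_bideg (a - (1, int n)) X \<in>
    kspace.span ((Bs a - {A}) \<union> (max_syz f \<inter> syz_comp n f a))" (is "?part X \<in> ?S")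
  using X
proof (rule vec_module.span_induct_alt)
  have "?part 0 = 0" by (simp add: vec_eq_iff)
  then show "?part 0 \<in> ?S" by (simp add: kspace.span_zero)
next
  fix p X h
  assume h: "h \<in> H" and X: "?part X \<in> ?S"
  have "?part (p *s h) \<in> ?S"
  proof (cases "h \<in> Bs a")
    case True
    then have hom: "vhomog mon_bideg (a - (1, int n)) h"
      using G[of a] by (auto simp: min_gens_of_bideg_def syz_comp_iff)
    obtain c where c: "part mon_bideg 0 p = const c"
      using homog_bideg_0[OF homog_part] by blast
    have "?part (p *s h) = kscale c h"
      using hom unfolding vhomog_def
      by (simp add: vec_eq_iff kscale_def bideg.part_mult[where e = "a - (1, int n)"] c)
    moreover have "h \<in> Bs a - {A}" using True h H by blast
    then have "h \<in> ?S" by (intro kspace.span_base) blast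
    ultimately show ?thesis by (simp only: kspace.span_scale)
  next
    case False
    then obtain a' where a': "h \<in> Bs a'" "a' \<noteq> a" using h H by blast
    then have hom: "vhomog mon_bideg (a' - (1, int n)) h" and hsyz: "h \<in> syz f"
      using G[of a'] by (auto simp: min_gens_of_bideg_def syz_comp_iff)
    have eq: "?part (p *s h) = part mon_bideg (a - a') p *s h"
      using hom unfolding vhomog_def
      by (simp add: vec_eq_iff bideg.part_mult[where e = "a' - (1, int n)"])
    have "0 \<notin> Poly_Mapping.keys (part mon_bideg (a - a') p)"
      using a'(2) by (auto simp: keys_part)
    then have "?part (p *s h) \<in> max_syz f"
      unfolding eq using hsyz by (rule no_constant_term_max_syz)
    moreover have "?part (p *s h) \<in> syz_comp n f a"
      using vpart_syz[OF syz_scale[OF hsyz]] by (simp add: syz_comp_iff)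
    ultimately show ?thesis by (auto intro: kspace.span_base)
  qed
  moreover have "?part (p *s h + X) = ?part (p *s h) + ?part X"
    by (simp add: vec_eq_iff part_add)
  ultimately show "?part (p *s h + X) \<in> ?S" using X by (simp add: kspace.span_add)
qed

lemma min_bihom_gens_Union:
  assumes G: "\<And>a. min_gens_of_bideg a (Bs a)"
  shows "min_bihom_gens n f (\<Union>a. Bs a)"
  unfolding min_bihom_gens_def
proof (intro conjI ballI allI impI)
  fix A
  assume "A \<in> (\<Union>a. Bs a)"
  then show "\<exists>a. A \<in> syz_comp n f a" using G unfolding min_gens_of_bideg_def by blast
next
  show "vec_module.span (\<Union>a. Bs a) = syz f" by (rule span_min_gens[OF G])
next
  fix H
  assume "H \<subset> (\<Union>a. Bs a)"
  then obtain A a where A: "A \<in> Bs a" "H \<subseteq> (\<Union>a. Bs a) - {A}" by blast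
  then have AV: "A \<in> syz_comp n f a" using G[of a] by (auto simp: min_gens_of_bideg_def)
  show "vec_module.span H \<noteq> syz f"
  proof
    assume "vec_module.span H = syz f"
    then have "A \<in> vec_module.span H" using AV by (simp add: syz_comp_iff)
    from part_of_span[OF G A(2) this, of a]
    have "A \<in> kspace.span ((Bs a - {A}) \<union> (max_syz f \<inter> syz_comp n f a))"
      using AV by (simp add: syz_comp_iff vpart_vhomog)
    then show False using G[of a] A(1) unfolding min_gens_of_bideg_def by blast
  qed
qed

text \<open>A minimal generating set may be assembled from arbitrary bases of the graded pieces modulo the
  multiples of the variables; in the bidegrees (3, m) the quadratic syzygies form such a basis.\<close>

lemma ex_min_bihom_gens:
  "\<exists>G. min_bihom_gens n f G \<and> {A \<in> G. \<exists>m. A \<in> syz_comp n f (3, m)} = range (quadratic_syz N)"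
proof -
  define Bs where "Bs a = (if fst a = 3 then quadratic_syz N ` J (snd a) else SOME B. min_gens_of_bideg a B)" for a
  have G: "min_gens_of_bideg a (Bs a)" for a
    using min_gens_of_bideg_quadratic[of "snd a"] someI_ex[OF ex_min_gens_of_bideg[of a]]
    by (cases a) (auto simp: Bs_def)
  have "{A \<in> \<Union>a. Bs a. \<exists>m. A \<in> syz_comp n f (3, m)} = range (quadratic_syz N)"
  proof (intro equalityI subsetI)
    fix A
    assume "A \<in> {A \<in> \<Union>a. Bs a. \<exists>m. A \<in> syz_comp n f (3, m)}"
    then obtain a m where A: "A \<in> Bs a" "A \<in> syz_comp n f (3, m)" by blast
    have "A \<noteq> 0" using A(1) G[of a] kspace.span_zero unfolding min_gens_of_bideg_def by blast
    moreover have "A \<in> syz_comp n f a" using A(1) G[of a] unfolding min_gens_of_bideg_def by blast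
    ultimately have "a = (3, m)" using syz_comp_unique A(2) by blast
    then show "A \<in> range (quadratic_syz N)" using A(1) by (auto simp: Bs_def)
  next
    fix A
    assume "A \<in> range (quadratic_syz N)"
    then obtain j where j: "A = quadratic_syz N j" by blast
    have "A \<in> Bs (3, 2 * int n - int (b j))" unfolding j Bs_def by auto
    moreover have "A \<in> syz_comp n f (3, 2 * int n - int (b j))"
      unfolding j by (rule quadratic_syz_comp)
    ultimately show "A \<in> {A \<in> \<Union>a. Bs a. \<exists>m. A \<in> syz_comp n f (3, m)}" by blast
  qed
  with min_bihom_gens_Union[OF G] show ?thesis by blast
qed

end

theorem theorem3p4:
  fixes n :: nat
    and q :: "'k::field bipoly ^ 6"
    and f :: "'k bipoly ^ 3"
    and N :: "'k bipoly ^ 5 ^ 6"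
    and b :: "5 \<Rightarrow> nat"
  assumes q_deg: "\<forall>i. q $ i \<in> R_comp (0, int n)"
    and q_indep: "\<forall>c :: 6 \<Rightarrow> 'k. (\<Sum>i\<in>UNIV. const (c i) * q $ i) = 0 \<longrightarrow> (\<forall>i. c i = 0)"
    and f_eq: "f = vector [var Xs * q $ 0 + var Xt * q $ 3,
                           var Xs * q $ 1 + var Xt * q $ 4,
                           var Xs * q $ 2 + var Xt * q $ 5]"
    and bpf: "basepoint_free f"
    and HB: "hilbert_burch q b N"
  shows "(\<forall>m. num_min_syz n f (3, m) = card {j. 2 * int n - int (b j) = m})
    \<and> finite {m. num_min_syz n f (3, m) \<noteq> 0}
    \<and> (\<Sum>m | num_min_syz n f (3, m) \<noteq> 0. num_min_syz n f (3, m)) = 5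
    \<and> inj (quadratic_syz N)
    \<and> (\<forall>j. quadratic_syz N j \<in> syz_comp n f (3, 2 * int n - int (b j)))
    \<and> (\<exists>G. min_bihom_gens n f G
         \<and> {A \<in> G. \<exists>m. A \<in> syz_comp n f (3, m)} = range (quadratic_syz N))"
proof -
  interpret hilbert_burch_setting n q f N b
    by unfold_locales (fact q_deg q_indep f_eq bpf HB)+
  have "finite {m. num_min_syz n f (3, m) \<noteq> 0}"
    unfolding num_min_syz_support by simp
  then show ?thesis
    using num_min_syz_eq sum_num_min_syz inj_quadratic_syz quadratic_syz_comp ex_min_bihom_gens
    by blast
qed

end
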